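(* Let $n\ge2$, $1\le k\le n-1$, and let $T\subset\mathbb R^n$ be a simplex. There exists a constant $C_{k,n}$, depending on the regularity of the simplex $T$, such that for $\mu\in H\Lambda^k(T)\cap H^*\Lambda^k(T)$ $$\|\mathbb I_T\mu\|_{L^2\Lambda^k(T)}+\|\mathrm d^k\mathbb I_T\mu\|_{L^2\Lambda^{k+1}(T)}+\|\delta_k\mathbb I_T\mu\|_{L^2\Lambda^{k-1}(T)}\le C_{k,n}\big(\|\mu\|_{L^2\Lambda^k(T)}+\|\mathrm d^k\mu\|_{L^2\Lambda^{k+1}(T)}+\|\delta_k\mu\|_{L^2\Lambda^{k-1}(T)}\big).$$
   Context: Regularity of a simplex is meant in the usual finite element sense (shape regularity, e.g. the ratio of diameter to inradius). $L^2\Lambda^j(T)$ is the space of differential $j$-forms with $L^2(T)$ coefficients component by component, with inner product $\langle\cdot,\cdot\rangle_{L^2\Lambda^j(T)}$; $\mathrm d^j$ is the exterior derivative on $j$-forms, $\star$ the Hodge star, $\delta_j\mu=(-1)^{jn}\star\mathrm d^{n-j}\star\mu$. $H\Lambda^k(T)=\{\omega\in L^2\Lambda^k(T):\mathrm d^k\omega\in L^2\Lambda^{k+1}(T)\}$, $H^*\Lambda^k(T)=\{\mu\in L^2\Lambda^k(T):\delta_k\mu\in L^2\Lambda^{k-1}(T)\}$. $\mathcal P_0\Lambda^j(T)$ is the space of constant-coefficient $j$-forms on $T$. The Koszul operator is $\kappa(\mathrm dx^{\alpha_1}\wedge\dots\wedge \mathrm dx^{\alpha_j})=\sum_{i=1}^j(-1)^{i+1}x^{\alpha_i}\mathrm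 dx^{\alpha_1}\wedge\dots\wedge\widehat{\mathrm dx^{\alpha_i}}\wedge\dots\wedge \mathrm dx^{\alpha_j}$ (extended linearly; the hat means omission), and $\kappa_T$ is given by the same formula with $x^i$ replaced by $\tilde x^i=x^i-c_i$, $c_i$ the constant such that $\int_T\tilde x^i=0$. For increasing $\alpha=(\alpha_1,\dots,\alpha_k)$ in $\{1,\dots,n\}$ with complementary increasing index $\beta=(\beta_1,\dots,\beta_{n-k})$, set $\tilde\mu^\alpha_{\mathrm d,T}=\sum_{j=1}^{n-k}[(\tilde x^{\beta_j})^2-c^{\beta_j}]\,\mathrm dx^{\alpha_1}\wedge\dots\wedge \mathrm dx^{\alpha_k}$, with constants $c^{\beta_j}$ such that $\int_T[(\tilde x^{\beta_j})^2-c^{\beta_j}]=0$, and $\mathcal H^2_{\mathrm d}\Lambda^k(T)=\mathrm{span}\{\tilde\mu^\alpha_{\mathrm d,T}\}_\alpha$. Define $\mathcal P^-_1\Lambda^{j}(T)=\mathcal P_0\Lambda^{j}(T)+\kappa(\mathcal P_0\Lambda^{j+1}(T))$, $\mathcal P^{*,-}_1\Lambda^{j}(T)=\mathcal P_0\Lambda^{j}(T)+\star\kappa\star(\mathcal P_0\Lambda^{j-1}(T))$, and $$\mathbf P\Lambda^k(T)=\mathcal P_0\Lambda^k(T)\oplus\kappa_T(\mathcal P_0\Lambda^{k+1}(T))\oplus\star\kappa_T\star(\mathcal P_0\Lambda^{k-1}(T))\oplus\mathcal H^2_{\mathrm d}\Lambda^k(T).$$ The interpolator $\mathbb I_T:H\Lambda^k(T)\cap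 H^*\Lambda^k(T)\to\mathbf P\Lambda^k(T)$ assigns to $\mu$ the (unique) $\mathbb I_T\mu\in\mathbf P\Lambda^k(T)$ with $\langle \mathrm d^k\mathbb I_T\mu,\eta\rangle_{L^2\Lambda^{k+1}(T)}-\langle\mathbb I_T\mu,\delta_{k+1}\eta\rangle_{L^2\Lambda^k(T)}=\langle \mathrm d^k\mu,\eta\rangle_{L^2\Lambda^{k+1}(T)}-\langle\mu,\delta_{k+1}\eta\rangle_{L^2\Lambda^k(T)}$ for all $\eta\in\mathcal P_1^{*,-}\Lambda^{k+1}(T)$ and $\langle\delta_k\mathbb I_T\mu,\tau\rangle_{L^2\Lambda^{k-1}(T)}-\langle\mathbb I_T\mu,\mathrm d^{k-1}\tau\rangle_{L^2\Lambda^k(T)}=\langle\delta_k\mu,\tau\rangle_{L^2\Lambda^{k-1}(T)}-\langle\mu,\mathrm d^{k-1}\tau\rangle_{L^2\Lambda^k(T)}$ for all $\tau\in\mathcal P_1^{-}\Lambda^{k-1}(T)$.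
   Formalization: The constant depends, besides k, n and the regularity of T, on an upper bound for the diameter of T; with regularity alone the estimate fails for large simplices (n=2, k=1, T=conv{0,he1,he2}, mu=exp(-x2)dx1, h to infinity). *)

theory Defs
  imports "HOL-Analysis.Analysis"
begin

text \<open>
  The coordinates of \<open>\<real>\<^sup>n\<close> are indexed by a finite linearly ordered type \<open>'n\<close> with \<open>n = CARD('n)\<close>.
  An increasing multi-index is identified with its set of entries, so that an element \<open>w\<close> of the
  exterior algebra is the vector of its coefficients, \<open>w = (\<Sum>I. w $ I dx\<^sup>I)\<close>, where \<open>dx\<^sup>I = axis I 1\<close>
  is the wedge product of the \<open>dx\<^sup>i\<close>, \<open>i \<in> I\<close>, in increasing order. The inner product of
  \<^typ>\<open>real ^ ('n set)\<close> is the one for which the \<open>dx\<^sup>I\<close> are orthonormal.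

  Forms are functions on all of \<open>\<real>\<^sup>n\<close>; only their values on the simplex \<open>T\<close> matter for the
  \<open>L\<^sup>2\<close> quantities below. Polynomial forms are determined by their restriction to \<open>T\<close>.
\<close>

type_synonym 'n form = "real ^ 'n \<Rightarrow> real ^ ('n set)"


subsection \<open>Simplices\<close>

definition inradius :: "(real ^ 'n) set \<Rightarrow> real" where
  "inradius T = Sup {r. 0 \<le> r \<and> (\<exists>x. cball x r \<subseteq> T)}"

definition shape_ratio :: "(real ^ 'n) set \<Rightarrow> real" where
  "shape_ratio T = diameter T / inradius T"


subsection \<open>Exterior algebra\<close>

definition alt :: "nat \<Rightarrow> (real ^ ('n::finite set)) set" where
  "alt j = {w. \<forall>I. card I \<noteq> j \<longrightarrow> w $ I = 0}"

text \<open>The sign in \<open>dx\<^sup>i \<and> dx\<^sup>I = \<plusminus> dx\<^bsup>I \<union> {i}\<^esup>\<close> for \<open>i \<notin> I\<close>; for \<open>i \<in> I\<close> this is \<open>(-1)\<^bsup>p+1\<^esup>\<close> where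
  \<open>p\<close> is the (one-based) position of \<open>i\<close> in \<open>I\<close>.\<close>

definition pos_sign :: "'n::{finite,linorder} \<Rightarrow> 'n set \<Rightarrow> real" where
  "pos_sign i I = (-1) ^ card {l \<in> I. l < i}"

definition dx_wedge :: "'n::{finite,linorder} \<Rightarrow> real ^ ('n set) \<Rightarrow> real ^ ('n set)" where
  "dx_wedge i w = (\<Sum>I | i \<notin> I. (w $ I * pos_sign i I) *\<^sub>R axis (insert i I) 1)"

text \<open>The sign is that of the permutation listing \<open>I\<close> and then its complement, so that
  \<open>dx\<^sup>I \<and> \<star>dx\<^sup>I\<close> is the volume form.\<close>

definition hodge :: "real ^ ('n::{finite,linorder} set) \<Rightarrow> real ^ ('n set)" where
  "hodge w = (\<Sum>I\<in>UNIV. (w $ I * (-1) ^ card {(i, j). i \<in> I \<and> j \<notin> I \<and> j < i}) *\<^sub>R axis (- I) 1)"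

definition star :: "'n::{finite,linorder} form \<Rightarrow> 'n form" where
  "star \<omega> = (\<lambda>x. hodge (\<omega> x))"

text \<open>The Koszul operator with \<open>x\<^sup>i\<close> replaced by \<open>x\<^sup>i - c\<^sub>i\<close>.\<close>

definition koszul :: "real ^ 'n::{finite,linorder} \<Rightarrow> 'n form \<Rightarrow> 'n form" where
  "koszul c \<omega> = (\<lambda>x. \<Sum>I\<in>UNIV. \<omega> x $ I *\<^sub>R
     (\<Sum>i\<in>I. (pos_sign i I * (x $ i - c $ i)) *\<^sub>R axis (I - {i}) 1))"


subsection \<open>Square integrable forms\<close>

definition L2_forms :: "(real ^ 'n) set \<Rightarrow> nat \<Rightarrow> 'n::finite form set" where
  "L2_forms T j = {\<omega>. (\<forall>x\<in>T. \<omega> x \<in> alt j) \<and>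
     (\<forall>I. (\<lambda>x. \<omega> x $ I) \<in> borel_measurable (lebesgue_on T) \<and>
          integrable (lebesgue_on T) (\<lambda>x. (\<omega> x $ I)\<^sup>2))}"

definition L2_inner :: "(real ^ 'n) set \<Rightarrow> 'n::finite form \<Rightarrow> 'n form \<Rightarrow> real" where
  "L2_inner T \<omega> \<eta> = (LINT x|lebesgue_on T. \<omega> x \<bullet> \<eta> x)"

definition L2_norm :: "(real ^ 'n) set \<Rightarrow> 'n::finite form \<Rightarrow> real" where
  "L2_norm T \<omega> = sqrt (L2_inner T \<omega> \<omega>)"


subsection \<open>Weak exterior derivative and codifferential\<close>

definition partial :: "'n::finite \<Rightarrow> (real ^ 'n \<Rightarrow> real) \<Rightarrow> real ^ 'n \<Rightarrow> real" where
  "partial i f = (\<lambda>x. frechet_derivative f (at x) (axis i 1))"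

definition test_functions :: "(real ^ 'n::finite) set \<Rightarrow> (real ^ 'n \<Rightarrow> real) set" where
  "test_functions U = {\<phi>. (\<forall>is x. foldr partial is \<phi> differentiable (at x)) \<and>
     compact (closure {x. \<phi> x \<noteq> 0}) \<and> closure {x. \<phi> x \<noteq> 0} \<subseteq> U}"

text \<open>\<open>\<eta> \<in> L\<^sup>2\<Lambda>\<^bsup>j+1\<^esup>(T)\<close> is the exterior derivative \<open>\<Sum>\<^sub>i dx\<^sup>i \<and> \<partial>\<^sub>i\<omega>\<close> of the \<open>j\<close>-form \<open>\<omega>\<close>, with the
  partial derivatives taken in the sense of distributions on the interior of \<open>T\<close>.\<close>

definition has_weak_d :: "(real ^ 'n::{finite,linorder}) set \<Rightarrow> nat \<Rightarrow> 'n::{finite,linorder} form \<Rightarrow> 'n form \<Rightarrow> bool" where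
  "has_weak_d T j \<omega> \<eta> \<longleftrightarrow> \<eta> \<in> L2_forms T (j + 1) \<and>
     (\<forall>\<phi>\<in>test_functions (interior T).
        (LINT x|lebesgue_on T. \<phi> x *\<^sub>R \<eta> x) =
        - (\<Sum>i\<in>UNIV. dx_wedge i (LINT x|lebesgue_on T. partial i \<phi> x *\<^sub>R \<omega> x)))"

definition HLambda :: "(real ^ 'n::{finite,linorder}) set \<Rightarrow> nat \<Rightarrow> 'n::{finite,linorder} form set" where
  "HLambda T j = {\<omega> \<in> L2_forms T j. \<exists>\<eta>. has_weak_d T j \<omega> \<eta>}"

text \<open>Determined up to null sets when \<open>\<omega> \<in> H\<Lambda>\<^sup>j(T)\<close>, unspecified otherwise.\<close>

definition weak_d :: "(real ^ 'n::{finite,linorder}) set \<Rightarrow> nat \<Rightarrow> 'n::{finite,linorder} form \<Rightarrow> 'n form" where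
  "weak_d T j \<omega> = (SOME \<eta>. has_weak_d T j \<omega> \<eta>)"

definition codiff :: "(real ^ 'n::{finite,linorder}) set \<Rightarrow> nat \<Rightarrow> 'n::{finite,linorder} form \<Rightarrow> 'n form" where
  "codiff T j \<mu> = (\<lambda>x. (-1) ^ (j * CARD('n)) *\<^sub>R star (weak_d T (CARD('n) - j) (star \<mu>)) x)"

text \<open>Since \<open>\<star>\<close> is a pointwise isometry, \<open>\<delta>\<^sub>j\<mu>\<close> is in \<open>L\<^sup>2\<close> iff \<open>d\<^bsup>n-j\<^esup>\<star>\<mu>\<close> is.\<close>

definition HstarLambda :: "(real ^ 'n::{finite,linorder}) set \<Rightarrow> nat \<Rightarrow> 'n::{finite,linorder} form set" where
  "HstarLambda T j = {\<mu> \<in> L2_forms T j. \<exists>\<eta>. has_weak_d T (CARD('n) - j) (star \<mu>) \<eta>}"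


subsection \<open>Polynomial forms\<close>

definition P0 :: "nat \<Rightarrow> 'n::finite form set" where
  "P0 j = {\<lambda>x. w |w. w \<in> alt j}"

definition P1_minus :: "nat \<Rightarrow> 'n::{finite,linorder} form set" where
  "P1_minus j = {\<lambda>x. a x + koszul 0 b x |a b. a \<in> P0 j \<and> b \<in> P0 (j + 1)}"

definition P1_star_minus :: "nat \<Rightarrow> 'n::{finite,linorder} form set" where
  "P1_star_minus j =
     {\<lambda>x. a x + star (koszul 0 (star b)) x |a b. a \<in> P0 j \<and> b \<in> P0 (j - 1)}"

text \<open>The constant \<open>c\<close> for which \<open>f - c\<close> has vanishing integral over \<open>T\<close>.\<close>

definition mean_const :: "(real ^ 'n) set \<Rightarrow> (real ^ 'n::finite \<Rightarrow> real) \<Rightarrow> real" where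
  "mean_const T f = (THE c. (LINT x|lebesgue_on T. f x - c) = 0)"

definition centre :: "(real ^ 'n::finite) set \<Rightarrow> real ^ 'n" where
  "centre T = (\<chi> i. mean_const T (\<lambda>x. x $ i))"

definition mu_d :: "(real ^ 'n) set \<Rightarrow> 'n::finite set \<Rightarrow> 'n form" where
  "mu_d T \<alpha> = (\<lambda>x. (\<Sum>b\<in>- \<alpha>. (x $ b - centre T $ b)\<^sup>2
      - mean_const T (\<lambda>y. (y $ b - centre T $ b)\<^sup>2)) *\<^sub>R axis \<alpha> 1)"

definition H2_d :: "(real ^ 'n) set \<Rightarrow> nat \<Rightarrow> 'n::finite form set" where
  "H2_d T k = {\<lambda>x. \<Sum>\<alpha> | card \<alpha> = k. a \<alpha> *\<^sub>R mu_d T \<alpha> x |a. True}"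

definition PLambda :: "(real ^ 'n::{finite,linorder}) set \<Rightarrow> nat \<Rightarrow> 'n::{finite,linorder} form set" where
  "PLambda T k =
     {\<lambda>x. a x + koszul (centre T) b x + star (koszul (centre T) (star c)) x + h x |a b c h.
        a \<in> P0 k \<and> b \<in> P0 (k + 1) \<and> c \<in> P0 (k - 1) \<and> h \<in> H2_d T k}"


subsection \<open>The interpolator\<close>

definition interpolates ::
  "(real ^ 'n::{finite,linorder}) set \<Rightarrow> nat \<Rightarrow> 'n::{finite,linorder} form \<Rightarrow> 'n form \<Rightarrow> bool" where
  "interpolates T k \<mu> p \<longleftrightarrow> p \<in> PLambda T k \<and>
     (\<forall>\<eta>\<in>P1_star_minus (k + 1).
        L2_inner T (weak_d T k p) \<eta> - L2_inner T p (codiff T (k + 1) \<eta>) =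
        L2_inner T (weak_d T k \<mu>) \<eta> - L2_inner T \<mu> (codiff T (k + 1) \<eta>)) \<and>
     (\<forall>\<tau>\<in>P1_minus (k - 1).
        L2_inner T (codiff T k p) \<tau> - L2_inner T p (weak_d T (k - 1) \<tau>) =
        L2_inner T (codiff T k \<mu>) \<tau> - L2_inner T \<mu> (weak_d T (k - 1) \<tau>))"

definition interpolator ::
  "(real ^ 'n::{finite,linorder}) set \<Rightarrow> nat \<Rightarrow> 'n::{finite,linorder} form \<Rightarrow> 'n form" where
  "interpolator T k \<mu> = (THE p. interpolates T k \<mu> p)"

end

theory Submission
  imports Defs
begin

text \<open>
  Write \<open>X\<^sub>i\<close> for the \<open>i\<close>-th coordinate centred at the barycentre of \<open>T\<close>, let \<open>W\<^sub>i\<close> be the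
  exterior product with \<open>dx\<^sup>i\<close> and \<open>\<iota>\<^sub>i\<close> the contraction with the \<open>i\<close>-th unit vector. Up to a sign depending on the degree, \<open>\<star>\<iota>\<^sub>i\<star>\<close> is \<open>W\<^sub>i\<close>, so that the elements of the
  local space are
  \<open>p = a + \<Sum>\<^sub>i X\<^sub>i \<iota>\<^sub>i b + \<Sum>\<^sub>i X\<^sub>i W\<^sub>i c + \<Sum>\<^sub>i (X\<^sub>i\<^sup>2 - m\<^sub>i) \<iota>\<^sub>i W\<^sub>i h\<close> with constant \<open>a, b, c, h\<close>. Here
  \<open>dp = (k + 1) b + 2 Eh\<close> with \<open>Eh = \<Sum>\<^sub>i X\<^sub>i W\<^sub>i h\<close>, and \<open>\<delta>p\<close> is, up to sign, \<open>(n - k + 1) c\<close>.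

  Since the \<open>X\<^sub>i\<close> and \<open>X\<^sub>i\<^sup>2 - m\<^sub>i\<close> have mean value zero, the equations defining the interpolant are triangular:
  constant test forms determine \<open>c\<close> and \<open>b\<close>, the test forms \<open>\<Sum>\<^sub>i X\<^sub>i \<iota>\<^sub>i v\<close> then determine \<open>a\<close>, and
  the test forms \<open>Ev\<close> finally determine \<open>h\<close> through the Gram matrix \<open>\<langle>Eh, Ev\<rangle>\<close>. Testing each equation with its own
  solution bounds \<open>a, b, c, h\<close>. Shape regularity enters only for \<open>h\<close>, in the estimate
  \<open>|T| diam(T)\<^sup>2 |h|\<^sup>2 \<le> C \<parallel>Eh\<parallel>\<^sup>2\<close>.
\<close>

subsection \<open>Exterior algebra\<close>

text \<open>The obstacle in the estimate is scaling. The equation for \<open>h\<close> contains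
  \<open>\<mu>\<close> and \<open>a\<close> in terms that lack a factor of the diameter; estimating
  them one by one would put a factor 1 / diam(T) in front of the norm of \<open>\<mu>\<close>. The
  equation for \<open>a\<close> says that their difference is, up to a constant, a pairing of the
  codifferential of \<open>\<mu>\<close> with the Koszul form of the test constant, which supplies
  the missing length. The bounds for the derivative and the codifferential of the interpolant are
  then free of the diameter. Only the norm of the interpolant itself, where constants are multiplied
  by coordinates, brings an upper bound of the diameter into the constant.

  A second obstacle lies in the definitions: a weak derivative is an arbitrary witness and the
  interpolator a definite description. Weak derivatives of polynomial forms must first be identified
  almost everywhere with classical ones, which takes integration by parts for existence and the
  fundamental lemma for uniqueness; and unique solvability must be known before anything can be
  estimated.\<close>

definition contract :: "'n::{finite,linorder} \<Rightarrow> real ^ ('n set) \<Rightarrow> real ^ ('n set)" where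
  "contract i w = (\<chi> J. if i \<in> J then 0 else pos_sign i J * w $ insert i J)"

definition shuffle_sign :: "'n::{finite,linorder} set \<Rightarrow> real" where
  "shuffle_sign I = (-1) ^ card {(i, j). i \<in> I \<and> j \<notin> I \<and> j < i}"

text \<open>The orthogonal projection onto \<open>alt j\<close>. It lets linear algebra on the
  subspace be done with maps on the whole coefficient space.\<close>

definition restrict_deg :: "nat \<Rightarrow> real ^ ('n::finite set) \<Rightarrow> real ^ ('n set)" where
  "restrict_deg j w = (\<chi> I. if card I = j then w $ I else 0)"

lemma pos_sign_square [simp]: "pos_sign i I * pos_sign i I = 1"
  by (simp add: pos_sign_def flip: power_add)

lemma pos_sign_insert [simp]: "pos_sign i (insert i I) = pos_sign i I"
  unfolding pos_sign_def by (rule arg_cong[where f="\<lambda>S. (-1) ^ card S"]) auto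

lemma pos_sign_remove [simp]: "pos_sign i (I - {i}) = pos_sign i I"
  unfolding pos_sign_def by (rule arg_cong[where f="\<lambda>S. (-1) ^ card S"]) auto

lemma dx_wedge_nth: "dx_wedge i w $ J = (if i \<in> J then pos_sign i J * w $ (J - {i}) else 0)"
proof -
  have "dx_wedge i w $ J = (\<Sum>I\<in>{I. i \<notin> I}. if I = J - {i} \<and> i \<in> J then w $ I * pos_sign i I else 0)"
    unfolding dx_wedge_def sum_component
    by (rule sum.cong) (auto simp: axis_def)
  also have "\<dots> = (if i \<in> J then pos_sign i J * w $ (J - {i}) else 0)"
    by (cases "i \<in> J") (simp_all add: sum.delta mult.commute)
  finally show ?thesis .
qed

lemma contract_nth: "contract i w $ J = (if i \<in> J then 0 else pos_sign i J * w $ insert i J)"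
  by (simp add: contract_def)

lemma hodge_nth: "hodge w $ J = shuffle_sign (- J) * w $ (- J)"
proof -
  have "hodge w $ J = (\<Sum>I\<in>UNIV. if I = - J then w $ I * shuffle_sign I else 0)"
    unfolding hodge_def sum_component shuffle_sign_def
    by (rule sum.cong) (auto simp: axis_def)
  also have "\<dots> = shuffle_sign (- J) * w $ (- J)"
    by (simp add: mult.commute)
  finally show ?thesis .
qed

lemma card_Compl_finite: "card (- J :: 'n::finite set) = CARD('n) - card J"
  by (simp add: Compl_eq_Diff_UNIV card_Diff_subset)

lemma linear_dx_wedge: "linear (dx_wedge i)"
  by (rule linearI) (auto simp: vec_eq_iff dx_wedge_nth algebra_simps)

lemma linear_contract: "linear (contract i)"
  by (rule linearI) (auto simp: vec_eq_iff contract_nth algebra_simps)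

lemma linear_hodge: "linear hodge"
  by (rule linearI) (auto simp: vec_eq_iff hodge_nth algebra_simps)

text \<open>Together with \<open>contract_contract\<close> this makes the part
  \<open>lin_wedge\<close> of the local space closed and the part \<open>lin_contract\<close>
  coclosed, which decouples the unknowns \<open>b\<close> and \<open>c\<close>.\<close>

lemma dx_wedge_dx_wedge [simp]: "dx_wedge i (dx_wedge i w) = 0"
  by (simp add: vec_eq_iff dx_wedge_nth)

lemma contract_contract [simp]: "contract i (contract i w) = 0"
  by (simp add: vec_eq_iff contract_nth)

lemma contract_dx_wedge_nth: "contract i (dx_wedge i w) $ J = (if i \<in> J then 0 else w $ J)"
  by (simp add: contract_nth dx_wedge_nth mult.assoc[symmetric])

lemma dx_wedge_contract_nth: "dx_wedge i (contract i w) $ J = (if i \<in> J then w $ J else 0)"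
  by (simp add: contract_nth dx_wedge_nth mult.assoc[symmetric] insert_absorb)

lemma subspace_alt: "subspace (alt j)"
  by (auto simp: subspace_def alt_def)

text \<open>A coefficient survives once for every direction outside its index set. This count is the
  factor that the codifferential puts in front of \<open>c\<close>.\<close>

lemma sum_contract_dx_wedge:
  fixes w :: "real ^ ('n::{finite,linorder} set)"
  assumes "w \<in> alt j"
  shows "(\<Sum>i\<in>UNIV. contract i (dx_wedge i w)) = (real CARD('n) - real j) *\<^sub>R w"
proof (subst vec_eq_iff, intro allI)
  fix J :: "'n set"
  have "(\<Sum>i\<in>UNIV. contract i (dx_wedge i w)) $ J = (\<Sum>i\<in>- J. w $ J)"
    unfolding sum_component contract_dx_wedge_nth
    by (rule sum.mono_neutral_cong_right) auto
  also have "\<dots> = (real CARD('n) - real (card J)) * w $ J"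
    by (simp add: card_Compl_finite card_mono of_nat_diff)
  also have "\<dots> = (real CARD('n) - real j) * w $ J"
    using assms by (cases "card J = j") (auto simp: alt_def)
  finally show "(\<Sum>i\<in>UNIV. contract i (dx_wedge i w)) $ J = ((real CARD('n) - real j) *\<^sub>R w) $ J"
    by simp
qed

text \<open>A coefficient survives once for every direction in its index set: the Euler type
  identity behind the factor \<open>k + 1\<close> in front of \<open>b\<close>.\<close>

lemma sum_dx_wedge_contract:
  fixes w :: "real ^ ('n::{finite,linorder} set)"
  assumes "w \<in> alt j"
  shows "(\<Sum>i\<in>UNIV. dx_wedge i (contract i w)) = real j *\<^sub>R w"
proof (subst vec_eq_iff, intro allI)
  fix J :: "'n set"
  have "(\<Sum>i\<in>UNIV. dx_wedge i (contract i w)) $ J = (\<Sum>i\<in>J. w $ J)"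
    unfolding sum_component dx_wedge_contract_nth
    by (rule sum.mono_neutral_cong_right) auto
  also have "\<dots> = real j * w $ J"
    using assms by (cases "card J = j") (auto simp: alt_def)
  finally show "(\<Sum>i\<in>UNIV. dx_wedge i (contract i w)) $ J = (real j *\<^sub>R w) $ J"
    by simp
qed

lemma dx_wedge_alt: "w \<in> alt j \<Longrightarrow> dx_wedge i w \<in> alt (Suc j)"
  by (auto simp: alt_def dx_wedge_nth card_Diff_singleton) (metis One_nat_def card_Suc_Diff1 diff_Suc_1 finite)

lemma contract_alt: "w \<in> alt (Suc j) \<Longrightarrow> contract i w \<in> alt j"
  by (auto simp: alt_def contract_nth)

lemma hodge_alt:
  fixes w :: "real ^ ('n::{finite,linorder} set)"
  assumes "w \<in> alt j" shows "hodge w \<in> alt (CARD('n) - j)"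
proof -
  have "hodge w $ J = 0" if "card J \<noteq> CARD('n) - j" for J :: "'n set"
  proof -
    have "card (- J) \<noteq> j" using that card_Compl_finite[of "- J"] by auto
    then show ?thesis using assms by (simp add: alt_def hodge_nth)
  qed
  then show ?thesis unfolding alt_def by auto
qed

section \<open>Signs of the Hodge star and of conjugation by it\<close>

lemma shuffle_sign_square [simp]: "shuffle_sign I * shuffle_sign I = 1"
  by (simp add: shuffle_sign_def flip: power_add)

text \<open>Every pair in \<open>I \<times> - I\<close> is either an inversion of \<open>I\<close>
  followed by its complement or, swapped, one of the complement followed by \<open>I\<close>; so the
  two exponents add up to the size of the product.\<close>

lemma shuffle_sign_Compl:
  fixes I :: "'n::{finite,linorder} set"
  shows "shuffle_sign I * shuffle_sign (- I) = (-1) ^ (card I * (CARD('n) - card I))"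
proof -
  let ?A = "{(i, j). i \<in> I \<and> j \<notin> I \<and> j < i}"
  let ?B = "{(i, j). i \<in> - I \<and> j \<notin> - I \<and> j < i}"
  have "I \<times> - I = ?A \<union> prod.swap ` ?B"
    by (fastforce simp: image_iff not_less_iff_gr_or_eq)
  moreover have "?A \<inter> prod.swap ` ?B = {}" by auto
  ultimately have "card (I \<times> - I) = card ?A + card (prod.swap ` ?B)"
    by (metis (no_types, lifting) card_Un_disjoint finite)
  also have "card (prod.swap ` ?B) = card ?B"
    by (rule card_image) (simp add: inj_on_def)
  finally show ?thesis
    by (simp add: shuffle_sign_def card_Compl_finite flip: power_add)
qed

lemma hodge_hodge:
  fixes w :: "real ^ ('n::{finite,linorder} set)"
  assumes "w \<in> alt j"
  shows "hodge (hodge w) = (-1) ^ (j * (CARD('n) - j)) *\<^sub>R w"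
  using assms
  by (auto simp: vec_eq_iff hodge_nth alt_def mult.assoc[symmetric] shuffle_sign_Compl
        mult.commute[of "shuffle_sign (- _)"])

text \<open>Moving \<open>i\<close> from \<open>I\<close> to its complement removes the inversions of \<open>i\<close> with the smaller elements
  of the complement and creates those with the larger elements of \<open>I\<close>.\<close>

lemma shuffle_sign_remove:
  fixes I :: "'n::{finite,linorder} set"
  assumes "i \<in> I"
  shows "shuffle_sign I * pos_sign i (- I) = (-1) ^ (card I - 1) * (shuffle_sign (I - {i}) * pos_sign i I)"
proof -
  let ?inv = "\<lambda>I. {(i::'n, j). i \<in> I \<and> j \<notin> I \<and> j < i}"
  let ?C = "{(a, j). a \<in> I - {i} \<and> j \<notin> I \<and> j < a}"
  let ?L = "{l \<in> - I. l < i}" and ?G = "{l \<in> I. i < l}" and ?S = "{l \<in> I. l < i}"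
  have "?inv I = ?C \<union> Pair i ` ?L" using assms by auto
  moreover have "?C \<inter> Pair i ` ?L = {}" by auto
  ultimately have "card (?inv I) = card ?C + card (Pair i ` ?L)"
    by (metis (no_types, lifting) card_Un_disjoint finite)
  then have 1: "card (?inv I) = card ?C + card ?L" by (simp add: card_image inj_on_def)
  have "?inv (I - {i}) = ?C \<union> (\<lambda>l. (l, i)) ` ?G" using assms by auto
  moreover have "?C \<inter> (\<lambda>l. (l, i)) ` ?G = {}" using assms by auto
  ultimately have "card (?inv (I - {i})) = card ?C + card ((\<lambda>l. (l, i)) ` ?G)"
    by (metis (no_types, lifting) card_Un_disjoint finite)
  then have 2: "card (?inv (I - {i})) = card ?C + card ?G" by (simp add: card_image inj_on_def)
  have "I - {i} = ?S \<union> ?G" "?S \<inter> ?G = {}" by auto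
  then have "card (I - {i}) = card ?S + card ?G" by (metis (no_types, lifting) card_Un_disjoint finite)
  then have 3: "card I - 1 = card ?S + card ?G" using assms by simp
  have sq: "(-1::real) ^ m * (-1) ^ m = 1" for m by (simp flip: power_add)
  show ?thesis
    unfolding shuffle_sign_def pos_sign_def 1 2 3 power_add
    by (simp add: mult_ac sq)
qed

text \<open>Only \<open>J\<close> containing \<open>i\<close> matter, and there the identity is
  \<open>shuffle_sign_remove\<close> for \<open>insert i (- J)\<close>. The exponent
  \<open>j - 1\<close> counts the other members of that set, each of them either below or above
  \<open>i\<close>.\<close>

lemma dx_wedge_hodge:
  fixes w :: "real ^ ('n::{finite,linorder} set)"
  assumes "w \<in> alt j"
  shows "dx_wedge i (hodge w) = (-1) ^ (j - 1) *\<^sub>R hodge (contract i w)"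
proof (subst vec_eq_iff, intro allI)
  fix J :: "'n set"
  show "dx_wedge i (hodge w) $ J = ((-1) ^ (j - 1) *\<^sub>R hodge (contract i w)) $ J"
  proof (cases "i \<in> J")
    case True
    let ?I = "insert i (- J)"
    have I: "- (J - {i}) = ?I" "- ?I = J - {i}" "?I - {i} = - J" using True by auto
    have "shuffle_sign ?I * pos_sign i J * w $ ?I =
        (-1) ^ (j - 1) * (shuffle_sign (- J) * pos_sign i (- J)) * w $ ?I"
    proof (cases "card ?I = j")
      case True
      then show ?thesis using shuffle_sign_remove[of i ?I] by (simp add: I)
    next
      case False
      then show ?thesis using assms by (simp add: alt_def)
    qed
    then show ?thesis using True by (simp add: dx_wedge_nth contract_nth hodge_nth I mult_ac)
  qed (simp add: dx_wedge_nth contract_nth hodge_nth)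
qed

text \<open>The first factor is the sign of \<open>dx_wedge_hodge\<close> in degree
  \<open>n - j\<close>, the second that of the double star in degree \<open>j\<close>.\<close>

definition koszul_sign :: "nat \<Rightarrow> nat \<Rightarrow> real" where
  "koszul_sign n j = (-1) ^ (n - j - 1) * (-1) ^ (j * (n - j))"

lemma koszul_sign_square [simp]: "koszul_sign n j * koszul_sign n j = 1"
  by (simp add: koszul_sign_def flip: power_add)

lemma hodge_contract_hodge:
  fixes w :: "real ^ ('n::{finite,linorder} set)"
  assumes w: "w \<in> alt j"
  shows "hodge (contract i (hodge w)) = koszul_sign CARD('n) j *\<^sub>R dx_wedge i w"
proof -
  let ?n = "CARD('n)"
  have "dx_wedge i (hodge (hodge w)) = (-1) ^ (?n - j - 1) *\<^sub>R hodge (contract i (hodge w))"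
    by (rule dx_wedge_hodge) (rule hodge_alt[OF w])
  then have "(-1) ^ (?n - j - 1) *\<^sub>R dx_wedge i (hodge (hodge w)) = hodge (contract i (hodge w))"
    by (simp flip: power_add)
  then show ?thesis
    by (simp add: hodge_hodge[OF w] linear_cmul[OF linear_dx_wedge] koszul_sign_def)
qed

text \<open>In order: the sign in the definition of the codifferential, that of
  \<open>dx_wedge_hodge\<close> in degree \<open>j\<close>, and that of the double star in degree
  \<open>j - 1\<close>. The estimates see only its modulus.\<close>

definition codiff_sign :: "nat \<Rightarrow> nat \<Rightarrow> real" where
  "codiff_sign n j = (-1) ^ (j * n) * ((-1) ^ (j - 1) * (-1) ^ ((j - 1) * (n - (j - 1))))"

lemma abs_codiff_sign [simp]: "\<bar>codiff_sign n j\<bar> = 1"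
  by (simp add: codiff_sign_def abs_mult power_abs)

lemma hodge_dx_wedge_hodge:
  fixes w :: "real ^ ('n::{finite,linorder} set)"
  assumes w: "w \<in> alt j" and "1 \<le> j"
  shows "(-1) ^ (j * CARD('n)) *\<^sub>R hodge (dx_wedge i (hodge w)) = codiff_sign CARD('n) j *\<^sub>R contract i w"
proof -
  have "contract i w \<in> alt (j - 1)" using contract_alt[of w "j - 1"] assms by simp
  then show ?thesis
    by (simp add: dx_wedge_hodge[OF w] linear_cmul[OF linear_hodge] hodge_hodge codiff_sign_def)
qed

text \<open>Removing and inserting \<open>i\<close> are inverse bijections between the index sets
  with and without \<open>i\<close>, and they preserve the sign; hence the two operations are
  adjoint.\<close>

lemma inner_dx_wedge: "dx_wedge i u \<bullet> v = u \<bullet> contract i v"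
proof -
  have "dx_wedge i u \<bullet> v = (\<Sum>J\<in>{J. i \<in> J}. u $ (J - {i}) * pos_sign i J * v $ J)"
    unfolding inner_vec_def by (rule sum.mono_neutral_cong_right) (auto simp: dx_wedge_nth mult_ac)
  also have "\<dots> = (\<Sum>I\<in>{I. i \<notin> I}. u $ I * pos_sign i I * v $ insert i I)"
    by (rule sum.reindex_bij_witness[of _ "insert i" "\<lambda>J. J - {i}"]) (auto simp: insert_absorb)
  also have "\<dots> = u \<bullet> contract i v"
    unfolding inner_vec_def by (rule sum.mono_neutral_cong_left) (auto simp: contract_nth mult_ac)
  finally show ?thesis .
qed

text \<open>By adjointness this is \<open>sum_contract_dx_wedge\<close> paired with
  \<open>w\<close>. For \<open>j\<close> below the dimension the factor is at least 1, which is the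
  algebraic reason for the definiteness of the Gram form of \<open>h\<close>.\<close>

lemma sum_norm_dx_wedge:
  fixes w :: "real ^ ('n::{finite,linorder} set)"
  assumes "w \<in> alt j"
  shows "(\<Sum>i\<in>UNIV. (norm (dx_wedge i w))\<^sup>2) = (real CARD('n) - real j) * (norm w)\<^sup>2"
proof -
  have "(\<Sum>i\<in>UNIV. (norm (dx_wedge i w))\<^sup>2) = w \<bullet> (\<Sum>i\<in>UNIV. contract i (dx_wedge i w))"
    by (simp add: inner_sum_right inner_dx_wedge flip: dot_square_norm)
  then show ?thesis by (simp add: sum_contract_dx_wedge[OF assms] dot_square_norm)
qed

text \<open>Wedging and then contracting keeps exactly the coefficients without \<open>i\<close>,
  the only ones that another wedge can see. This turns the derivative of the quadratic part into a
  plain multiple of \<open>lin_wedge\<close>.\<close>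

lemma dx_wedge_contract_dx_wedge [simp]: "dx_wedge i (contract i (dx_wedge i w)) = dx_wedge i w"
  by (simp add: vec_eq_iff dx_wedge_nth contract_dx_wedge_nth)

lemma norm_dx_wedge_le: "norm (dx_wedge i w) \<le> norm w"
proof -
  have "(norm (dx_wedge i w))\<^sup>2 = (\<Sum>J\<in>{J. i \<in> J}. (w $ (J - {i}))\<^sup>2)"
    unfolding norm_vec_def L2_set_def
    by (subst real_sqrt_pow2, simp add: sum_nonneg, rule sum.mono_neutral_cong_right)
       (auto simp: dx_wedge_nth power_mult_distrib power2_eq_square[of "pos_sign _ _"])
  also have "\<dots> = (\<Sum>J\<in>(\<lambda>J. J - {i}) ` {J. i \<in> J}. (w $ J)\<^sup>2)"
    by (subst sum.reindex) (auto simp: inj_on_def)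
  also have "\<dots> \<le> (\<Sum>J\<in>UNIV. (w $ J)\<^sup>2)" by (rule sum_mono2) auto
  also have "\<dots> = (norm w)\<^sup>2"
    unfolding norm_vec_def L2_set_def by (simp add: sum_nonneg)
  finally show ?thesis by (simp add: power2_le_iff_abs_le)
qed

lemma norm_contract_le: "norm (contract i w) \<le> norm w"
proof -
  have "(norm (contract i w))\<^sup>2 = (\<Sum>J\<in>{J. i \<notin> J}. (w $ insert i J)\<^sup>2)"
    unfolding norm_vec_def L2_set_def
    by (subst real_sqrt_pow2, simp add: sum_nonneg, rule sum.mono_neutral_cong_right)
       (auto simp: contract_nth power_mult_distrib power2_eq_square[of "pos_sign _ _"])
  also have "\<dots> = (\<Sum>J\<in>insert i ` {J. i \<notin> J}. (w $ J)\<^sup>2)"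
    by (subst sum.reindex) (auto simp: inj_on_def)
  also have "\<dots> \<le> (\<Sum>J\<in>UNIV. (w $ J)\<^sup>2)" by (rule sum_mono2) auto
  also have "\<dots> = (norm w)\<^sup>2"
    unfolding norm_vec_def L2_set_def by (simp add: sum_nonneg)
  finally show ?thesis by (simp add: power2_le_iff_abs_le)
qed

section \<open>Linear functionals on forms of a fixed degree\<close>

lemma linear_restrict_deg: "linear (restrict_deg j)"
  by (rule linearI) (auto simp: vec_eq_iff restrict_deg_def)

lemma restrict_deg_alt: "restrict_deg j w \<in> alt j"
  by (simp add: restrict_deg_def alt_def)

lemma restrict_deg_id: "w \<in> alt j \<Longrightarrow> restrict_deg j w = w"
  by (auto simp: restrict_deg_def alt_def vec_eq_iff)

text \<open>Extending \<open>B\<close> by the inner product on the complement makes it definite on the whole space, where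
  an injective linear map is surjective.\<close>

lemma definite_form_represents_alt:
  fixes B :: "real ^ ('n::finite set) \<Rightarrow> real ^ ('n set) \<Rightarrow> real"
  assumes B: "bilinear B" and pos: "\<And>v. v \<in> alt j \<Longrightarrow> v \<noteq> 0 \<Longrightarrow> B v v > 0" and f: "linear f"
  shows "\<exists>!u. u \<in> alt j \<and> (\<forall>v\<in>alt j. B u v = (f v :: real))"
proof (rule ex_ex1I)
  let ?P = "restrict_deg j :: real ^ ('n set) \<Rightarrow> _"
  define B' where "B' u v = B (?P u) (?P v) + (u - ?P u) \<bullet> (v - ?P v)" for u v
  have linB: "linear (\<lambda>v. B' u v)" "linear (\<lambda>u. B' u v)" for u v
    unfolding B'_def
    by (rule linearI; simp add: linear_add[OF linear_restrict_deg] linear_cmul[OF linear_restrict_deg]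
        bilinear_radd[OF B] bilinear_rmul[OF B] bilinear_ladd[OF B] bilinear_lmul[OF B]
        inner_diff_left inner_diff_right inner_add_left inner_add_right algebra_simps)+
  \<comment> \<open>The operator that represents \<open>B'\<close> through the inner product; its
    injectivity is the definiteness of \<open>B'\<close>.\<close>
  define A where "A u = (\<Sum>b\<in>Basis. B' u b *\<^sub>R b)" for u
  have A_inner: "A u \<bullet> v = B' u v" for u v
  proof -
    have "B' u v = B' u (\<Sum>b\<in>Basis. (v \<bullet> b) *\<^sub>R b)" by (simp add: euclidean_representation)
    also have "\<dots> = (\<Sum>b\<in>Basis. (v \<bullet> b) * B' u b)"
      by (simp add: linear_sum[OF linB(1)] linear_cmul[OF linB(1)])
    finally show ?thesis by (simp add: A_def inner_sum_left inner_commute[of v] mult.commute)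
  qed
  have linA: "linear A"
    by (rule linearI) (simp_all add: A_def linear_add[OF linB(2)] linear_cmul[OF linB(2)]
        scaleR_left_distrib sum.distrib scaleR_sum_right)
  have "u = 0" if "A u = 0" for u
  proof -
    have 0: "B (?P u) (?P u) + (u - ?P u) \<bullet> (u - ?P u) = 0"
      using A_inner[of u u] that by (simp add: B'_def)
    have "B (?P u) (?P u) \<ge> 0"
      using pos[OF restrict_deg_alt, of u] by (cases "?P u = 0") (auto simp: bilinear_lzero[OF B])
    with 0 have "B (?P u) (?P u) = 0" "u - ?P u = 0"
      by (smt (verit) inner_ge_zero inner_eq_zero_iff)+
    with pos[OF restrict_deg_alt, of u] show "u = 0" by force
  qed
  then have "inj A" by (simp add: linear_injective_0[OF linA])
  then have "surj A" using linA by (simp add: linear_injective_imp_surjective)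
  \<comment> \<open>The right-hand side is the vector representing \<open>f \<circ> ?P\<close>.
    Against \<open>v\<close> of degree \<open>j\<close> the complementary term of \<open>B'\<close>
    vanishes, so the projection of \<open>u\<close> solves the original problem.\<close>
  then obtain u where u: "A u = (\<Sum>b\<in>Basis. f (?P b) *\<^sub>R b)" by (metis surjD)
  have "B (?P u) v = f v" if v: "v \<in> alt j" for v
  proof -
    have "f v = f (?P (\<Sum>b\<in>Basis. (v \<bullet> b) *\<^sub>R b))" by (simp add: euclidean_representation restrict_deg_id v)
    also have "\<dots> = (\<Sum>b\<in>Basis. (v \<bullet> b) * f (?P b))"
      by (simp add: linear_sum[OF linear_restrict_deg] linear_cmul[OF linear_restrict_deg]
          linear_sum[OF f] linear_cmul[OF f])
    also have "\<dots> = A u \<bullet> v" by (simp add: u inner_sum_left inner_commute[of v] mult.commute)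
    also have "\<dots> = B (?P u) v" by (simp add: A_inner B'_def restrict_deg_id v)
    finally show ?thesis by simp
  qed
  with restrict_deg_alt show "\<exists>u. u \<in> alt j \<and> (\<forall>v\<in>alt j. B u v = f v)" by blast
next
  fix u u' assume u: "u \<in> alt j \<and> (\<forall>v\<in>alt j. B u v = f v)" "u' \<in> alt j \<and> (\<forall>v\<in>alt j. B u' v = f v)"
  then have diff: "u - u' \<in> alt j" by (simp add: subspace_diff[OF subspace_alt])
  with u have "B (u - u') (u - u') = 0" by (simp add: bilinear_lsub[OF B])
  with pos[OF diff] show "u = u'" by force
qed

subsection \<open>The fundamental lemma of the calculus of variations\<close>

text \<open>The function exp(-1/t), extended by zero, times powers of 1/t: the smallest natural
  family that contains the standard flat function and whose derivatives are linear combinations of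
  members.\<close>

definition flat :: "nat \<Rightarrow> real \<Rightarrow> real" where
  "flat j t = (if t \<le> 0 then 0 else exp (- inverse t) * inverse t ^ j)"

lemma flat_tendsto_0: "(flat j \<longlongrightarrow> 0) (at 0)"
proof -
  have "((\<lambda>t. inverse t ^ j / exp (inverse t)) \<longlongrightarrow> 0) (at_right (0::real))"
    by (rule filterlim_compose[OF tendsto_power_div_exp_0 filterlim_inverse_at_top_right])
  then have "(flat j \<longlongrightarrow> 0) (at_right 0)"
    by (rule Lim_transform_eventually)
       (auto simp: eventually_at_filter flat_def exp_minus field_simps)
  moreover have "(flat j \<longlongrightarrow> 0) (at_left 0)"
    by (rule tendsto_eventually) (auto simp: eventually_at_filter flat_def)
  ultimately show ?thesis by (simp add: filterlim_split_at)
qed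

lemma flat_has_derivative:
  "(flat j has_real_derivative flat (j + 2) t - real j * flat (j + 1) t) (at t)"
proof (cases t "0 :: real" rule: linorder_cases)
  case less
  have "((\<lambda>t. 0) has_real_derivative 0) (at t)" by simp
  then have "(flat j has_real_derivative 0) (at t)"
    by (rule has_field_derivative_transform_within_open[of _ _ _ "{..<0}"])
       (use less in \<open>auto simp: flat_def\<close>)
  with less show ?thesis by (simp add: flat_def)
next
  case equal
  \<comment> \<open>Since \<open>flat j 0 = 0\<close>, the difference quotient at the origin is
    itself a member of the family, so one limit settles all orders.\<close>
  have "(\<lambda>h. flat j h / h) = flat (j + 1)"
    by (auto simp: flat_def fun_eq_iff field_simps)
  then show ?thesis using flat_tendsto_0[of "j + 1"] equal
    by (simp add: DERIV_def flat_def)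
next
  case greater
  have "((\<lambda>t. exp (- inverse t) * inverse t ^ j) has_real_derivative
      flat (j + 2) t - real j * flat (j + 1) t) (at t)"
    using greater
    by (auto intro!: derivative_eq_intros simp: flat_def power_Suc) (cases j; simp add: field_simps)
  then show ?thesis
    by (rule has_field_derivative_transform_within_open[of _ _ _ "{0<..}"])
       (use greater in \<open>auto simp: flat_def\<close>)
qed

text \<open>A class closed under partial derivatives. Smoothness in the sense of iterated
  \<open>partial\<close> is then an induction on the list of directions, with no formula for higher
  derivatives of products.\<close>

inductive_set flat_algebra :: "(real ^ 'n::finite \<Rightarrow> real) set" where
  const: "(\<lambda>x. c) \<in> flat_algebra"
| gen: "(\<lambda>x. flat j (c * x $ m + d)) \<in> flat_algebra"
| add: "f \<in> flat_algebra \<Longrightarrow> g \<in> flat_algebra \<Longrightarrow> (\<lambda>x. f x + g x) \<in> flat_algebra"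
| mult: "f \<in> flat_algebra \<Longrightarrow> g \<in> flat_algebra \<Longrightarrow> (\<lambda>x. f x * g x) \<in> flat_algebra"

lemma partial_eqI: "(\<And>x. (f has_derivative f' x) (at x)) \<Longrightarrow> partial i f = (\<lambda>x. f' x (axis i 1))"
  unfolding partial_def by (metis frechet_derivative_at)

lemma flat_algebra_partial:
  "f \<in> flat_algebra \<Longrightarrow> (\<forall>x. f differentiable (at x)) \<and> (\<forall>i. partial i f \<in> flat_algebra)"
proof (induction rule: flat_algebra.induct)
  case (const c)
  have "partial i (\<lambda>x::real^'a. c) = (\<lambda>x. 0)" for i by (rule partial_eqI) simp
  then show ?case by (auto intro: flat_algebra.const)
next
  case (gen j c m d)
  \<comment> \<open>The difference in \<open>flat_has_derivative\<close> is written as a sum with a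
    negative constant, because the algebra is generated by sums and products.\<close>
  have D: "((\<lambda>x::real^'a. flat j (c * x $ m + d)) has_derivative
      (\<lambda>v. (flat (j + 2) (c * x $ m + d) + - real j * flat (j + 1) (c * x $ m + d)) * (c * v $ m))) (at x)" for x
    by (rule has_derivative_eq_rhs,
        rule DERIV_compose_FDERIV[OF flat_has_derivative[of j]])
       (auto intro!: derivative_eq_intros bounded_linear_imp_has_derivative[OF bounded_linear_vec_nth])
  have "partial i (\<lambda>x::real^'a. flat j (c * x $ m + d)) = (\<lambda>x. (flat (j + 2) (c * x $ m + d)
      + - real j * flat (j + 1) (c * x $ m + d)) * (c * axis i 1 $ m))" for i
    by (rule partial_eqI[OF D])
  also have "(\<lambda>x. (flat (j + 2) (c * x $ m + d) + - real j * flat (j + 1) (c * x $ m + d)) * (c * axis i 1 $ m))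
      \<in> flat_algebra" for i
    by (intro flat_algebra.intros)
  finally show ?case using D
    by (auto simp: differentiable_def)
next
  case (add f g)
  have D: "((\<lambda>x. f x + g x) has_derivative (\<lambda>v. frechet_derivative f (at x) v + frechet_derivative g (at x) v)) (at x)" for x
    using add.IH by (intro has_derivative_add) (auto simp flip: frechet_derivative_works)
  have "partial i (\<lambda>x. f x + g x) = (\<lambda>x. partial i f x + partial i g x)" for i
    unfolding partial_eqI[OF D] by (simp add: partial_def)
  then show ?case using D add.IH
    by (auto simp: differentiable_def intro!: flat_algebra.intros)
next
  case (mult f g)
  have D: "((\<lambda>x. f x * g x) has_derivative (\<lambda>v. f x * frechet_derivative g (at x) v + frechet_derivative f (at x) v * g x)) (at x)" for x
    using mult.IH by (intro has_derivative_mult) (auto simp flip: frechet_derivative_works)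
  have "partial i (\<lambda>x. f x * g x) = (\<lambda>x. f x * partial i g x + partial i f x * g x)" for i
    unfolding partial_eqI[OF D] by (simp add: partial_def)
  then show ?case using D mult
    by (auto simp: differentiable_def intro!: flat_algebra.intros)
qed

lemma flat_algebra_smooth:
  assumes "f \<in> flat_algebra" shows "foldr partial is f differentiable (at x)"
proof -
  have "foldr partial is f \<in> flat_algebra"
    using assms by (induction "is") (auto simp: flat_algebra_partial)
  then show ?thesis by (simp add: flat_algebra_partial)
qed

lemma flat_algebra_prod:
  "finite I \<Longrightarrow> (\<And>i. i \<in> I \<Longrightarrow> f i \<in> flat_algebra) \<Longrightarrow> (\<lambda>x. \<Prod>i\<in>I. f i x) \<in> flat_algebra"
  by (induction rule: finite_induct) (auto intro: flat_algebra.intros)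

text \<open>In the box each factor is exp(-1/((m + 1) s)), where s is the distance to a face. The
  scaling by \<open>Suc m\<close> drives it to 1 there while the support stays in the closed
  box.\<close>

definition bump :: "real ^ 'n::finite \<Rightarrow> real ^ 'n \<Rightarrow> nat \<Rightarrow> real ^ 'n \<Rightarrow> real" where
  "bump a b m x = (\<Prod>i\<in>UNIV. flat 0 (real (Suc m) * (x $ i - a $ i)) * flat 0 (real (Suc m) * (b $ i - x $ i)))"

lemma bump_eq_0: "x \<notin> box a b \<Longrightarrow> bump a b m x = 0"
  by (auto simp: bump_def mem_box_cart flat_def not_less mult_le_0_iff)

lemma flat_0_le_1: "0 \<le> flat 0 t" "flat 0 t \<le> 1"
  by (auto simp: flat_def)

lemma bump_bounds: "0 \<le> bump a b m x" "bump a b m x \<le> 1"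
  unfolding bump_def
  by (auto intro!: prod_nonneg prod_le_1 mult_le_one mult_nonneg_nonneg flat_0_le_1)

lemma bump_in_test_functions:
  assumes "cbox a b \<subseteq> U" shows "bump a b m \<in> test_functions U"
proof -
  have "bump a b m = (\<lambda>x. \<Prod>i\<in>UNIV. flat 0 (real (Suc m) * x $ i + - real (Suc m) * a $ i)
      * flat 0 (- real (Suc m) * x $ i + real (Suc m) * b $ i))"
    by (simp add: bump_def fun_eq_iff algebra_simps)
  also have "\<dots> \<in> flat_algebra"
    by (intro flat_algebra_prod flat_algebra.mult flat_algebra.gen) auto
  finally have 1: "bump a b m \<in> flat_algebra" .
  have "{x. bump a b m x \<noteq> 0} \<subseteq> cbox a b"
    using bump_eq_0[of _ a b m] box_subset_cbox[of a b] by auto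
  then have 2: "closure {x. bump a b m x \<noteq> 0} \<subseteq> cbox a b"
    by (simp add: closure_minimal closed_cbox)
  then have "compact (closure {x. bump a b m x \<noteq> 0})"
    by (meson bounded_cbox bounded_subset closed_closure compact_eq_bounded_closed)
  with 1 2 assms show ?thesis
    unfolding test_functions_def by (auto intro: flat_algebra_smooth)
qed

lemma bump_tendsto: "(\<lambda>m. bump a b m x) \<longlonglongrightarrow> indicator (box a b) x"
proof (cases "x \<in> box a b")
  case True
  have 1: "(\<lambda>m. flat 0 (real (Suc m) * s)) \<longlonglongrightarrow> 1" if "s > 0" for s
  proof -
    have "(\<lambda>m. exp (- (inverse (real (Suc m)) * inverse s))) \<longlonglongrightarrow> exp (- (0 * inverse s))"
      by (intro tendsto_intros LIMSEQ_inverse_real_of_nat)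
    moreover have "flat 0 (real (Suc m) * s) = exp (- (inverse (real (Suc m)) * inverse s))" for m
      using that by (simp add: flat_def mult_le_0_iff)
    ultimately show ?thesis by simp
  qed
  have "(\<lambda>m. bump a b m x) \<longlonglongrightarrow> (\<Prod>i\<in>(UNIV::'a set). 1 * 1)"
    unfolding bump_def by (intro tendsto_intros 1) (use True in \<open>auto simp: mem_box_cart\<close>)
  with True show ?thesis by simp
qed (simp add: bump_eq_0)

text \<open>Dynkin's lemma for the generator of open boxes.\<close>

lemma AE_eq_0_if_box_integrals_eq_0:
  fixes F :: "'a::euclidean_space \<Rightarrow> real"
  assumes F: "integrable lborel F" and box: "\<And>a b. (LINT x:box a b|lborel. F x) = 0"
  shows "AE x in lborel. F x = 0"
proof -
  have [measurable]: "F \<in> borel_measurable borel" using F by auto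
  have int: "set_integrable lborel A F" if "A \<in> sets borel" for A
    using F that unfolding set_integrable_def by (intro integrable_mult_indicator) auto
  \<comment> \<open>The whole space is an increasing union of boxes, so the integral over it
    vanishes as well; the complement step of the induction relies on this.\<close>
  have "box (- real n *\<^sub>R One) (real n *\<^sub>R One) \<subseteq> box (- real m *\<^sub>R One) (real m *\<^sub>R (One::'a))"
    if "n \<le> m" for n m
    using that by (intro subset_box_imp(4)) auto
  then have "incseq (\<lambda>n. box (- real n *\<^sub>R One) (real n *\<^sub>R (One::'a)))"
    by (simp add: incseq_def)
  then have "(\<lambda>n. LINT x:box (- real n *\<^sub>R One) (real n *\<^sub>R One)|lborel. F x) \<longlonglongrightarrow>
      (LINT x:(\<Union>n. box (- real n *\<^sub>R One) (real n *\<^sub>R One))|lborel. F x)"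
    by (intro set_integral_cont_up int) auto
  then have UNIV: "(LINT x:UNIV|lborel. F x) = 0"
    by (simp add: box UN_box_eq_UNIV LIMSEQ_const_iff)
  have "(LINT x:A|lborel. F x) = 0" if A: "A \<in> sets borel" for A
  proof -
    have "Int_stable (range (\<lambda>(a, b). box a b :: 'a set))"
      by (auto simp: Int_stable_def box_Int_box)
    moreover have "range (\<lambda>(a, b). box a b :: 'a set) \<subseteq> Pow UNIV" by simp
    moreover have "A \<in> sigma_sets UNIV (range (\<lambda>(a, b). box a b))"
      using A by (simp add: borel_eq_box)
    ultimately show ?thesis
    proof (induction rule: sigma_sets_induct_disjoint)
      case (basic A)
      then show ?case using box by auto
    next
      case (compl A)
      then have A: "A \<in> sets borel" by (simp add: borel_eq_box)
      have "(LINT x:A \<union> (UNIV - A)|lborel. F x) = (LINT x:A|lborel. F x) + (LINT x:UNIV - A|lborel. F x)"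
        using A by (intro set_integral_Un int) auto
      with compl UNIV show ?case by simp
    next
      case (union A)
      then have A: "A i \<in> sets borel" for i by (auto simp: borel_eq_box)
      have "(LINT x:(\<Union>i. A i)|lborel. F x) = (\<Sum>i. (LINT x:A i|lborel. F x))"
        using union(1) A by (intro lebesgue_integral_countable_add int) (auto simp: disjoint_family_on_def)
      with union show ?case by simp
    qed (simp add: set_lebesgue_integral_def)
  qed note zero = this
  have pos: "AE x in lborel. \<bar>F x\<bar> = 0"
  proof -
    \<comment> \<open>Integrating over the set where \<open>F\<close> is nonnegative and over its
      complement separately yields the integral of the modulus.\<close>
    let ?P = "{x. F x \<ge> 0}"
    have "(LINT x:?P|lborel. F x) - (LINT x:- ?P|lborel. F x)
        = (LINT x|lborel. indicator ?P x *\<^sub>R F x - indicator (- ?P) x *\<^sub>R F x)"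
      unfolding set_lebesgue_integral_def
      by (rule Bochner_Integration.integral_diff[symmetric])
         (rule int[unfolded set_integrable_def], measurable)+
    also have "\<dots> = (LINT x|lborel. \<bar>F x\<bar>)"
      by (intro Bochner_Integration.integral_cong) (auto simp: indicator_def)
    finally have "(LINT x|lborel. \<bar>F x\<bar>) = (LINT x:?P|lborel. F x) - (LINT x:- ?P|lborel. F x)" ..
    also have "\<dots> = 0" by (subst (1 2) zero) auto
    finally show ?thesis using F by (subst (asm) integral_nonneg_eq_0_iff_AE) auto
  qed
  then show ?thesis by simp
qed

text \<open>A Borel representative of \<open>F\<close> transfers the question to
  \<open>lborel\<close>, whose measurable sets are generated by the boxes.\<close>

lemma AE_eq_0_lebesgue_if_box_integrals_eq_0:
  fixes F :: "'a::euclidean_space \<Rightarrow> real"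
  assumes F: "integrable lebesgue F" and box: "\<And>a b. (LINT x:box a b|lebesgue. F x) = 0"
  shows "AE x in lebesgue. F x = 0"
proof -
  obtain F' where F': "F' \<in> borel_measurable lborel" and "AE x in lborel. F x = F' x"
    using completion_ex_borel_measurable_real[of F lborel] F by auto
  then have ae: "AE x in lebesgue. F x = F' x" by (simp add: AE_completion)
  have m: "F' \<in> borel_measurable lebesgue" using F' by (rule measurable_completion)
  have "integrable lebesgue F'"
    using F integrable_cong_AE[OF _ m ae] by auto
  then have int: "integrable lborel F'" using F' by (simp add: integrable_completion)
  have "(LINT x:box a b|lborel. F' x) = 0" for a b
  proof -
    have "(LINT x:box a b|lborel. F' x) = (LINT x:box a b|lebesgue. F' x)"
      unfolding set_lebesgue_integral_def using F' by (subst integral_completion) auto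
    also have "\<dots> = (LINT x:box a b|lebesgue. F x)"
      unfolding set_lebesgue_integral_def
    proof (rule integral_cong_AE)
      show "(\<lambda>x. indicat_real (box a b) x *\<^sub>R F x) \<in> borel_measurable lebesgue"
        using F by (intro borel_measurable_scaleR borel_measurable_indicator) auto
      show "(\<lambda>x. indicat_real (box a b) x *\<^sub>R F' x) \<in> borel_measurable lebesgue"
        using m by (intro borel_measurable_scaleR borel_measurable_indicator) auto
    qed (use ae in auto)
    finally show ?thesis by (simp add: box)
  qed
  then have "AE x in lborel. F' x = 0" by (rule AE_eq_0_if_box_integrals_eq_0[OF int])
  then have "AE x in lebesgue. F' x = 0" by (rule AE_completion)
  with ae show ?thesis by eventually_elim simp
qed

text \<open>Bumps converge boundedly to indicators of boxes, so by dominated convergence the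
  hypothesis extends to boxes whose closure lies in the interior. The box criterion is then applied
  locally, to \<open>f\<close> cut off to such a box, and the local results are glued over the
  interior.\<close>

lemma fundamental_lemma:
  fixes f :: "real ^ 'n::finite \<Rightarrow> real"
  assumes T: "T \<in> sets lebesgue" and fr: "negligible (frontier T)"
    and f: "integrable (lebesgue_on T) f"
    and test: "\<And>\<phi>. \<phi> \<in> test_functions (interior T) \<Longrightarrow> (LINT x|lebesgue_on T. \<phi> x * f x) = 0"
  shows "AE x in lebesgue_on T. f x = 0"
proof -
  have bump_int: "(LINT x|lebesgue_on T. indicator (box a b) x * f x) = 0" if ab: "cbox a b \<subseteq> interior T" for a b
  proof -
    have sub: "box a b \<subseteq> T" using ab box_subset_cbox interior_subset by blast
    have m: "bump a b m \<in> borel_measurable (lebesgue_on T)" for m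
    proof -
      have "bump a b m differentiable (at x)" for x
        using bump_in_test_functions[OF ab, of m] by (auto simp: test_functions_def dest: spec[of _ "[]"])
      then have "continuous_on T (bump a b m)"
        by (meson continuous_at_imp_continuous_on differentiable_imp_continuous_within)
      then show ?thesis by (rule continuous_imp_measurable_on_sets_lebesgue[OF _ T])
    qed
    have "(\<lambda>m. LINT x|lebesgue_on T. bump a b m x * f x) \<longlonglongrightarrow> (LINT x|lebesgue_on T. indicator (box a b) x * f x)"
    proof (rule integral_dominated_convergence[where w="\<lambda>x. \<bar>f x\<bar>"])
      show "(\<lambda>x. indicator (box a b) x * f x) \<in> borel_measurable (lebesgue_on T)"
        using f sub by (intro borel_measurable_times borel_measurable_indicator) (auto simp: sets_restrict_space_iff T)
      show "AE x in lebesgue_on T. norm (bump a b m x * f x) \<le> \<bar>f x\<bar>" for m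
        using bump_bounds[of a b m] by (auto simp: abs_mult intro!: mult_left_le_one_le)
      show "AE x in lebesgue_on T. (\<lambda>m. bump a b m x * f x) \<longlonglongrightarrow> indicator (box a b) x * f x"
        by (auto intro!: tendsto_intros bump_tendsto)
    qed (use f m in auto)
    then show ?thesis using test[OF bump_in_test_functions[OF ab]] by (simp add: LIMSEQ_const_iff)
  qed
  have box0: "AE x in lebesgue. x \<in> box a b \<longrightarrow> f x = 0" if ab: "cbox a b \<subseteq> interior T" for a b
  proof -
    have sub: "box a b \<subseteq> T" using ab box_subset_cbox interior_subset by blast
    let ?F = "\<lambda>x. indicator (box a b) x * f x"
    have eq: "indicator T x *\<^sub>R (indicator (box a b) x * f x) = ?F x" for x
      using sub by (auto simp: indicator_def)
    have "integrable (lebesgue_on T) (\<lambda>x. indicator (box a b) x *\<^sub>R f x)"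
      using f sub by (intro integrable_mult_indicator) (auto simp: sets_restrict_space_iff T)
    then have "integrable lebesgue (\<lambda>x. indicator T x *\<^sub>R (indicator (box a b) x * f x))"
      using T by (simp add: integrable_restrict_space)
    then have int: "integrable lebesgue ?F" unfolding eq .
    have "(LINT x:box c d|lebesgue. ?F x) = 0" for c d
    proof -
      \<comment> \<open>Testing the cut-off function on an arbitrary box means integrating
        \<open>f\<close> over an intersection of boxes, which is again a box of the admissible
        kind.\<close>
      obtain a' b' where ab': "box c d \<inter> box a b = box a' b'"
        and sub': "cbox a' b' \<subseteq> cbox a b"
        by (rule that[OF box_Int_box]) (auto simp: mem_box)
      have "(LINT x:box c d|lebesgue. ?F x) = (LINT x|lebesgue. indicator T x *\<^sub>R (indicator (box a' b') x * f x))"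
        unfolding set_lebesgue_integral_def ab'[symmetric] using sub
        by (intro Bochner_Integration.integral_cong) (auto simp: indicator_def)
      also have "\<dots> = 0"
        using bump_int[of a' b'] sub' ab T by (simp add: integral_restrict_space)
      finally show ?thesis .
    qed
    then have "AE x in lebesgue. ?F x = 0" by (rule AE_eq_0_lebesgue_if_box_integrals_eq_0[OF int])
    then show ?thesis by eventually_elim auto
  qed
  let ?\<F> = "{box a b |a b. cbox a b \<subseteq> interior T}"
  \<comment> \<open>Exceptional null sets can be united only countably often, hence the countable
    subcover.\<close>
  obtain \<G> where \<G>: "\<G> \<subseteq> ?\<F>" "countable \<G>" "\<Union>\<G> = \<Union>?\<F>"
    by (rule Lindelof[of ?\<F>]) (auto simp: open_box)
  have "AE x in lebesgue. \<forall>S\<in>\<G>. x \<in> S \<longrightarrow> f x = 0"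
    by (rule AE_ball_countable'[OF _ \<G>(2)]) (use \<G>(1) box0 in blast)
  moreover have "AE x in lebesgue. x \<notin> frontier T"
    using fr by (simp add: AE_not_in negligible_iff_null_sets)
  ultimately have "AE x in lebesgue. x \<in> T \<longrightarrow> f x = 0"
  proof eventually_elim
    case (elim x)
    show ?case
    proof
      assume "x \<in> T"
      then have "x \<in> interior T" using elim closure_subset[of T] by (auto simp: frontier_def)
      then obtain a b where "cbox a b \<subseteq> interior T" "x \<in> box a b"
        by (meson open_contains_cbox open_interior)
      then have "x \<in> \<Union>\<G>" unfolding \<G>(3) by blast
      then show "f x = 0" using elim by blast
    qed
  qed
  then show ?thesis using T by (simp add: AE_restrict_space_iff)
qed

subsection \<open>Integration by parts\<close>

lemma lborel_integral_translation:
  fixes f :: "'a::euclidean_space \<Rightarrow> real"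
  assumes [measurable]: "f \<in> borel_measurable borel"
  shows "(LINT x|lborel. f (x + c)) = (LINT x|lborel. f x)"
    and "integrable lborel f \<Longrightarrow> integrable lborel (\<lambda>x. f (x + c))"
proof -
  have "(LINT x|lborel. f x) = (LINT x|distr lborel borel ((+) c). f x)"
    by (simp add: lborel_distr_plus)
  also have "\<dots> = (LINT x|lborel. f (x + c))"
    by (subst integral_distr) (auto simp: add.commute)
  finally show "(LINT x|lborel. f (x + c)) = (LINT x|lborel. f x)" ..
  assume "integrable lborel f"
  then have "integrable (distr lborel borel ((+) c)) f" by (simp add: lborel_distr_plus)
  then show "integrable lborel (\<lambda>x. f (x + c))"
    by (subst (asm) integrable_distr_eq) (auto simp: add.commute)
qed

lemma integrable_continuous_compact_support:
  fixes f :: "'a::euclidean_space \<Rightarrow> real"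
  assumes "continuous_on UNIV f" "compact K" "\<And>x. x \<notin> K \<Longrightarrow> f x = 0"
  shows "integrable lborel f"
proof -
  have "integrable lborel (\<lambda>x. indicator K x *\<^sub>R f x)"
    using assms by (intro borel_integrable_compact) (auto intro: continuous_on_subset)
  also have "(\<lambda>x. indicator K x *\<^sub>R f x) = f" using assms(3) by (auto simp: indicator_def fun_eq_iff)
  finally show ?thesis .
qed

text \<open>The difference quotients have integral zero by translation invariance.\<close>

lemma integral_directional_derivative_eq_0:
  fixes \<psi> :: "'a::euclidean_space \<Rightarrow> real"
  assumes D: "\<And>x. (\<psi> has_derivative D x) (at x)" and cont: "continuous_on UNIV (\<lambda>x. D x e)"
    and K: "compact K" and supp: "\<And>x. x \<notin> K \<Longrightarrow> \<psi> x = 0"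
  shows "(LINT x|lborel. D x e) = 0"
proof -
  have cont\<psi>: "continuous_on UNIV \<psi>"
    using D by (meson has_derivative_continuous continuous_at_imp_continuous_on)
  have D0: "D x e = 0" if "x \<notin> K" for x
  proof -
    have "(\<psi> has_derivative (\<lambda>v. 0)) (at x)"
      by (rule has_derivative_transform_within_open[of "\<lambda>y. 0" _ _ _ "- K"])
         (use K that supp in \<open>auto simp: compact_imp_closed open_Compl\<close>)
    then show ?thesis using D has_derivative_unique by metis
  qed
  have line: "((\<lambda>t. \<psi> (x + t *\<^sub>R e)) has_real_derivative D (x + t *\<^sub>R e) e) (at t)" for x t
  proof -
    have "((\<lambda>t. x + t *\<^sub>R e) has_derivative (\<lambda>s. s *\<^sub>R e)) (at t)"
      by (auto intro!: derivative_eq_intros)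
    from has_derivative_compose[OF this D]
    show ?thesis using linear_cmul[OF has_derivative_linear[OF D]]
      by (simp add: has_field_derivative_def mult_commute_abs)
  qed
  obtain R where R: "R > 0" "\<And>x. x \<in> K \<Longrightarrow> norm x \<le> R"
    using K by (meson bounded_pos compact_imp_bounded)
  have "compact ((\<lambda>x. D x e) ` K)"
    using K cont by (intro compact_continuous_image) (auto intro: continuous_on_subset)
  then have "bounded ((\<lambda>x. D x e) ` K)" by (rule compact_imp_bounded)
  then obtain B where B: "B > 0" "\<And>x. x \<in> K \<Longrightarrow> \<bar>D x e\<bar> \<le> B"
    by (auto simp: bounded_pos)
  have B': "\<bar>D x e\<bar> \<le> B" for x using B D0 by (cases "x \<in> K") auto
  let ?t = "\<lambda>n. inverse (real (Suc n))"
  define s where "s n x = (\<psi> (x + ?t n *\<^sub>R e) - \<psi> x) / ?t n" for n x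
  \<comment> \<open>By the mean value theorem a difference quotient is a value of the derivative on
    the segment from \<open>x\<close> in direction \<open>e\<close>. As the step is at most 1, it is
    bounded by \<open>B\<close> and vanishes unless \<open>x\<close> lies within
    \<open>norm e\<close> of \<open>K\<close>.\<close>
  let ?w = "\<lambda>x. indicator (cball 0 (R + norm e)) x *\<^sub>R B"
  have meas [measurable]: "\<psi> \<in> borel_measurable borel" "(\<lambda>x. D x e) \<in> borel_measurable borel"
    using cont cont\<psi> by (simp_all add: borel_measurable_continuous_onI)
  have "(\<lambda>n. LINT x|lborel. s n x) \<longlonglongrightarrow> (LINT x|lborel. D x e)"
  proof (rule integral_dominated_convergence[where w="?w"])
    show "integrable lborel ?w" by (rule borel_integrable_compact) auto
    show "AE x in lborel. (\<lambda>n. s n x) \<longlonglongrightarrow> D x e"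
    proof (rule AE_I2)
      fix x
      have "((\<lambda>t. (\<psi> (x + t *\<^sub>R e) - \<psi> x) / t) \<longlongrightarrow> D x e) (at 0)"
        using line[of x 0] by (simp add: DERIV_def)
      moreover have "filterlim ?t (at 0) sequentially"
        unfolding filterlim_at using LIMSEQ_inverse_real_of_nat by auto
      ultimately show "(\<lambda>n. s n x) \<longlonglongrightarrow> D x e"
        unfolding s_def by (rule filterlim_compose)
    qed
    show "AE x in lborel. norm (s n x) \<le> ?w x" for n
    proof (rule AE_I2)
      fix x
      have "\<exists>\<xi>>0. \<xi> < ?t n \<and> \<psi> (x + ?t n *\<^sub>R e) - \<psi> (x + 0 *\<^sub>R e) = (?t n - 0) * D (x + \<xi> *\<^sub>R e) e"
        by (rule MVT2) (auto intro: line)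
      then obtain \<xi> where \<xi>: "\<xi> > 0" "\<xi> < ?t n" and eq: "s n x = D (x + \<xi> *\<^sub>R e) e"
        by (auto simp: s_def)
      show "norm (s n x) \<le> ?w x"
      proof (cases "x + \<xi> *\<^sub>R e \<in> K")
        case True
        have "?t n \<le> 1" by (simp add: inverse_le_1_iff)
        with \<xi> have "\<xi> \<le> 1" by linarith
        have "norm x \<le> norm (x + \<xi> *\<^sub>R e) + norm (\<xi> *\<^sub>R e)"
          by (metis add_diff_cancel_right' norm_triangle_ineq4)
        also have "\<dots> \<le> R + norm e"
          using R(2)[OF True] \<open>\<xi> \<le> 1\<close> \<xi> by (intro add_mono) (auto intro: mult_left_le_one_le)
        finally show ?thesis using B' eq by simp
      next
        case False
        then show ?thesis using D0 eq B by simp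
      qed
    qed
  qed (simp_all add: s_def)
  moreover have "(LINT x|lborel. s n x) = 0" for n
  proof -
    have "integrable lborel \<psi>" by (rule integrable_continuous_compact_support[OF cont\<psi> K supp])
    then show ?thesis unfolding s_def
      using lborel_integral_translation[of \<psi> "?t n *\<^sub>R e"] by simp
  qed
  ultimately show ?thesis by (simp add: LIMSEQ_const_iff)
qed

lemma integrable_lebesgue_on_compact:
  fixes f :: "'a::euclidean_space \<Rightarrow> 'b::euclidean_space"
  assumes "compact T" "continuous_on T f"
  shows "integrable (lebesgue_on T) f"
proof -
  have "integrable lborel (\<lambda>x. indicator T x *\<^sub>R f x)"
    using assms by (rule borel_integrable_compact)
  then have "integrable lebesgue (\<lambda>x. indicator T x *\<^sub>R f x)"
    by (subst integrable_completion) auto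
  moreover have "T \<in> sets lebesgue" using assms by (simp add: fmeasurableD lmeasurable_compact)
  ultimately show ?thesis by (simp add: integrable_restrict_space)
qed

lemma test_functionsD:
  assumes "\<phi> \<in> test_functions U"
  shows "(\<phi> has_derivative frechet_derivative \<phi> (at x)) (at x)" "continuous_on S \<phi>"
    "continuous_on S (partial i \<phi>)"
proof -
  have 1: "\<phi> differentiable (at x)" and 2: "partial i \<phi> differentiable (at x)" for x
    using assms unfolding test_functions_def
    by (auto dest: spec[of _ "[]"] spec[of _ "[i]"])
  show "(\<phi> has_derivative frechet_derivative \<phi> (at x)) (at x)"
    using 1 by (simp flip: frechet_derivative_works)
  show "continuous_on S \<phi>" "continuous_on S (partial i \<phi>)"
    using 1 2 by (meson continuous_at_imp_continuous_on differentiable_imp_continuous_within)+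
qed

text \<open>The product \<open>\<phi> x * f x\<close> is supported in the interior of
  \<open>T\<close>, so integrating its derivative over \<open>T\<close> is integrating over the
  whole space, where the result is zero; the product rule does the rest.\<close>

lemma integration_by_parts:
  fixes f :: "real ^ 'n::finite \<Rightarrow> real"
  assumes T: "compact T" and \<phi>: "\<phi> \<in> test_functions (interior T)"
    and D: "\<And>x. (f has_derivative D x) (at x)" and cont: "continuous_on UNIV (\<lambda>x. D x (axis i 1))"
  shows "(LINT x|lebesgue_on T. partial i \<phi> x * f x) = - (LINT x|lebesgue_on T. \<phi> x * D x (axis i 1))"
proof -
  let ?e = "axis i 1 :: real ^ 'n" and ?K = "closure {x. \<phi> x \<noteq> 0}"
  let ?D = "\<lambda>x v. \<phi> x * D x v + frechet_derivative \<phi> (at x) v * f x"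
  have K: "compact ?K" "?K \<subseteq> interior T" using \<phi> by (auto simp: test_functions_def)
  have f: "continuous_on S f" for S
    using D by (meson has_derivative_continuous continuous_at_imp_continuous_on)
  have T': "T \<in> sets lebesgue" using T by (simp add: fmeasurableD lmeasurable_compact)
  have g: "?D x ?e = partial i \<phi> x * f x + \<phi> x * D x ?e" for x
    by (simp add: partial_def)
  have contg: "continuous_on UNIV (\<lambda>x. ?D x ?e)"
    unfolding g by (intro continuous_intros test_functionsD[OF \<phi>] f cont)
  have 0: "(LINT x|lborel. ?D x ?e) = 0"
  proof (rule integral_directional_derivative_eq_0[where \<psi>="\<lambda>x. \<phi> x * f x" and D="?D" and K="?K", OF _ contg K(1)])
    show "((\<lambda>x. \<phi> x * f x) has_derivative ?D x) (at x)" for x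
      by (rule has_derivative_mult[OF test_functionsD(1)[OF \<phi>] D])
    show "\<phi> x * f x = 0" if "x \<notin> ?K" for x
      using that closure_subset[of "{x. \<phi> x \<noteq> 0}"] by auto
  qed
  have out: "?D x ?e = 0" if "x \<notin> T" for x
  proof -
    have "x \<in> - ?K" using that K(2) interior_subset by blast
    then have "(\<phi> has_derivative (\<lambda>v. 0)) (at x)"
      by - (rule has_derivative_transform_within_open[of "\<lambda>y. 0" _ _ _ "- ?K"],
          use closure_subset[of "{x. \<phi> x \<noteq> 0}"] in auto)
    then have "frechet_derivative \<phi> (at x) = (\<lambda>v. 0)"
      by (metis frechet_derivative_at)
    moreover have "\<phi> x = 0" using \<open>x \<in> - ?K\<close> closure_subset[of "{x. \<phi> x \<noteq> 0}"] by auto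
    ultimately show ?thesis by simp
  qed
  have "(LINT x|lebesgue_on T. ?D x ?e) = (LINT x|lebesgue. indicator T x *\<^sub>R ?D x ?e)"
    using T' by (simp add: integral_restrict_space)
  also have "\<dots> = (LINT x|lebesgue. ?D x ?e)"
    using out by (intro Bochner_Integration.integral_cong) (auto simp: indicator_def)
  also have "\<dots> = 0"
    using 0 contg by (subst integral_completion) (auto simp: borel_measurable_continuous_onI)
  finally have "(LINT x|lebesgue_on T. partial i \<phi> x * f x + \<phi> x * D x ?e) = 0"
    unfolding g .
  moreover have "integrable (lebesgue_on T) (\<lambda>x. partial i \<phi> x * f x)"
    "integrable (lebesgue_on T) (\<lambda>x. \<phi> x * D x ?e)"
    by (intro integrable_lebesgue_on_compact T continuous_intros test_functionsD[OF \<phi>] f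
        continuous_on_subset[OF cont]; simp)+
  ultimately show ?thesis by simp
qed

subsection \<open>Weak derivatives of continuously differentiable forms\<close>

lemma integrable_componentwise:
  fixes f :: "'a \<Rightarrow> real ^ 'b::finite"
  assumes "\<And>I. integrable M (\<lambda>x. f x $ I)" shows "integrable M f"
proof -
  have eq: "f = (\<lambda>x. \<Sum>I\<in>UNIV. (f x $ I) *\<^sub>R axis I 1)"
    by (auto simp: fun_eq_iff vec_eq_iff axis_def if_distrib cong: if_cong)
  show ?thesis
    by (subst eq) (intro Bochner_Integration.integrable_sum integrable_scaleR_left assms)
qed

lemma borel_measurable_componentwise:
  fixes f :: "'a \<Rightarrow> real ^ 'b::finite"
  assumes "\<And>I. (\<lambda>x. f x $ I) \<in> borel_measurable M" shows "f \<in> borel_measurable M"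
proof -
  have "f = (\<lambda>x. \<Sum>I\<in>UNIV. (f x $ I) *\<^sub>R axis I 1)"
    by (auto simp: fun_eq_iff vec_eq_iff axis_def if_distrib cong: if_cong)
  also have "\<dots> \<in> borel_measurable M"
    using assms by (intro borel_measurable_sum borel_measurable_scaleR) auto
  finally show ?thesis .
qed

lemma integral_linear:
  fixes F :: "'b::euclidean_space \<Rightarrow> 'c::euclidean_space"
  assumes "linear F" "integrable M f"
  shows "(LINT x|M. F (f x)) = F (LINT x|M. f x)"
  using assms by (intro integral_bounded_linear) (simp_all add: linear_conv_bounded_linear)

lemma L2_forms_continuous:
  assumes T: "compact T" and cont: "continuous_on T \<omega>" and alt: "\<And>x. \<omega> x \<in> alt j"
  shows "\<omega> \<in> L2_forms T j"
  unfolding L2_forms_def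
proof (intro CollectI conjI ballI allI alt)
  have T': "T \<in> sets lebesgue" using T by (simp add: fmeasurableD lmeasurable_compact)
  fix I
  have c: "continuous_on T (\<lambda>x. \<omega> x $ I)" using cont by (intro continuous_intros)
  show "(\<lambda>x. \<omega> x $ I) \<in> borel_measurable (lebesgue_on T)"
    using c T' by (rule continuous_imp_measurable_on_sets_lebesgue)
  show "integrable (lebesgue_on T) (\<lambda>x. (\<omega> x $ I)\<^sup>2)"
    by (intro integrable_lebesgue_on_compact T continuous_intros cont)
qed

text \<open>\<open>\<omega>' i\<close> is the partial derivative in direction \<open>i\<close>. With
  the whole family named, derivative and codifferential are read off algebraically.\<close>

definition C1_form :: "'n::finite form \<Rightarrow> ('n \<Rightarrow> 'n form) \<Rightarrow> bool" where
  "C1_form \<omega> \<omega>' \<longleftrightarrow> (\<forall>x. (\<omega> has_derivative (\<lambda>v. \<Sum>i\<in>UNIV. v $ i *\<^sub>R \<omega>' i x)) (at x)) \<and>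
     (\<forall>i. continuous_on UNIV (\<omega>' i))"

lemma C1_form_continuous:
  assumes "C1_form \<omega> \<omega>'" shows "continuous_on S \<omega>" "continuous_on S (\<omega>' i)"
proof -
  have "(\<omega> has_derivative (\<lambda>v. \<Sum>i\<in>UNIV. v $ i *\<^sub>R \<omega>' i x)) (at x)" for x
    using assms by (simp add: C1_form_def)
  then show "continuous_on S \<omega>"
    by (meson has_derivative_continuous continuous_at_imp_continuous_on)
  show "continuous_on S (\<omega>' i)"
    using assms by (auto simp: C1_form_def intro: continuous_on_subset)
qed

text \<open>Integration by parts works coefficient by coefficient, and \<open>dx_wedge i\<close>,
  being linear, passes through the integral.\<close>

lemma has_weak_d_C1:
  fixes T :: "(real ^ 'n::{finite,linorder}) set"
  assumes T: "compact T" and C1: "C1_form \<omega> \<omega>'" and alt: "\<And>x i. \<omega>' i x \<in> alt j"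
  shows "has_weak_d T j \<omega> (\<lambda>x. \<Sum>i\<in>UNIV. dx_wedge i (\<omega>' i x))"
  unfolding has_weak_d_def
proof (intro conjI ballI)
  have lin: "continuous_on S (dx_wedge i)" for i :: 'n and S
    by (simp add: linear_continuous_on linear_dx_wedge linear_conv_bounded_linear[symmetric])
  have cont: "continuous_on T (\<lambda>x. \<Sum>i\<in>UNIV. dx_wedge i (\<omega>' i x))"
    by (intro continuous_on_sum continuous_on_compose2[OF lin] C1_form_continuous[OF C1]) auto
  then show "(\<lambda>x. \<Sum>i\<in>UNIV. dx_wedge i (\<omega>' i x)) \<in> L2_forms T (j + 1)"
    using alt by (intro L2_forms_continuous T) (auto intro!: subspace_sum[OF subspace_alt] dx_wedge_alt)
  fix \<phi> assume \<phi>: "\<phi> \<in> test_functions (interior T)"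
  have int: "integrable (lebesgue_on T) (\<lambda>x. \<phi> x *\<^sub>R \<omega>' i x)" for i
    by (intro integrable_lebesgue_on_compact T continuous_intros test_functionsD[OF \<phi>] C1_form_continuous[OF C1])
  have parts: "(LINT x|lebesgue_on T. partial i \<phi> x *\<^sub>R \<omega> x) = - (LINT x|lebesgue_on T. \<phi> x *\<^sub>R \<omega>' i x)" for i
  proof (subst vec_eq_iff, intro allI)
    fix I
    have int': "integrable (lebesgue_on T) (\<lambda>x. partial i \<phi> x *\<^sub>R \<omega> x)"
      by (intro integrable_lebesgue_on_compact T continuous_intros test_functionsD[OF \<phi>] C1_form_continuous[OF C1])
    have D: "((\<lambda>x. \<omega> x $ I) has_derivative (\<lambda>v. (\<Sum>i\<in>UNIV. v $ i *\<^sub>R \<omega>' i x) $ I)) (at x)" for x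
      by (rule bounded_linear.has_derivative[OF bounded_linear_vec_nth]) (use C1 in \<open>simp add: C1_form_def\<close>)
    have ax: "(\<Sum>l\<in>UNIV. axis i 1 $ l *\<^sub>R \<omega>' l x) = \<omega>' i x" for x
      by (simp add: axis_def if_distrib[of "\<lambda>c. c *\<^sub>R _"] cong: if_cong)
    have "(LINT x|lebesgue_on T. partial i \<phi> x *\<^sub>R \<omega> x) $ I = (LINT x|lebesgue_on T. partial i \<phi> x * \<omega> x $ I)"
      using integral_bounded_linear[OF bounded_linear_vec_nth int', of I] by simp
    also have "\<dots> = - (LINT x|lebesgue_on T. \<phi> x * \<omega>' i x $ I)"
      by (rule integration_by_parts[OF T \<phi> D, of i, unfolded ax])
         (intro continuous_intros C1_form_continuous[OF C1])
    also have "\<dots> = (- (LINT x|lebesgue_on T. \<phi> x *\<^sub>R \<omega>' i x)) $ I"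
      using integral_bounded_linear[OF bounded_linear_vec_nth[of I] int[of i]] by simp
    finally show "(LINT x|lebesgue_on T. partial i \<phi> x *\<^sub>R \<omega> x) $ I = (- (LINT x|lebesgue_on T. \<phi> x *\<^sub>R \<omega>' i x)) $ I" .
  qed
  have int_wedge: "integrable (lebesgue_on T) (\<lambda>x. dx_wedge i (\<phi> x *\<^sub>R \<omega>' i x))" for i
    by (intro integrable_lebesgue_on_compact T continuous_on_compose2[OF lin] continuous_intros
        test_functionsD[OF \<phi>] C1_form_continuous[OF C1]) auto
  have "- (\<Sum>i\<in>UNIV. dx_wedge i (LINT x|lebesgue_on T. partial i \<phi> x *\<^sub>R \<omega> x))
      = (\<Sum>i\<in>UNIV. dx_wedge i (LINT x|lebesgue_on T. \<phi> x *\<^sub>R \<omega>' i x))"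
    unfolding parts by (simp add: linear_neg[OF linear_dx_wedge] sum_negf)
  also have "\<dots> = (\<Sum>i\<in>UNIV. (LINT x|lebesgue_on T. dx_wedge i (\<phi> x *\<^sub>R \<omega>' i x)))"
    by (simp only: integral_linear[OF linear_dx_wedge int])
  also have "\<dots> = (LINT x|lebesgue_on T. (\<Sum>i\<in>UNIV. dx_wedge i (\<phi> x *\<^sub>R \<omega>' i x)))"
    using int_wedge by (simp add: Bochner_Integration.integral_sum)
  also have "\<dots> = (LINT x|lebesgue_on T. \<phi> x *\<^sub>R (\<Sum>i\<in>UNIV. dx_wedge i (\<omega>' i x)))"
    by (simp add: linear_cmul[OF linear_dx_wedge] scaleR_sum_right)
  finally show "(LINT x|lebesgue_on T. \<phi> x *\<^sub>R (\<Sum>i\<in>UNIV. dx_wedge i (\<omega>' i x)))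
      = - (\<Sum>i\<in>UNIV. dx_wedge i (LINT x|lebesgue_on T. partial i \<phi> x *\<^sub>R \<omega> x))" by simp
qed

section \<open>Uniqueness of the weak derivative\<close>

lemma integrable_if_square_integrable:
  fixes f :: "'a::euclidean_space \<Rightarrow> real"
  assumes "T \<in> lmeasurable" "f \<in> borel_measurable (lebesgue_on T)" "integrable (lebesgue_on T) (\<lambda>x. (f x)\<^sup>2)"
  shows "integrable (lebesgue_on T) f"
proof (rule Bochner_Integration.integrable_bound)
  show "integrable (lebesgue_on T) (\<lambda>x. 1 + (f x)\<^sup>2)"
    using assms finite_measure.integrable_const[OF finite_measure_lebesgue_on[OF assms(1)], of "1::real"] by auto
  have "\<bar>u\<bar> \<le> 1 + u\<^sup>2" for u :: real
    using zero_le_power2[of "\<bar>u\<bar> - 1/2"] by (simp add: power2_eq_square algebra_simps)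
  then show "AE x in lebesgue_on T. norm (f x) \<le> norm (1 + (f x)\<^sup>2)" by simp
qed (use assms in auto)

text \<open>This is what permits replacing the arbitrary witness \<open>weak_d\<close> by a
  classical derivative under an integral. The fundamental lemma is applied to each of the finitely
  many coefficients of the difference.\<close>

lemma has_weak_d_unique:
  fixes T :: "(real ^ 'n::{finite,linorder}) set"
  assumes T: "compact T" and fr: "negligible (frontier T)"
    and w: "has_weak_d T j \<omega> \<eta>" "has_weak_d T j \<omega> \<eta>'"
  shows "AE x in lebesgue_on T. \<eta> x = \<eta>' x"
proof -
  have T': "T \<in> lmeasurable" using T by (simp add: lmeasurable_compact)
  have L2: "\<eta> \<in> L2_forms T (j + 1)" "\<eta>' \<in> L2_forms T (j + 1)"
    using w by (auto simp: has_weak_d_def)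
  have int: "integrable (lebesgue_on T) (\<lambda>x. \<zeta> x $ I)" if "\<zeta> \<in> L2_forms T (j + 1)" for \<zeta> I
    using that T' by - (rule integrable_if_square_integrable, auto simp: L2_forms_def)
  have int\<phi>: "integrable (lebesgue_on T) (\<lambda>x. \<phi> x * \<zeta> x $ I)"
    if \<zeta>: "\<zeta> \<in> L2_forms T (j + 1)" and \<phi>: "\<phi> \<in> test_functions (interior T)" for \<zeta> \<phi> I
  proof -
    have c: "continuous_on T \<phi>" by (rule test_functionsD[OF \<phi>])
    then have "bounded (\<phi> ` T)"
      using T by (intro compact_imp_bounded compact_continuous_image)
    then obtain B where B: "\<And>x. x \<in> T \<Longrightarrow> \<bar>\<phi> x\<bar> \<le> B"
      by (auto simp: bounded_iff)
    have m: "\<phi> \<in> borel_measurable (lebesgue_on T)"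
      using c T' by (intro continuous_imp_measurable_on_sets_lebesgue) (auto simp: fmeasurableD)
    show ?thesis
    proof (rule Bochner_Integration.integrable_bound)
      show "integrable (lebesgue_on T) (\<lambda>x. B * \<zeta> x $ I)" using int[OF \<zeta>] by simp
      show "AE x in lebesgue_on T. norm (\<phi> x * \<zeta> x $ I) \<le> norm (B * \<zeta> x $ I)"
        using B by (intro AE_I2) (force simp: abs_mult intro!: mult_right_mono)
    qed (use m int[OF \<zeta>] in auto)
  qed
  have "AE x in lebesgue_on T. \<eta> x $ I - \<eta>' x $ I = 0" for I
  proof (rule fundamental_lemma[OF _ fr])
    fix \<phi> assume \<phi>: "\<phi> \<in> test_functions (interior T)"
    have i: "integrable (lebesgue_on T) (\<lambda>x. \<phi> x *\<^sub>R \<zeta> x)" if "\<zeta> \<in> L2_forms T (j + 1)" for \<zeta>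
      using int\<phi>[OF that \<phi>] by (intro integrable_componentwise) simp
    have "(LINT x|lebesgue_on T. \<phi> x *\<^sub>R \<eta> x) = (LINT x|lebesgue_on T. \<phi> x *\<^sub>R \<eta>' x)"
      using w \<phi> by (simp add: has_weak_d_def)
    then have "(LINT x|lebesgue_on T. (\<phi> x *\<^sub>R \<eta> x) $ I) = (LINT x|lebesgue_on T. (\<phi> x *\<^sub>R \<eta>' x) $ I)"
      by (simp only: integral_bounded_linear[OF bounded_linear_vec_nth i[OF L2(1)]]
          integral_bounded_linear[OF bounded_linear_vec_nth i[OF L2(2)]])
    then show "(LINT x|lebesgue_on T. \<phi> x * (\<eta> x $ I - \<eta>' x $ I)) = 0"
      using int\<phi>[OF L2(1) \<phi>] int\<phi>[OF L2(2) \<phi>] by (simp add: right_diff_distrib)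
  qed (use T' L2 int in \<open>auto simp: fmeasurableD\<close>)
  then have "AE x in lebesgue_on T. \<forall>I\<in>UNIV. \<eta> x $ I - \<eta>' x $ I = 0"
    by (intro AE_ball_countable') auto
  then show ?thesis by eventually_elim (simp add: vec_eq_iff)
qed

lemma weak_d_has_weak_d: "has_weak_d T j \<omega> \<eta> \<Longrightarrow> has_weak_d T j \<omega> (weak_d T j \<omega>)"
  unfolding weak_d_def by (rule someI[of "has_weak_d T j \<omega>"])

lemma weak_d_AE_eq:
  fixes T :: "(real ^ 'n::{finite,linorder}) set"
  assumes "compact T" "negligible (frontier T)" "has_weak_d T j \<omega> \<eta>"
  shows "AE x in lebesgue_on T. weak_d T j \<omega> x = \<eta> x"
  using assms weak_d_has_weak_d has_weak_d_unique by blast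

section \<open>Codifferentials of continuously differentiable forms\<close>

lemma C1_form_star:
  assumes "C1_form \<omega> \<omega>'" shows "C1_form (star \<omega>) (\<lambda>i x. hodge (\<omega>' i x))"
  unfolding C1_form_def
proof (intro conjI allI)
  have bl: "bounded_linear (hodge :: real ^ ('a set) \<Rightarrow> _)"
    using linear_hodge by (simp add: linear_conv_bounded_linear)
  fix x
  have "((\<lambda>x. hodge (\<omega> x)) has_derivative (\<lambda>v. hodge (\<Sum>i\<in>UNIV. v $ i *\<^sub>R \<omega>' i x))) (at x)"
    using assms unfolding C1_form_def by (auto intro: bounded_linear.has_derivative[OF bl])
  then show "(star \<omega> has_derivative (\<lambda>v. \<Sum>i\<in>UNIV. v $ i *\<^sub>R hodge (\<omega>' i x))) (at x)"
    by (simp add: star_def linear_sum[OF linear_hodge] linear_cmul[OF linear_hodge])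
  show "continuous_on UNIV (\<lambda>x. hodge (\<omega>' i x))" for i
    using C1_form_continuous[OF assms] by (intro bounded_linear.continuous_on[OF bl])
qed

lemma has_weak_d_star:
  fixes T :: "(real ^ 'n::{finite,linorder}) set"
  assumes "compact T" "C1_form \<omega> \<omega>'" "\<And>i x. \<omega>' i x \<in> alt j"
  shows "has_weak_d T (CARD('n) - j) (star \<omega>) (\<lambda>x. \<Sum>i\<in>UNIV. dx_wedge i (hodge (\<omega>' i x)))"
  by (rule has_weak_d_C1[OF assms(1) C1_form_star[OF assms(2)]]) (rule hodge_alt[OF assms(3)])

text \<open>Conjugation by the star turns the wedges of the classical exterior derivative into
  contractions, so the codifferential becomes a divergence.\<close>

lemma codiff_AE_eq:
  fixes T :: "(real ^ 'n::{finite,linorder}) set"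
  assumes "1 \<le> j" and T: "compact T" "negligible (frontier T)"
    and C1: "C1_form \<omega> \<omega>'" and alt: "\<And>i x. \<omega>' i x \<in> alt j"
  shows "AE x in lebesgue_on T. codiff T j \<omega> x = codiff_sign CARD('n) j *\<^sub>R (\<Sum>i\<in>UNIV. contract i (\<omega>' i x))"
  using weak_d_AE_eq[OF T has_weak_d_star[OF T(1) C1 alt]]
proof eventually_elim
  case (elim x)
  show ?case unfolding codiff_def star_def[of "weak_d T _ _"] elim
    by (simp add: linear_sum[OF linear_hodge] hodge_dx_wedge_hodge[OF alt assms(1)] scaleR_sum_right)
qed

subsection \<open>Shape regularity and square integrable forms\<close>

lemma simplex_interior_nonempty:
  fixes T :: "(real ^ 'n::finite) set"
  assumes "int CARD('n) simplex T" shows "interior T \<noteq> {}"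
proof -
  have "aff_dim T = int DIM(real ^ 'n)" using aff_dim_simplex[OF assms] by simp
  then have "affine hull T = UNIV" by (simp only: aff_dim_eq_full)
  moreover from this have "T \<noteq> {}" by auto
  ultimately show ?thesis
    using convex_simplex[OF assms] rel_interior_interior rel_interior_eq_empty by metis
qed

text \<open>A ball with more than half of the inradius exists by the definition of a supremum,
  whether or not the supremum is attained; this costs the factor 2.\<close>

lemma inscribed_ball:
  fixes T :: "(real ^ 'n::finite) set"
  assumes "bounded T" "interior T \<noteq> {}" "shape_ratio T \<le> \<rho>" "0 < \<rho>"
  obtains z r where "0 < r" "cball z r \<subseteq> T" "diameter T \<le> 2 * \<rho> * r"
proof -
  let ?S = "{r. 0 \<le> r \<and> (\<exists>x. cball x r \<subseteq> T)}"
  have "r \<le> diameter T" if r: "r \<in> ?S" for r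
  proof -
    obtain x where "0 \<le> r" "cball x r \<subseteq> T" using r by auto
    then show ?thesis using diameter_subset[of "cball x r" T] assms(1) by simp
  qed
  then have bdd: "bdd_above ?S" by (rule bdd_aboveI)
  obtain x where "x \<in> interior T" using assms by auto
  then obtain e where e: "e > 0" "cball x e \<subseteq> T"
    unfolding mem_interior_cball by auto
  then have "e \<le> inradius T" unfolding inradius_def by (intro cSup_upper bdd) auto
  with e have pos: "inradius T > 0" by simp
  have ne: "?S \<noteq> {}" using e by (auto intro: less_imp_le)
  have "inradius T / 2 < Sup ?S" using pos by (simp add: inradius_def)
  then obtain r where "r \<in> ?S" and r: "inradius T / 2 < r"
    unfolding less_cSup_iff[OF ne bdd] by blast
  then obtain z where "cball z r \<subseteq> T" by auto
  moreover have "diameter T \<le> 2 * \<rho> * r"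
  proof -
    have "diameter T \<le> \<rho> * inradius T"
      using assms(3) pos by (simp add: shape_ratio_def divide_le_eq)
    also have "\<dots> \<le> \<rho> * (2 * r)" using r assms(4) by (intro mult_left_mono) auto
    finally show ?thesis by simp
  qed
  moreover have "0 < r" using pos r by linarith
  ultimately show thesis using that by blast
qed

text \<open>The analytic half of \<open>L2_forms\<close>. Separated from the degree, it passes
  through the star unchanged and serves forms of all degrees at once.\<close>

definition square_integrable_on :: "'n::finite form \<Rightarrow> (real ^ 'n) set \<Rightarrow> bool" where
  "square_integrable_on \<omega> T \<longleftrightarrow> (\<forall>I. (\<lambda>x. \<omega> x $ I) \<in> borel_measurable (lebesgue_on T) \<and>
     integrable (lebesgue_on T) (\<lambda>x. (\<omega> x $ I)\<^sup>2))"

lemma L2_forms_square_integrable: "\<omega> \<in> L2_forms T j \<Longrightarrow> square_integrable_on \<omega> T"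
  by (simp add: L2_forms_def square_integrable_on_def)

lemma square_integrable_hodge:
  assumes "square_integrable_on \<omega> T"
  shows "square_integrable_on (\<lambda>x. a *\<^sub>R star \<omega> x) T"
  using assms unfolding square_integrable_on_def star_def
  by (auto simp: hodge_nth power_mult_distrib mult.assoc[symmetric]
      intro!: borel_measurable_times borel_measurable_const)

lemma square_integrable_borel_measurable:
  "square_integrable_on \<omega> T \<Longrightarrow> \<omega> \<in> borel_measurable (lebesgue_on T)"
  by (rule borel_measurable_componentwise) (simp add: square_integrable_on_def)

lemma square_integrable_inner:
  assumes "square_integrable_on \<omega> T" "square_integrable_on \<eta> T"
  shows "integrable (lebesgue_on T) (\<lambda>x. \<omega> x \<bullet> \<eta> x)"
  unfolding inner_vec_def
proof (intro Bochner_Integration.integrable_sum)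
  fix I
  show "integrable (lebesgue_on T) (\<lambda>x. \<omega> x $ I \<bullet> \<eta> x $ I)"
  proof (rule Bochner_Integration.integrable_bound)
    show "integrable (lebesgue_on T) (\<lambda>x. (\<omega> x $ I)\<^sup>2 + (\<eta> x $ I)\<^sup>2)"
      using assms by (auto simp: square_integrable_on_def)
    have "\<bar>u * v\<bar> \<le> u\<^sup>2 + v\<^sup>2" for u v :: real
    proof -
      have "2 * (\<bar>u\<bar> * \<bar>v\<bar>) \<le> \<bar>u\<bar>\<^sup>2 + \<bar>v\<bar>\<^sup>2" using sum_squares_bound[of "\<bar>u\<bar>" "\<bar>v\<bar>"] by simp
      moreover have "0 \<le> \<bar>u\<bar> * \<bar>v\<bar>" by simp
      ultimately show ?thesis unfolding abs_mult power2_abs by linarith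
    qed
    then show "AE x in lebesgue_on T. norm (\<omega> x $ I \<bullet> \<eta> x $ I) \<le> norm ((\<omega> x $ I)\<^sup>2 + (\<eta> x $ I)\<^sup>2)"
      by simp
    show "(\<lambda>x. \<omega> x $ I \<bullet> \<eta> x $ I) \<in> borel_measurable (lebesgue_on T)"
      using assms by (intro borel_measurable_inner) (auto simp: square_integrable_on_def)
  qed
qed

lemma L2_inner_cong:
  assumes "square_integrable_on \<omega> T" "square_integrable_on \<omega>' T" "square_integrable_on \<eta> T" "square_integrable_on \<eta>' T"
    and "AE x in lebesgue_on T. \<omega> x = \<omega>' x" "AE x in lebesgue_on T. \<eta> x = \<eta>' x"
  shows "L2_inner T \<omega> \<eta> = L2_inner T \<omega>' \<eta>'"
  unfolding L2_inner_def
proof (rule integral_cong_AE)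
  show "AE x in lebesgue_on T. \<omega> x \<bullet> \<eta> x = \<omega>' x \<bullet> \<eta>' x"
    using assms(5,6) by eventually_elim simp
qed (use assms square_integrable_borel_measurable in \<open>auto intro!: borel_measurable_inner\<close>)

lemma L2_inner_commute: "L2_inner T \<omega> \<eta> = L2_inner T \<eta> \<omega>"
  by (simp add: L2_inner_def inner_commute)

lemma L2_inner_add_right:
  assumes "square_integrable_on \<omega> T" "square_integrable_on \<eta> T" "square_integrable_on \<eta>' T"
  shows "L2_inner T \<omega> (\<lambda>x. \<eta> x + \<eta>' x) = L2_inner T \<omega> \<eta> + L2_inner T \<omega> \<eta>'"
  unfolding L2_inner_def inner_add_right
  using assms by (intro Bochner_Integration.integral_add square_integrable_inner)

lemma L2_inner_scaleR_right: "L2_inner T \<omega> (\<lambda>x. c *\<^sub>R \<eta> x) = c * L2_inner T \<omega> \<eta>"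
  by (simp add: L2_inner_def)

lemma L2_norm_nonneg [simp]: "0 \<le> L2_norm T \<omega>"
  by (simp add: L2_norm_def L2_inner_def)

text \<open>The properties of a simplex that carry the estimates; its shape enters separately,
  through an inscribed ball.\<close>

locale convex_body =
  fixes T :: "(real ^ 'n::{finite,linorder}) set"
  assumes compact: "compact T" and convex: "convex T" and interior: "interior T \<noteq> {}"
begin

abbreviation vol :: real where "vol \<equiv> measure lebesgue T"
abbreviation diam :: real where "diam \<equiv> diameter T"

lemma negligible_frontier: "negligible (frontier T)"
  by (rule negligible_convex_frontier[OF convex])

lemma lmeasurable: "T \<in> lmeasurable"
  using compact by (rule lmeasurable_compact)

lemma sets_lebesgue: "T \<in> sets lebesgue"
  using lmeasurable by (simp add: fmeasurableD)

lemma vol_pos: "vol > 0"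
  using open_not_negligible[of "interior T"] interior negligible_subset[of T "interior T"]
    interior_subset[of T] lmeasurable
  by (metis less_eq_real_def measure_nonneg negligible_iff_measure0 open_interior)

lemma measure_T [simp]: "measure (lebesgue_on T) T = vol"
  using sets_lebesgue by (simp add: measure_restrict_space)

lemma integrable_continuous:
  fixes f :: "real ^ 'n::{finite,linorder} \<Rightarrow> 'b::euclidean_space"
  shows "continuous_on T f \<Longrightarrow> integrable (lebesgue_on T) f"
  by (rule integrable_lebesgue_on_compact[OF compact])

lemma dist_le_diam: "x \<in> T \<Longrightarrow> y \<in> T \<Longrightarrow> dist x y \<le> diam"
  using compact by (simp add: compact_imp_bounded diameter_bounded_bound)

lemma diam_nonneg: "0 \<le> diam"
  using compact by (simp add: compact_imp_bounded diameter_ge_0)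

lemma integral_bounds:
  fixes f :: "real ^ 'n::{finite,linorder} \<Rightarrow> real"
  assumes "continuous_on T f" "\<And>x. x \<in> T \<Longrightarrow> l \<le> f x" "\<And>x. x \<in> T \<Longrightarrow> f x \<le> u"
  shows "vol * l \<le> (LINT x|lebesgue_on T. f x)" "(LINT x|lebesgue_on T. f x) \<le> vol * u"
proof -
  have "(LINT x|lebesgue_on T. l) \<le> (LINT x|lebesgue_on T. f x)"
    by (intro integral_mono integrable_continuous assms continuous_intros) (use assms in auto)
  then show "vol * l \<le> (LINT x|lebesgue_on T. f x)" by simp
  have "(LINT x|lebesgue_on T. f x) \<le> (LINT x|lebesgue_on T. u)"
    by (intro integral_mono integrable_continuous assms continuous_intros) (use assms in auto)
  then show "(LINT x|lebesgue_on T. f x) \<le> vol * u" by simp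
qed

lemma mean_const_eq:
  assumes "continuous_on T f"
  shows "mean_const T f = (LINT x|lebesgue_on T. f x) / vol"
proof -
  have "(LINT x|lebesgue_on T. f x - c) = (LINT x|lebesgue_on T. f x) - vol * c" for c
    using integrable_continuous[OF assms] integrable_continuous[of "\<lambda>x. c"] by simp
  note key = this
  show ?thesis unfolding mean_const_def
  proof (rule the_equality)
    show "(LINT x|lebesgue_on T. f x - (LINT x|lebesgue_on T. f x) / vol) = 0"
      unfolding key using vol_pos by simp
    show "c = (LINT x|lebesgue_on T. f x) / vol" if "(LINT x|lebesgue_on T. f x - c) = 0" for c
      using that vol_pos unfolding key by (simp add: field_simps)
  qed
qed

lemma mean_const_bounds:
  assumes "continuous_on T f" "\<And>x. x \<in> T \<Longrightarrow> l \<le> f x" "\<And>x. x \<in> T \<Longrightarrow> f x \<le> u"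
  shows "l \<le> mean_const T f" "mean_const T f \<le> u"
  using integral_bounds[OF assms] vol_pos
  by (auto simp: mean_const_eq[OF assms(1)] field_simps)

lemma integral_minus_mean_const:
  assumes "continuous_on T f"
  shows "(LINT x|lebesgue_on T. f x - mean_const T f) = 0"
proof -
  have "(LINT x|lebesgue_on T. f x - mean_const T f) = (LINT x|lebesgue_on T. f x) - vol * mean_const T f"
    using integrable_continuous[OF assms] integrable_continuous[of "\<lambda>x. mean_const T f"] by simp
  then show ?thesis using vol_pos by (simp add: mean_const_eq[OF assms])
qed

lemma integral_centred: "(LINT x|lebesgue_on T. x $ i - centre T $ i) = 0"
  unfolding centre_def vec_lambda_beta by (intro integral_minus_mean_const continuous_intros)

text \<open>The coordinate of the centre is a mean of values that all lie within \<open>diam\<close>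
  of \<open>x $ i\<close>.\<close>

lemma abs_centred_le:
  assumes "x \<in> T" shows "\<bar>x $ i - centre T $ i\<bar> \<le> diam"
proof -
  have "\<bar>x $ i - y $ i\<bar> \<le> diam" if "y \<in> T" for y
    using dist_le_diam[OF assms that] component_le_norm_cart[of "x - y" i] by (simp add: dist_norm)
  then have "x $ i - diam \<le> y $ i" "y $ i \<le> x $ i + diam" if "y \<in> T" for y
    using that by (smt (verit))+
  then show ?thesis
    using mean_const_bounds[of "\<lambda>y. y $ i" "x $ i - diam" "x $ i + diam"]
    by (simp add: centre_def continuous_on_component)
qed

lemma square_integrable_continuous:
  assumes "continuous_on T \<omega>" shows "square_integrable_on \<omega> T"
  unfolding square_integrable_on_def
  by (intro allI conjI integrable_continuous continuous_imp_measurable_on_sets_lebesgue[OF _ sets_lebesgue]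
      continuous_intros assms)

lemma L2_norm_cong:
  assumes "square_integrable_on \<omega> T" "continuous_on T \<eta>" "AE x in lebesgue_on T. \<omega> x = \<eta> x"
  shows "L2_norm T \<omega> = L2_norm T \<eta>"
proof -
  note sq = square_integrable_continuous[OF assms(2)]
  show ?thesis
    unfolding L2_norm_def L2_inner_cong[OF assms(1) sq assms(1) sq assms(3) assms(3)] ..
qed

lemma L2_norm_le:
  assumes "continuous_on T g" "\<And>x. x \<in> T \<Longrightarrow> norm (g x) \<le> G" "0 \<le> G"
  shows "L2_norm T g \<le> sqrt vol * G"
proof -
  have "L2_inner T g g \<le> vol * G\<^sup>2"
    unfolding L2_inner_def
    by (rule integral_bounds(2)[where l=0]) (use assms in \<open>auto intro!: continuous_intros simp: dot_square_norm power_mono\<close>)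
  then have "L2_norm T g \<le> sqrt (vol * G\<^sup>2)" unfolding L2_norm_def by (rule real_sqrt_le_mono)
  then show ?thesis using assms by (simp add: real_sqrt_mult)
qed

lemma abs_L2_inner_le:
  assumes \<omega>: "square_integrable_on \<omega> T" and g: "continuous_on T g"
    and G: "\<And>x. x \<in> T \<Longrightarrow> norm (g x) \<le> G" "0 \<le> G"
  shows "\<bar>L2_inner T \<omega> g\<bar> \<le> L2_norm T \<omega> * (sqrt vol * G)"
proof -
  have m: "\<omega> \<in> borel_measurable (lebesgue_on T)" by (rule square_integrable_borel_measurable[OF \<omega>])
  have int2: "integrable (lebesgue_on T) (\<lambda>x. (norm (\<omega> x))\<^sup>2)"
    using square_integrable_inner[OF \<omega> \<omega>] by (simp add: dot_square_norm)
  have int: "integrable (lebesgue_on T) (\<lambda>x. norm (\<omega> x))"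
    by (rule integrable_if_square_integrable[OF lmeasurable _ int2]) (use m in simp)
  have intc: "integrable (lebesgue_on T) (\<lambda>x. c)" for c :: real
    by (intro integrable_continuous continuous_intros)
  let ?I = "LINT x|lebesgue_on T. norm (\<omega> x)"
  \<comment> \<open>With the mean as constant, nonnegativity of the variance of
    \<open>norm (\<omega> x)\<close> is the Cauchy-Schwarz inequality against 1. It bounds the L1
    norm by \<open>sqrt vol\<close> times the L2 norm.\<close>
  define a where "a = ?I / vol"
  have "0 \<le> (LINT x|lebesgue_on T. (norm (\<omega> x) - a)\<^sup>2)"
    by (intro Bochner_Integration.integral_nonneg) simp
  also have "\<dots> = (LINT x|lebesgue_on T. (norm (\<omega> x))\<^sup>2 - 2 * a * norm (\<omega> x) + a\<^sup>2)"
    by (simp add: power2_eq_square algebra_simps)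
  also have "\<dots> = (LINT x|lebesgue_on T. (norm (\<omega> x))\<^sup>2) - 2 * a * ?I + vol * a\<^sup>2"
    using int int2 intc by simp
  also have "\<dots> = (LINT x|lebesgue_on T. (norm (\<omega> x))\<^sup>2) - ?I\<^sup>2 / vol"
    using vol_pos by (simp add: a_def power2_eq_square)
  finally have "?I\<^sup>2 \<le> vol * L2_inner T \<omega> \<omega>"
    using vol_pos by (simp add: L2_inner_def dot_square_norm field_simps)
  then have "\<bar>?I\<bar> \<le> sqrt (vol * L2_inner T \<omega> \<omega>)"
    by (metis real_sqrt_abs real_sqrt_le_mono)
  then have I: "?I \<le> sqrt vol * L2_norm T \<omega>"
    by (simp add: L2_norm_def real_sqrt_mult)
  have "\<bar>L2_inner T \<omega> g\<bar> \<le> (LINT x|lebesgue_on T. \<bar>\<omega> x \<bullet> g x\<bar>)"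
    unfolding L2_inner_def by (rule integral_abs_bound)
  also have "\<dots> \<le> (LINT x|lebesgue_on T. G * norm (\<omega> x))"
  proof (rule integral_mono)
    show "integrable (lebesgue_on T) (\<lambda>x. \<bar>\<omega> x \<bullet> g x\<bar>)"
      using square_integrable_inner[OF \<omega> square_integrable_continuous[OF g]] by simp
    fix x assume "x \<in> space (lebesgue_on T)"
    then have "norm (g x) \<le> G" using G by simp
    then have "norm (\<omega> x) * norm (g x) \<le> norm (\<omega> x) * G" by (intro mult_left_mono) auto
    then show "\<bar>\<omega> x \<bullet> g x\<bar> \<le> G * norm (\<omega> x)"
      using Cauchy_Schwarz_ineq2[of "\<omega> x" "g x"] by (simp add: mult.commute)
  qed (use int in simp)
  also have "\<dots> = G * ?I" by simp
  also have "\<dots> \<le> G * (sqrt vol * L2_norm T \<omega>)" using I G by (intro mult_left_mono) auto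
  finally show ?thesis by (simp add: mult_ac)
qed

text \<open>On a ball of radius \<open>r / 4\<close> inside the inscribed ball, displaced from its centre in the direction
  \<open>\<plusminus>v\<close> according to the sign of the affine function there, that function has modulus at least \<open>r |v| / 4\<close>.\<close>

lemma second_moment_ge:
  assumes ball: "cball z r \<subseteq> T" "0 < r" and \<rho>: "diam \<le> 2 * \<rho> * r" "0 < \<rho>"
  shows "vol * diam\<^sup>2 * (norm v)\<^sup>2 / (8 * \<rho>) ^ (CARD('n) + 2)
    \<le> (LINT x|lebesgue_on T. ((x - c) \<bullet> v)\<^sup>2)"
proof (cases "v = 0")
  case False
  let ?n = "CARD('n)"
  define s :: real where "s = (if 0 \<le> (z - c) \<bullet> v then 1 else -1)"
  have s: "0 \<le> s * ((z - c) \<bullet> v)" "s * s = 1" "\<bar>s\<bar> = 1" by (auto simp: s_def)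
  \<comment> \<open>At \<open>w\<close> the function has modulus at least
    \<open>r / 2 * norm v\<close>, and over the small ball it varies by at most
    \<open>r / 4 * norm v\<close>. The ball stays inside because 1/2 + 1/4 is below 1.\<close>
  define w where "w = z + (s * (r / 2) / norm v) *\<^sub>R v"
  let ?B = "ball w (r / 4)"
  have sub: "?B \<subseteq> T"
  proof
    fix x assume "x \<in> ?B"
    then have "dist w x < r / 4" by simp
    moreover have "dist z w = r / 2"
      using False ball(2) s by (simp add: w_def dist_norm abs_mult)
    ultimately have "dist z x \<le> r" using dist_triangle[of z x w] ball(2) by linarith
    then show "x \<in> T" using ball(1) by auto
  qed
  have lower: "(r / 4 * norm v)\<^sup>2 \<le> ((x - c) \<bullet> v)\<^sup>2" if "x \<in> ?B" for x
  proof -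
    have "(x - c) \<bullet> v = (z - c) \<bullet> v + (s * (r / 2) / norm v) * (v \<bullet> v) + (x - w) \<bullet> v"
      by (simp add: w_def inner_add_left inner_diff_left)
    also have "(s * (r / 2) / norm v) * (v \<bullet> v) = s * (r / 2 * norm v)"
      using False by (simp add: dot_square_norm power2_eq_square)
    finally have "s * ((x - c) \<bullet> v) = s * ((z - c) \<bullet> v) + s * s * (r / 2 * norm v) + s * ((x - w) \<bullet> v)"
      by (simp add: algebra_simps)
    moreover have "\<bar>(x - w) \<bullet> v\<bar> \<le> r / 4 * norm v"
    proof -
      have "norm (x - w) \<le> r / 4" using that by (simp add: dist_norm norm_minus_commute)
      then have "norm (x - w) * norm v \<le> r / 4 * norm v" by (rule mult_right_mono) simp
      with Cauchy_Schwarz_ineq2[of "x - w" v] show ?thesis by linarith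
    qed
    then have "\<bar>s * ((x - w) \<bullet> v)\<bar> \<le> r / 4 * norm v" using s by (simp add: abs_mult)
    ultimately have "r / 4 * norm v \<le> s * ((x - c) \<bullet> v)" using s by simp
    also have "\<dots> \<le> \<bar>(x - c) \<bullet> v\<bar>" using s(3) by (metis abs_ge_self abs_mult mult_1)
    finally show ?thesis using ball(2)
      by (metis abs_ge_zero power2_abs power_mono mult_nonneg_nonneg norm_ge_zero less_imp_le zero_less_divide_iff zero_less_numeral)
  qed
  obtain x0 where x0: "x0 \<in> T" using ball by fastforce
  \<comment> \<open>Origin of \<open>(8 * \<rho>) ^ (?n + 2)\<close>: \<open>T\<close> lies in a
    ball of radius \<open>diam\<close>, so its volume times \<open>diam\<^sup>2\<close> is at most
    \<open>unit_ball_vol ?n * (2 * \<rho> * r) ^ (?n + 2)\<close>. Writing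
    \<open>2 * \<rho> * r\<close> as \<open>8 * \<rho> * (r / 4)\<close> leaves the volume of the
    small ball and two powers of \<open>r / 4\<close>, which the squared lower bound
    absorbs.\<close>
  have "T \<subseteq> cball x0 diam" using dist_le_diam[OF x0] by auto
  then have "vol \<le> measure lebesgue (cball x0 diam)"
    by (intro measure_mono_fmeasurable sets_lebesgue) auto
  also have "\<dots> = unit_ball_vol ?n * diam ^ ?n"
    using diam_nonneg content_ball[of diam x0] by (simp add: content_cball_conv_ball)
  finally have "vol * diam\<^sup>2 * (norm v)\<^sup>2 \<le> unit_ball_vol ?n * diam ^ ?n * diam\<^sup>2 * (norm v)\<^sup>2"
    by (intro mult_right_mono) auto
  also have "\<dots> = unit_ball_vol ?n * diam ^ (?n + 2) * (norm v)\<^sup>2"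
    by (simp add: power_add power2_eq_square)
  also have "\<dots> \<le> unit_ball_vol ?n * (2 * \<rho> * r) ^ (?n + 2) * (norm v)\<^sup>2"
    by (intro mult_right_mono mult_left_mono power_mono \<rho> diam_nonneg) auto
  also have "2 * \<rho> * r = 8 * \<rho> * (r / 4)" by simp
  also have "unit_ball_vol ?n * (8 * \<rho> * (r / 4)) ^ (?n + 2) * (norm v)\<^sup>2
      = (8 * \<rho>) ^ (?n + 2) * ((r / 4 * norm v)\<^sup>2 * (unit_ball_vol ?n * (r / 4) ^ ?n))"
    by (simp only: power_mult_distrib power_add) (simp add: mult_ac power2_eq_square)
  finally have "vol * diam\<^sup>2 * (norm v)\<^sup>2 / (8 * \<rho>) ^ (?n + 2)
      \<le> (r / 4 * norm v)\<^sup>2 * (unit_ball_vol ?n * (r / 4) ^ ?n)"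
    using \<rho>(2) by (simp add: divide_le_eq mult.commute)
  also have "unit_ball_vol ?n * (r / 4) ^ ?n = measure lebesgue ?B"
    using ball(2) content_ball[of "r / 4" w] by simp
  also have "(r / 4 * norm v)\<^sup>2 * measure lebesgue ?B
      = (LINT x|lebesgue_on T. (r / 4 * norm v)\<^sup>2 * indicator ?B x)"
    using sub by (simp add: measure_restrict_space sets_lebesgue sets_restrict_space_iff Int_absorb2)
  also have "\<dots> \<le> (LINT x|lebesgue_on T. ((x - c) \<bullet> v)\<^sup>2)"
  proof (rule integral_mono)
    show "integrable (lebesgue_on T) (\<lambda>x. (r / 4 * norm v)\<^sup>2 * indicator ?B x)"
    proof -
      have "integrable (lebesgue_on T) (\<lambda>x. indicator ?B x *\<^sub>R (r / 4 * norm v)\<^sup>2)"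
        using sub by (intro integrable_mult_indicator integrable_continuous continuous_intros)
          (auto simp: sets_restrict_space_iff sets_lebesgue)
      then show ?thesis by (simp add: mult.commute)
    qed
    show "integrable (lebesgue_on T) (\<lambda>x. ((x - c) \<bullet> v)\<^sup>2)"
      by (intro integrable_continuous continuous_intros)
    show "(r / 4 * norm v)\<^sup>2 * indicator ?B x \<le> ((x - c) \<bullet> v)\<^sup>2" for x
      using lower[of x] by (auto simp: indicator_def)
  qed
  finally show ?thesis .
qed simp

end

subsection \<open>Polynomial forms\<close>

definition lin_contract :: "real ^ 'n::{finite,linorder} \<Rightarrow> real ^ ('n set) \<Rightarrow> 'n::{finite,linorder} form" where
  "lin_contract c w x = (\<Sum>i\<in>UNIV. (x $ i - c $ i) *\<^sub>R contract i w)"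

definition lin_wedge :: "real ^ 'n::{finite,linorder} \<Rightarrow> real ^ ('n set) \<Rightarrow> 'n::{finite,linorder} form" where
  "lin_wedge c w x = (\<Sum>i\<in>UNIV. (x $ i - c $ i) *\<^sub>R dx_wedge i w)"

lemma contract_eq_sum:
  "contract i w = (\<Sum>I | i \<in> I. (w $ I * pos_sign i I) *\<^sub>R axis (I - {i}) 1)"
proof (subst vec_eq_iff, intro allI)
  fix J
  have "(\<Sum>I | i \<in> I. (w $ I * pos_sign i I) *\<^sub>R axis (I - {i}) 1) $ J
      = (\<Sum>I\<in>{I. i \<in> I}. if I = insert i J \<and> i \<notin> J then w $ I * pos_sign i I else 0)"
    unfolding sum_component by (rule sum.cong) (auto simp: axis_def)
  also have "\<dots> = contract i w $ J"
    by (cases "i \<in> J") (simp_all add: sum.delta contract_nth mult.commute)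
  finally show "contract i w $ J = (\<Sum>I | i \<in> I. (w $ I * pos_sign i I) *\<^sub>R axis (I - {i}) 1) $ J" ..
qed

lemma koszul_eq: "koszul c \<omega> x = lin_contract c (\<omega> x) x"
proof -
  have "koszul c \<omega> x = (\<Sum>I\<in>UNIV. \<Sum>i\<in>I. (x $ i - c $ i) *\<^sub>R ((\<omega> x $ I * pos_sign i I) *\<^sub>R axis (I - {i}) 1))"
    by (simp add: koszul_def scaleR_sum_right mult_ac)
  also have "\<dots> = (\<Sum>I\<in>UNIV. \<Sum>i | i \<in> UNIV \<and> i \<in> I. (x $ i - c $ i) *\<^sub>R ((\<omega> x $ I * pos_sign i I) *\<^sub>R axis (I - {i}) 1))"
    by simp
  also have "\<dots> = (\<Sum>i\<in>UNIV. \<Sum>I | I \<in> UNIV \<and> i \<in> I. (x $ i - c $ i) *\<^sub>R ((\<omega> x $ I * pos_sign i I) *\<^sub>R axis (I - {i}) 1))"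
    by (rule sum.swap_restrict) auto
  finally show ?thesis by (simp add: lin_contract_def contract_eq_sum scaleR_sum_right)
qed

lemma star_koszul_star_eq:
  fixes w :: "real ^ ('n::{finite,linorder} set)"
  assumes "w \<in> alt j"
  shows "star (koszul c (star (\<lambda>x. w))) x = koszul_sign CARD('n) j *\<^sub>R lin_wedge c w x"
  by (simp add: star_def koszul_eq lin_contract_def lin_wedge_def linear_sum[OF linear_hodge]
      linear_cmul[OF linear_hodge] hodge_contract_hodge[OF assms] scaleR_sum_right mult.commute)

lemma linear_lin_contract: "linear (\<lambda>w. lin_contract c w x)"
  by (rule linearI) (simp_all add: lin_contract_def linear_add[OF linear_contract] linear_cmul[OF linear_contract]
      scaleR_add_right sum.distrib scaleR_sum_right mult.commute)

lemma linear_lin_wedge: "linear (\<lambda>w. lin_wedge c w x)"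
  by (rule linearI) (simp_all add: lin_wedge_def linear_add[OF linear_dx_wedge] linear_cmul[OF linear_dx_wedge]
      scaleR_add_right sum.distrib scaleR_sum_right mult.commute)

text \<open>Moving the base point changes the form by a constant of the same degree. Hence the test
  spaces, defined with base point 0, can be described with the barycentre, about which coordinates
  have mean zero.\<close>

lemma lin_contract_shift: "lin_contract 0 w x = (\<Sum>i\<in>UNIV. c $ i *\<^sub>R contract i w) + lin_contract c w x"
  by (simp add: lin_contract_def scaleR_diff_left sum_subtractf)

lemma lin_wedge_shift: "lin_wedge 0 w x = (\<Sum>i\<in>UNIV. c $ i *\<^sub>R dx_wedge i w) + lin_wedge c w x"
  by (simp add: lin_wedge_def scaleR_diff_left sum_subtractf)

lemma const_mem_P0: "(\<lambda>x. w) \<in> P0 j \<longleftrightarrow> w \<in> alt j"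
  by (auto simp: P0_def fun_eq_iff)

lemma P1_minus_eq:
  "P1_minus j = {\<lambda>x. a + lin_contract c b x |a b. a \<in> alt j \<and> b \<in> alt (j + 1)}"
proof -
  have sub: "(\<Sum>i\<in>UNIV. c $ i *\<^sub>R contract i b) \<in> alt j" if "b \<in> alt (j + 1)" for b :: "real ^ ('a set)"
    using that by (intro subspace_sum[OF subspace_alt] subspace_scale[OF subspace_alt] contract_alt) auto
  have "(P1_minus j :: 'a form set) = {\<lambda>x. a + lin_contract 0 b x |a b. a \<in> alt j \<and> b \<in> alt (j + 1)}"
  proof (intro equalityI subsetI)
    fix f :: "'a form" assume "f \<in> P1_minus j"
    then show "f \<in> {\<lambda>x. a + lin_contract 0 b x |a b. a \<in> alt j \<and> b \<in> alt (j + 1)}"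
      by (auto simp: P1_minus_def P0_def koszul_eq)
  next
    fix f :: "'a form" assume "f \<in> {\<lambda>x. a + lin_contract 0 b x |a b. a \<in> alt j \<and> b \<in> alt (j + 1)}"
    then obtain a b where "f = (\<lambda>x. a + lin_contract 0 b x)" "a \<in> alt j" "b \<in> alt (j + 1)" by auto
    then show "f \<in> P1_minus j"
      unfolding P1_minus_def mem_Collect_eq
      by (intro exI[of _ "\<lambda>x. a"] exI[of _ "\<lambda>x. b"] conjI) (simp_all add: const_mem_P0 koszul_eq)
  qed
  also have "\<dots> = {\<lambda>x. a + lin_contract c b x |a b. a \<in> alt j \<and> b \<in> alt (j + 1)}"
  proof (intro equalityI subsetI)
    fix f :: "'a form" assume "f \<in> {\<lambda>x. a + lin_contract 0 b x |a b. a \<in> alt j \<and> b \<in> alt (j + 1)}"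
    then obtain a b where f: "f = (\<lambda>x. a + lin_contract 0 b x)" and ab: "a \<in> alt j" "b \<in> alt (j + 1)" by auto
    have "f = (\<lambda>x. (a + (\<Sum>i\<in>UNIV. c $ i *\<^sub>R contract i b)) + lin_contract c b x)"
      by (simp add: f lin_contract_shift[of b _ c] add.assoc)
    with ab sub show "f \<in> {\<lambda>x. a + lin_contract c b x |a b. a \<in> alt j \<and> b \<in> alt (j + 1)}"
      by (blast intro: subspace_add[OF subspace_alt])
  next
    fix f :: "'a form" assume "f \<in> {\<lambda>x. a + lin_contract c b x |a b. a \<in> alt j \<and> b \<in> alt (j + 1)}"
    then obtain a b where f: "f = (\<lambda>x. a + lin_contract c b x)" and ab: "a \<in> alt j" "b \<in> alt (j + 1)" by auto
    have "f = (\<lambda>x. (a - (\<Sum>i\<in>UNIV. c $ i *\<^sub>R contract i b)) + lin_contract 0 b x)"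
      by (simp add: f lin_contract_shift[of b _ c])
    with ab sub show "f \<in> {\<lambda>x. a + lin_contract 0 b x |a b. a \<in> alt j \<and> b \<in> alt (j + 1)}"
      by (blast intro: subspace_diff[OF subspace_alt])
  qed
  finally show ?thesis .
qed

text \<open>The sign \<open>koszul_sign\<close> is its own inverse and can therefore be absorbed
  into \<open>b\<close> in both directions. Writing the degree as \<open>j + 1\<close> makes the
  truncated subtraction in the definition exact.\<close>

lemma P1_star_minus_eq:
  "P1_star_minus (j + 1) = {\<lambda>x. a + lin_wedge c b x |a b. a \<in> alt (j + 1) \<and> b \<in> alt j}"
proof -
  let ?s = "koszul_sign CARD('a) j"
  have sub: "(\<Sum>i\<in>UNIV. c $ i *\<^sub>R dx_wedge i b) \<in> alt (j + 1)" if "b \<in> alt j" for b :: "real ^ ('a set)"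
    using dx_wedge_alt[OF that] by (intro subspace_sum[OF subspace_alt] subspace_scale[OF subspace_alt]) auto
  have scale: "?s *\<^sub>R b \<in> alt j" if "b \<in> alt j" for b :: "real ^ ('a set)"
    using that by (rule subspace_scale[OF subspace_alt])
  note cmul = linear_cmul[OF linear_lin_wedge]
  show ?thesis
  proof (intro equalityI subsetI)
    fix f :: "'a form" assume "f \<in> P1_star_minus (j + 1)"
    then obtain a b where f: "f = (\<lambda>x. a + star (koszul 0 (star (\<lambda>x. b))) x)" and ab: "a \<in> alt (j + 1)" "b \<in> alt j"
      by (auto simp: P1_star_minus_def P0_def)
    have "f = (\<lambda>x. (a + (\<Sum>i\<in>UNIV. c $ i *\<^sub>R dx_wedge i (?s *\<^sub>R b))) + lin_wedge c (?s *\<^sub>R b) x)"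
      by (simp add: f star_koszul_star_eq[OF ab(2)] add.assoc flip: lin_wedge_shift) (simp add: cmul)
    with ab sub[OF scale] scale show "f \<in> {\<lambda>x. a + lin_wedge c b x |a b. a \<in> alt (j + 1) \<and> b \<in> alt j}"
      by (blast intro: subspace_add[OF subspace_alt])
  next
    fix f :: "'a form" assume "f \<in> {\<lambda>x. a + lin_wedge c b x |a b. a \<in> alt (j + 1) \<and> b \<in> alt j}"
    then obtain a b where f: "f = (\<lambda>x. a + lin_wedge c b x)" and ab: "a \<in> alt (j + 1)" "b \<in> alt j" by auto
    have "f = (\<lambda>x. (a - (\<Sum>i\<in>UNIV. c $ i *\<^sub>R dx_wedge i b)) + star (koszul 0 (star (\<lambda>x. ?s *\<^sub>R b))) x)"
      by (simp add: f star_koszul_star_eq[OF scale[OF ab(2)]] cmul lin_wedge_shift[of b _ c])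
    moreover have "a - (\<Sum>i\<in>UNIV. c $ i *\<^sub>R dx_wedge i b) \<in> alt (j + 1)"
      using ab sub by (intro subspace_diff[OF subspace_alt])
    ultimately show "f \<in> P1_star_minus (j + 1)"
      using scale[OF ab(2)] unfolding P1_star_minus_def mem_Collect_eq
      by (intro exI[of _ "\<lambda>x. a - (\<Sum>i\<in>UNIV. c $ i *\<^sub>R dx_wedge i b)"] exI[of _ "\<lambda>x. ?s *\<^sub>R b"] conjI)
        (simp_all add: const_mem_P0)
  qed
qed

text \<open>The projection \<open>contract i (dx_wedge i w)\<close> keeps the coefficients whose
  index set omits \<open>i\<close>. It replaces the sum over the complement of each multi-index in
  \<open>mu_d\<close> by one over all directions, to which the operator identities apply.\<close>

definition quad :: "(real ^ 'n::{finite,linorder}) set \<Rightarrow> real ^ ('n set) \<Rightarrow> 'n::{finite,linorder} form" where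
  "quad T w x = (\<Sum>i\<in>UNIV. ((x $ i - centre T $ i)\<^sup>2 - mean_const T (\<lambda>y. (y $ i - centre T $ i)\<^sup>2))
      *\<^sub>R contract i (dx_wedge i w))"

lemma quad_nth:
  "quad T w x $ J = (\<Sum>i\<in>- J. (x $ i - centre T $ i)\<^sup>2 - mean_const T (\<lambda>y. (y $ i - centre T $ i)\<^sup>2)) * w $ J"
  unfolding quad_def sum_component vector_scaleR_component contract_dx_wedge_nth sum_distrib_right
  by (rule sum.mono_neutral_cong_right) auto

lemma H2_d_eq: "H2_d T k = quad T ` alt k"
proof -
  have eq: "(\<Sum>\<alpha> | card \<alpha> = k. a \<alpha> *\<^sub>R mu_d T \<alpha> x) = quad T w x"
    if w: "\<And>\<alpha>. w $ \<alpha> = (if card \<alpha> = k then a \<alpha> else 0)" for w a and x :: "real ^ 'a::{finite,linorder}"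
  proof (subst vec_eq_iff, intro allI)
    fix J
    have "(\<Sum>\<alpha> | card \<alpha> = k. a \<alpha> *\<^sub>R mu_d T \<alpha> x) $ J
      = (\<Sum>\<alpha>\<in>{\<alpha>. card \<alpha> = k}. if \<alpha> = J then quad T w x $ J else 0)"
      unfolding sum_component
      by (rule sum.cong) (auto simp: mu_d_def quad_nth w axis_def mult.commute)
    also have "\<dots> = quad T w x $ J" using w by (auto simp: sum.delta quad_nth)
    finally show "(\<Sum>\<alpha> | card \<alpha> = k. a \<alpha> *\<^sub>R mu_d T \<alpha> x) $ J = quad T w x $ J" .
  qed
  show ?thesis
  proof (intro equalityI subsetI)
    fix f assume "f \<in> H2_d T k"
    then obtain a where f: "f = (\<lambda>x. \<Sum>\<alpha> | card \<alpha> = k. a \<alpha> *\<^sub>R mu_d T \<alpha> x)" by (auto simp: H2_d_def)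
    let ?w = "\<chi> \<alpha>. if card \<alpha> = k then a \<alpha> else 0"
    have "f = quad T ?w" unfolding f by (rule ext, rule eq) simp
    moreover have "?w \<in> alt k" by (simp add: alt_def)
    ultimately show "f \<in> quad T ` alt k" by blast
  next
    fix f assume "f \<in> quad T ` alt k"
    then obtain w where f: "f = quad T w" and w: "w \<in> alt k" by auto
    have "f = (\<lambda>x. \<Sum>\<alpha> | card \<alpha> = k. (w $ \<alpha>) *\<^sub>R mu_d T \<alpha> x)"
      unfolding f by (rule ext, rule eq[symmetric]) (use w in \<open>auto simp: alt_def\<close>)
    then show "f \<in> H2_d T k" by (auto simp: H2_d_def)
  qed
qed

text \<open>It also covers the test forms, as the cases with \<open>h = 0\<close> and one of
  \<open>b\<close>, \<open>c\<close> zero, so one computation of derivative and codifferential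
  serves both sides of the equations.\<close>

definition poly_form :: "(real ^ 'n::{finite,linorder}) set \<Rightarrow> real ^ ('n set) \<Rightarrow> real ^ ('n set) \<Rightarrow> real ^ ('n set) \<Rightarrow>
    real ^ ('n set) \<Rightarrow> 'n::{finite,linorder} form" where
  "poly_form T a b c h x = a + lin_contract (centre T) b x + lin_wedge (centre T) c x + quad T h x"

lemma PLambda_eq:
  assumes "1 \<le> k"
  shows "PLambda T k = {poly_form T a b c h |a b c h. a \<in> alt k \<and> b \<in> alt (k + 1) \<and> c \<in> alt (k - 1) \<and> h \<in> alt k}"
proof -
  let ?s = "koszul_sign CARD('a) (k - 1)"
  have scale: "?s *\<^sub>R c \<in> alt (k - 1)" if "c \<in> alt (k - 1)" for c :: "real ^ ('a set)"
    using that by (rule subspace_scale[OF subspace_alt])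
  note cmul = linear_cmul[OF linear_lin_wedge]
  show ?thesis
  proof (intro equalityI subsetI)
    fix f assume "f \<in> PLambda T k"
    then obtain a b c h where f: "f = (\<lambda>x. a + koszul (centre T) (\<lambda>x. b) x
        + star (koszul (centre T) (star (\<lambda>x. c))) x + quad T h x)"
      and mem: "a \<in> alt k" "b \<in> alt (k + 1)" "c \<in> alt (k - 1)" "h \<in> alt k"
      unfolding PLambda_def P0_def H2_d_eq by auto
    have "f = poly_form T a b (?s *\<^sub>R c) h"
      by (simp add: f poly_form_def fun_eq_iff koszul_eq star_koszul_star_eq[OF mem(3)] cmul)
    with mem scale show "f \<in> {poly_form T a b c h |a b c h. a \<in> alt k \<and> b \<in> alt (k + 1) \<and> c \<in> alt (k - 1) \<and> h \<in> alt k}"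
      by blast
  next
    fix f :: "'a form" assume "f \<in> {poly_form T a b c h |a b c h. a \<in> alt k \<and> b \<in> alt (k + 1) \<and> c \<in> alt (k - 1) \<and> h \<in> alt k}"
    then obtain a b c h where f: "f = poly_form T a b c h"
      and mem: "a \<in> alt k" "b \<in> alt (k + 1)" "c \<in> alt (k - 1)" "h \<in> alt k" by auto
    have "f = (\<lambda>x. a + koszul (centre T) (\<lambda>x. b) x
        + star (koszul (centre T) (star (\<lambda>x. ?s *\<^sub>R c))) x + quad T h x)"
      by (simp add: f poly_form_def fun_eq_iff koszul_eq star_koszul_star_eq[OF scale[OF mem(3)]] cmul
          del: One_nat_def)
    with mem scale[OF mem(3)] show "f \<in> PLambda T k"
      unfolding PLambda_def H2_d_eq mem_Collect_eq
      by (intro exI[of _ "\<lambda>x. a"] exI[of _ "\<lambda>x. b"] exI[of _ "\<lambda>x. ?s *\<^sub>R c"] exI[of _ "quad T h"] conjI)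
        (simp_all add: const_mem_P0)
  qed
qed

definition poly_form_partial :: "(real ^ 'n::{finite,linorder}) set \<Rightarrow> real ^ ('n set) \<Rightarrow> real ^ ('n set) \<Rightarrow> real ^ ('n set) \<Rightarrow>
    'n::{finite,linorder} \<Rightarrow> 'n form" where
  "poly_form_partial T b c h i x = contract i b + dx_wedge i c
     + (2 * (x $ i - centre T $ i)) *\<^sub>R contract i (dx_wedge i h)"

lemma C1_form_poly_form: "C1_form (poly_form T a b c h) (poly_form_partial T b c h)"
  unfolding C1_form_def
proof (intro conjI allI)
  fix x
  note [derivative_intros] = bounded_linear_imp_has_derivative[OF bounded_linear_vec_nth]
  show "(poly_form T a b c h has_derivative (\<lambda>v. \<Sum>i\<in>UNIV. v $ i *\<^sub>R poly_form_partial T b c h i x)) (at x)"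
    unfolding poly_form_def[abs_def] lin_contract_def lin_wedge_def quad_def poly_form_partial_def
    by (rule has_derivative_eq_rhs, (rule derivative_eq_intros refl)+)
       (simp add: fun_eq_iff scaleR_add_right sum.distrib mult_ac)
  show "continuous_on UNIV (poly_form_partial T b c h i)" for i
    unfolding poly_form_partial_def[abs_def] by (intro continuous_intros)
qed

text \<open>The \<open>c\<close> part dies because a repeated wedge vanishes, the \<open>b\<close>
  part is multiplied by its degree, and in the \<open>h\<close> part the projection disappears under
  the wedge.\<close>

lemma sum_dx_wedge_poly_form_partial:
  assumes "b \<in> alt (k + 1)"
  shows "(\<Sum>i\<in>UNIV. dx_wedge i (poly_form_partial T b c h i x))
    = real (k + 1) *\<^sub>R b + 2 *\<^sub>R lin_wedge (centre T) h x"
  using sum_dx_wedge_contract[OF assms]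
  by (simp add: poly_form_partial_def linear_add[OF linear_dx_wedge] linear_cmul[OF linear_dx_wedge]
      sum.distrib lin_wedge_def scaleR_sum_right)

text \<open>In direction \<open>i\<close> the \<open>b\<close> and \<open>h\<close> parts both begin
  with \<open>contract i\<close> and are annihilated by a second one; only \<open>c\<close> is
  left.\<close>

lemma sum_contract_poly_form_partial:
  fixes c :: "real ^ ('n::{finite,linorder} set)"
  assumes "c \<in> alt j"
  shows "(\<Sum>i\<in>UNIV. contract i (poly_form_partial T b c h i x)) = (real CARD('n) - real j) *\<^sub>R c"
  using sum_contract_dx_wedge[OF assms]
  by (simp add: poly_form_partial_def linear_add[OF linear_contract] linear_cmul[OF linear_contract]
      sum.distrib)

text \<open>The condition on \<open>c\<close> concerns its wedges and not membership in
  \<open>alt (j - 1)\<close>, so that it holds for \<open>c = 0\<close> in degree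
  \<open>j = 0\<close>, which the test forms have when \<open>k = 1\<close>.\<close>

lemma poly_form_partial_alt:
  assumes "b \<in> alt (j + 1)" "\<And>i. dx_wedge i c \<in> alt j" "h \<in> alt j"
  shows "poly_form_partial T b c h i x \<in> alt j"
  unfolding poly_form_partial_def
  using assms contract_alt[of b j i] contract_alt[OF dx_wedge_alt[OF assms(3)], of i i]
  by (intro subspace_add[OF subspace_alt] subspace_scale[OF subspace_alt]) auto

subsection \<open>The interpolation equations\<close>

lemma continuous_on_lin_contract: "continuous_on S (lin_contract c w)"
  unfolding lin_contract_def[abs_def] by (intro continuous_intros)

lemma continuous_on_lin_wedge: "continuous_on S (lin_wedge c w)"
  unfolding lin_wedge_def[abs_def] by (intro continuous_intros)

lemma continuous_on_quad: "continuous_on S (quad T w)"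
  unfolding quad_def[abs_def] by (intro continuous_intros)

lemma continuous_on_poly_form: "continuous_on S (poly_form T a b c h)"
  by (rule C1_form_continuous[OF C1_form_poly_form])

lemma lin_contract_0 [simp]: "lin_contract c 0 x = 0"
  by (rule linear_0[OF linear_lin_contract])

lemma lin_wedge_0 [simp]: "lin_wedge c 0 x = 0"
  by (rule linear_0[OF linear_lin_wedge])

lemma quad_0 [simp]: "quad T 0 x = 0"
  by (simp add: vec_eq_iff quad_nth)

lemma zero_alt [simp]: "0 \<in> alt j"
  by (rule subspace_0[OF subspace_alt])

text \<open>The factor by which the codifferential multiplies the constant \<open>c\<close> of the
  wedge part, whose degree is \<open>j - 1\<close>.\<close>

definition codiff_factor :: "nat \<Rightarrow> nat \<Rightarrow> real" where
  "codiff_factor n j = codiff_sign n j * (real n - real (j - 1))"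

context convex_body
begin

abbreviation K :: "real ^ ('n set) \<Rightarrow> 'n form" where "K \<equiv> lin_contract (centre T)"
abbreviation E :: "real ^ ('n set) \<Rightarrow> 'n form" where "E \<equiv> lin_wedge (centre T)"

lemma norm_K_le:
  assumes "x \<in> T" shows "norm (K w x) \<le> real CARD('n) * diam * norm w"
proof -
  have "norm (K w x) \<le> (\<Sum>i\<in>(UNIV::'n set). diam * norm w)"
    unfolding lin_contract_def
    by (rule order_trans[OF norm_sum], rule sum_mono)
       (auto intro!: mult_mono abs_centred_le assms norm_contract_le diam_nonneg)
  then show ?thesis by simp
qed

lemma norm_E_le:
  assumes "x \<in> T" shows "norm (E w x) \<le> real CARD('n) * diam * norm w"
proof -
  have "norm (E w x) \<le> (\<Sum>i\<in>(UNIV::'n set). diam * norm w)"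
    unfolding lin_wedge_def
    by (rule order_trans[OF norm_sum], rule sum_mono)
       (auto intro!: mult_mono abs_centred_le assms norm_dx_wedge_le diam_nonneg)
  then show ?thesis by simp
qed

text \<open>A square and its mean both lie between 0 and \<open>diam\<^sup>2\<close>, and so their
  difference is bounded by \<open>diam\<^sup>2\<close> too.\<close>

lemma norm_quad_le:
  assumes "x \<in> T" shows "norm (quad T w x) \<le> real CARD('n) * diam\<^sup>2 * norm w"
proof -
  have sq: "0 \<le> (y $ i - centre T $ i)\<^sup>2 \<and> (y $ i - centre T $ i)\<^sup>2 \<le> diam\<^sup>2" if "y \<in> T" for y i
    using power_mono[OF abs_centred_le[OF that, of i], of 2] by simp
  have m: "0 \<le> mean_const T (\<lambda>y. (y $ i - centre T $ i)\<^sup>2)"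
    "mean_const T (\<lambda>y. (y $ i - centre T $ i)\<^sup>2) \<le> diam\<^sup>2" for i
    using sq by (intro mean_const_bounds[where l=0 and u="diam\<^sup>2"] continuous_intros; simp)+
  have coeff: "\<bar>(x $ i - centre T $ i)\<^sup>2 - mean_const T (\<lambda>y. (y $ i - centre T $ i)\<^sup>2)\<bar> \<le> diam\<^sup>2" for i
    using sq[OF assms, of i] m[of i] by linarith
  have w: "norm (contract i (dx_wedge i w)) \<le> norm w" for i
    by (rule order_trans[OF norm_contract_le norm_dx_wedge_le])
  have "norm (quad T w x) \<le> (\<Sum>i\<in>(UNIV::'n set). diam\<^sup>2 * norm w)"
    unfolding quad_def
    by (rule order_trans[OF norm_sum], rule sum_mono) (auto intro!: mult_mono coeff w)
  then show ?thesis by simp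
qed

lemma L2_inner_sum_const:
  assumes "\<And>i. i \<in> I \<Longrightarrow> continuous_on T (f i)" "\<And>i. i \<in> I \<Longrightarrow> (LINT x|lebesgue_on T. f i x) = 0"
  shows "L2_inner T (\<lambda>x. \<Sum>i\<in>I. f i x *\<^sub>R v i) (\<lambda>x. w) = 0"
proof -
  have "L2_inner T (\<lambda>x. \<Sum>i\<in>I. f i x *\<^sub>R v i) (\<lambda>x. w) = (LINT x|lebesgue_on T. (\<Sum>i\<in>I. f i x * (v i \<bullet> w)))"
    by (simp add: L2_inner_def inner_sum_left)
  also have "\<dots> = (\<Sum>i\<in>I. (LINT x|lebesgue_on T. f i x * (v i \<bullet> w)))"
    using assms by (intro Bochner_Integration.integral_sum integrable_mult_left integrable_continuous)
  also have "\<dots> = 0" using assms by simp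
  finally show ?thesis .
qed

lemma L2_inner_K_const: "L2_inner T (K w) (\<lambda>x. v) = 0"
  unfolding lin_contract_def[abs_def]
  by (rule L2_inner_sum_const) (auto intro!: continuous_intros integral_centred)

lemma L2_inner_E_const: "L2_inner T (E w) (\<lambda>x. v) = 0"
  unfolding lin_wedge_def[abs_def]
  by (rule L2_inner_sum_const) (auto intro!: continuous_intros integral_centred)

lemma L2_inner_quad_const: "L2_inner T (quad T w) (\<lambda>x. v) = 0"
  unfolding quad_def[abs_def]
  by (rule L2_inner_sum_const) (auto intro!: continuous_intros integral_minus_mean_const)

lemma L2_inner_const: "L2_inner T (\<lambda>x. w) (\<lambda>x. v) = vol * (w \<bullet> v)"
  by (simp add: L2_inner_def)

lemmas square_integrable_forms = square_integrable_continuous[OF continuous_on_const]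
  square_integrable_continuous[OF continuous_on_lin_contract]
  square_integrable_continuous[OF continuous_on_lin_wedge]
  square_integrable_continuous[OF continuous_on_quad]
  square_integrable_continuous[OF continuous_on_poly_form]

lemma L2_inner_poly_form_const: "L2_inner T (poly_form T a b c h) (\<lambda>x. v) = vol * (a \<bullet> v)"
proof -
  have "L2_inner T (\<lambda>x. v) (poly_form T a b c h) = L2_inner T (\<lambda>x. v) (\<lambda>x. a + K b x + E c x + quad T h x)"
    by (simp add: poly_form_def[abs_def])
  also have "\<dots> = L2_inner T (\<lambda>x. v) (\<lambda>x. a) + L2_inner T (\<lambda>x. v) (K b) + L2_inner T (\<lambda>x. v) (E c)
      + L2_inner T (\<lambda>x. v) (quad T h)"
    by (subst L2_inner_add_right; (intro square_integrable_forms square_integrable_continuous continuous_intros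
        continuous_on_lin_contract continuous_on_lin_wedge)?)+ simp
  also have "\<dots> = vol * (a \<bullet> v)"
    by (simp add: L2_inner_commute[of T "\<lambda>x. v"] L2_inner_K_const L2_inner_E_const L2_inner_quad_const
        L2_inner_const)
  finally show ?thesis by (simp add: L2_inner_commute[of T "\<lambda>x. v"])
qed

text \<open>Every coefficient of \<open>E h\<close> is linear in \<open>x - centre T\<close>, with
  gradient \<open>v J\<close>. The second moment bound applies to each, and the squared gradients
  add up to \<open>(n - j) * (norm h)\<^sup>2\<close>, which is at least
  \<open>(norm h)\<^sup>2\<close>.\<close>

lemma L2_inner_E_ge:
  assumes h: "h \<in> alt j" "j < CARD('n)"
    and ball: "cball z r \<subseteq> T" "0 < r" "diam \<le> 2 * \<rho> * r" "0 < \<rho>"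
  shows "vol * diam\<^sup>2 * (norm h)\<^sup>2 / (8 * \<rho>) ^ (CARD('n) + 2) \<le> L2_inner T (E h) (E h)"
proof -
  define v :: "'n set \<Rightarrow> real ^ 'n::{finite,linorder}" where "v J = (\<chi> i. dx_wedge i h $ J)" for J
  let ?q = "vol * diam\<^sup>2 / (8 * \<rho>) ^ (CARD('n) + 2)"
  have q: "0 \<le> ?q" using vol_pos ball by simp
  have E: "E h x $ J = (x - centre T) \<bullet> v J" for x J
    by (simp add: lin_wedge_def v_def inner_vec_def)
  have "(\<Sum>J\<in>UNIV. (norm (v J))\<^sup>2) = (\<Sum>J\<in>UNIV. \<Sum>i\<in>UNIV. (dx_wedge i h $ J)\<^sup>2)"
    by (simp add: v_def norm_vec_def L2_set_def sum_nonneg)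
  also have "\<dots> = (\<Sum>i\<in>UNIV. (norm (dx_wedge i h))\<^sup>2)"
    by (subst sum.swap) (simp add: norm_vec_def L2_set_def sum_nonneg)
  also have "\<dots> = (real CARD('n) - real j) * (norm h)\<^sup>2"
    by (rule sum_norm_dx_wedge[OF h(1)])
  also have "\<dots> \<ge> 1 * (norm h)\<^sup>2" using h(2) by (intro mult_right_mono) auto
  finally have "(norm h)\<^sup>2 \<le> (\<Sum>J\<in>UNIV. (norm (v J))\<^sup>2)" by simp
  then have "?q * (norm h)\<^sup>2 \<le> ?q * (\<Sum>J\<in>UNIV. (norm (v J))\<^sup>2)" using q by (rule mult_left_mono)
  also have "\<dots> = (\<Sum>J\<in>UNIV. vol * diam\<^sup>2 * (norm (v J))\<^sup>2 / (8 * \<rho>) ^ (CARD('n) + 2))"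
    by (simp add: sum_distrib_left)
  also have "\<dots> \<le> (\<Sum>J\<in>UNIV. (LINT x|lebesgue_on T. ((x - centre T) \<bullet> v J)\<^sup>2))"
    by (intro sum_mono second_moment_ge[OF ball])
  also have "\<dots> = (LINT x|lebesgue_on T. (\<Sum>J\<in>UNIV. ((x - centre T) \<bullet> v J)\<^sup>2))"
    by (intro Bochner_Integration.integral_sum[symmetric] integrable_continuous continuous_intros)
  also have "\<dots> = L2_inner T (E h) (E h)"
    by (simp add: L2_inner_def inner_vec_def[of "E h _"] E power2_eq_square)
  finally show ?thesis by simp
qed

lemma weak_d_poly_form:
  assumes mem: "b \<in> alt (j + 1)" "\<And>i. dx_wedge i c \<in> alt j" "h \<in> alt j"
  shows "AE x in lebesgue_on T. weak_d T j (poly_form T a b c h) x = real (j + 1) *\<^sub>R b + 2 *\<^sub>R E h x"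
    and "square_integrable_on (weak_d T j (poly_form T a b c h)) T"
proof -
  have w: "has_weak_d T j (poly_form T a b c h) (\<lambda>x. \<Sum>i\<in>UNIV. dx_wedge i (poly_form_partial T b c h i x))"
    by (rule has_weak_d_C1[OF compact C1_form_poly_form]) (rule poly_form_partial_alt[OF mem])
  show "AE x in lebesgue_on T. weak_d T j (poly_form T a b c h) x = real (j + 1) *\<^sub>R b + 2 *\<^sub>R E h x"
    using weak_d_AE_eq[OF compact negligible_frontier w]
    unfolding sum_dx_wedge_poly_form_partial[OF mem(1)] .
  show "square_integrable_on (weak_d T j (poly_form T a b c h)) T"
    using weak_d_has_weak_d[OF w] by (auto simp: has_weak_d_def intro: L2_forms_square_integrable)
qed

lemma codiff_poly_form:
  assumes mem: "b \<in> alt (j + 1)" "c \<in> alt (j - 1)" "h \<in> alt j" and j: "1 \<le> j"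
  shows "AE x in lebesgue_on T. codiff T j (poly_form T a b c h) x
      = codiff_factor CARD('n) j *\<^sub>R c"
    and "square_integrable_on (codiff T j (poly_form T a b c h)) T"
proof -
  have "dx_wedge i c \<in> alt j" for i using dx_wedge_alt[OF mem(2), of i] j by simp
  note alt = poly_form_partial_alt[OF mem(1) this mem(3)]
  show "AE x in lebesgue_on T. codiff T j (poly_form T a b c h) x
      = codiff_factor CARD('n) j *\<^sub>R c"
    using codiff_AE_eq[OF j compact negligible_frontier C1_form_poly_form alt]
    unfolding sum_contract_poly_form_partial[OF mem(2)] by (simp add: codiff_factor_def del: One_nat_def)
  have "square_integrable_on (weak_d T (CARD('n) - j) (star (poly_form T a b c h))) T"
    using weak_d_has_weak_d[OF has_weak_d_star[OF compact C1_form_poly_form alt]]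
    by (auto simp: has_weak_d_def intro: L2_forms_square_integrable)
  then show "square_integrable_on (codiff T j (poly_form T a b c h)) T"
    unfolding codiff_def by (rule square_integrable_hodge)
qed

end

section \<open>The linear system for the coefficients of the interpolant\<close>

locale interpolation = convex_body T for T :: "(real ^ 'n::{finite,linorder}) set" +
  fixes k :: nat and \<mu> :: "'n form"
  assumes k: "1 \<le> k" "k < CARD('n)" and \<mu>: "\<mu> \<in> HLambda T k" "\<mu> \<in> HstarLambda T k"
begin

abbreviation D :: "'n form" where "D \<equiv> weak_d T k \<mu>"
abbreviation S :: "'n form" where "S \<equiv> codiff T k \<mu>"

lemma square_integrable_data: "square_integrable_on \<mu> T" "square_integrable_on D T" "square_integrable_on S T"
proof -
  show "square_integrable_on \<mu> T" using \<mu> by (auto simp: HLambda_def intro: L2_forms_square_integrable)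
  show "square_integrable_on D T" using \<mu>(1) weak_d_has_weak_d
    by (fastforce simp: HLambda_def has_weak_d_def intro: L2_forms_square_integrable)
  have "square_integrable_on (weak_d T (CARD('n) - k) (star \<mu>)) T"
    using \<mu>(2) weak_d_has_weak_d
    by (fastforce simp: HstarLambda_def has_weak_d_def intro: L2_forms_square_integrable)
  then show "square_integrable_on S T"
    unfolding codiff_def by (rule square_integrable_hodge)
qed


text \<open>The factors \<open>real (k + 1)\<close> and \<open>codiff_factor CARD('n) k\<close> come
  from differentiating the interpolant; \<open>real k\<close> and
  \<open>codiff_factor CARD('n) (k + 1)\<close> come from differentiating the test forms
  \<open>K v\<close> and \<open>E v\<close>. The last right-hand side is the only one that contains
  another unknown.\<close>

definition solves :: "real ^ ('n set) \<Rightarrow> real ^ ('n set) \<Rightarrow> real ^ ('n set) \<Rightarrow> real ^ ('n set) \<Rightarrow> bool" where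
  "solves a b c h \<longleftrightarrow> a \<in> alt k \<and> b \<in> alt (k + 1) \<and> c \<in> alt (k - 1) \<and> h \<in> alt k \<and>
    (\<forall>u\<in>alt (k - 1). codiff_factor CARD('n) k * vol * (c \<bullet> u) = L2_inner T S (\<lambda>x. u)) \<and>
    (\<forall>v\<in>alt k. real k * vol * (a \<bullet> v) = real k * L2_inner T \<mu> (\<lambda>x. v) - L2_inner T S (K v)) \<and>
    (\<forall>u\<in>alt (k + 1). real (k + 1) * vol * (b \<bullet> u) = L2_inner T D (\<lambda>x. u)) \<and>
    (\<forall>v\<in>alt k. 2 * L2_inner T (E h) (E v)
       = L2_inner T D (E v) - codiff_factor CARD('n) (k + 1) * (L2_inner T \<mu> (\<lambda>x. v) - vol * (a \<bullet> v)))"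

text \<open>Both families of equations are linear in the pair of constants \<open>u\<close>,
  \<open>v\<close> of the test form. Setting one constant to zero separates them into the four
  conditions, and addition recovers them.\<close>

lemma interpolates_poly_form_iff:
  assumes mem: "a \<in> alt k" "b \<in> alt (k + 1)" "c \<in> alt (k - 1)" "h \<in> alt k"
  shows "interpolates T k \<mu> (poly_form T a b c h) \<longleftrightarrow> solves a b c h"
proof -
  let ?p = "poly_form T a b c h"
  have dxc: "dx_wedge i c \<in> alt k" for i using dx_wedge_alt[OF mem(3), of i] k by simp
  note dp = weak_d_poly_form[OF mem(2) dxc mem(4)]
  note cp = codiff_poly_form[OF mem(2,3,4) k(1)]
  have eta: "L2_inner T (weak_d T k ?p) \<eta> - L2_inner T ?p (codiff T (k + 1) \<eta>)
        = real (k + 1) * vol * (b \<bullet> u) + 2 * L2_inner T (E h) (E v) - codiff_factor CARD('n) (k + 1) * vol * (a \<bullet> v) \<and>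
      L2_inner T D \<eta> - L2_inner T \<mu> (codiff T (k + 1) \<eta>)
        = L2_inner T D (\<lambda>x. u) + L2_inner T D (E v) - codiff_factor CARD('n) (k + 1) * L2_inner T \<mu> (\<lambda>x. v)"
    if \<eta>: "\<eta> = (\<lambda>x. u + E v x)" and uv: "u \<in> alt (k + 1)" "v \<in> alt k" for \<eta> u v
  proof -
    have pf: "\<eta> = poly_form T u 0 v 0" by (simp add: \<eta> poly_form_def[abs_def])
    have "v \<in> alt (k + 1 - 1)" using uv by simp
    note c\<eta> = codiff_poly_form[of 0 "k + 1" v 0 u, folded pf, OF zero_alt this zero_alt]
    have sq\<eta>: "square_integrable_on \<eta> T" unfolding pf by (rule square_integrable_forms)
    have "L2_inner T (weak_d T k ?p) \<eta> = L2_inner T (\<lambda>x. real (k + 1) *\<^sub>R b + 2 *\<^sub>R E h x) \<eta>"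
      by (intro L2_inner_cong dp sq\<eta> AE_I2 refl square_integrable_continuous continuous_intros continuous_on_lin_wedge)
    also have "\<dots> = L2_inner T \<eta> (\<lambda>x. real (k + 1) *\<^sub>R b) + L2_inner T \<eta> (\<lambda>x. 2 *\<^sub>R E h x)"
      unfolding L2_inner_commute[of T _ \<eta>]
      by (intro L2_inner_add_right sq\<eta> square_integrable_continuous continuous_intros continuous_on_lin_wedge)
    also have "L2_inner T \<eta> (\<lambda>x. real (k + 1) *\<^sub>R b) = real (k + 1) * vol * (b \<bullet> u)"
      unfolding pf L2_inner_poly_form_const by (simp add: inner_commute)
    also have "L2_inner T \<eta> (\<lambda>x. 2 *\<^sub>R E h x) = 2 * L2_inner T (E h) (\<lambda>x. u + E v x)"
      unfolding L2_inner_scaleR_right by (simp add: \<eta> L2_inner_commute)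
    also have "L2_inner T (E h) (\<lambda>x. u + E v x) = L2_inner T (E h) (E v)"
      by (simp add: L2_inner_add_right square_integrable_forms L2_inner_E_const)
    finally have 1: "L2_inner T (weak_d T k ?p) \<eta> = real (k + 1) * vol * (b \<bullet> u) + 2 * L2_inner T (E h) (E v)" .
    have 2: "L2_inner T \<omega> (codiff T (k + 1) \<eta>) = codiff_factor CARD('n) (k + 1) * L2_inner T \<omega> (\<lambda>x. v)" if "square_integrable_on \<omega> T" for \<omega>
    proof -
      have "L2_inner T \<omega> (codiff T (k + 1) \<eta>) = L2_inner T \<omega> (\<lambda>x. codiff_factor CARD('n) (k + 1) *\<^sub>R v)"
        by (rule L2_inner_cong[OF that that c\<eta>(2) square_integrable_forms(1) AE_I2 c\<eta>(1)]) simp_all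
      then show ?thesis by (simp only: L2_inner_scaleR_right)
    qed
    have 3: "L2_inner T D \<eta> = L2_inner T D (\<lambda>x. u) + L2_inner T D (E v)"
      unfolding \<eta> by (intro L2_inner_add_right square_integrable_data square_integrable_forms)
    show ?thesis
      unfolding 1 2[OF square_integrable_forms(5)] 2[OF square_integrable_data(1)] 3 L2_inner_poly_form_const by simp
  qed
  have tau: "L2_inner T (codiff T k ?p) \<tau> - L2_inner T ?p (weak_d T (k - 1) \<tau>)
        = codiff_factor CARD('n) k * vol * (c \<bullet> u) - real k * vol * (a \<bullet> v) \<and>
      L2_inner T S \<tau> - L2_inner T \<mu> (weak_d T (k - 1) \<tau>)
        = L2_inner T S (\<lambda>x. u) + L2_inner T S (K v) - real k * L2_inner T \<mu> (\<lambda>x. v)"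
    if \<tau>: "\<tau> = (\<lambda>x. u + K v x)" and uv: "u \<in> alt (k - 1)" "v \<in> alt k" for \<tau> u v
  proof -
    have pf: "\<tau> = poly_form T u v 0 0" by (simp add: \<tau> poly_form_def[abs_def])
    have z: "dx_wedge i (0 :: real ^ ('n set)) \<in> alt (k - 1)" for i
      by (simp add: linear_0[OF linear_dx_wedge])
    have kk: "k - 1 + 1 = k" using k by simp
    note w\<tau> = weak_d_poly_form[of v "k - 1" 0 0 u, unfolded kk, folded pf, OF uv(2) z zero_alt]
    have sq\<tau>: "square_integrable_on \<tau> T" unfolding pf by (rule square_integrable_forms)
    have "L2_inner T (codiff T k ?p) \<tau> = L2_inner T (\<lambda>x. codiff_factor CARD('n) k *\<^sub>R c) \<tau>"
      by (intro L2_inner_cong cp sq\<tau> AE_I2 refl square_integrable_forms)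
    also have "\<dots> = L2_inner T \<tau> (\<lambda>x. codiff_factor CARD('n) k *\<^sub>R c)" by (rule L2_inner_commute)
    also have "\<dots> = codiff_factor CARD('n) k * vol * (c \<bullet> u)"
      unfolding pf L2_inner_scaleR_right L2_inner_poly_form_const by (simp add: inner_commute)
    finally have 1: "L2_inner T (codiff T k ?p) \<tau> = codiff_factor CARD('n) k * vol * (c \<bullet> u)" .
    have 2: "L2_inner T \<omega> (weak_d T (k - 1) \<tau>) = real k * L2_inner T \<omega> (\<lambda>x. v)" if "square_integrable_on \<omega> T" for \<omega>
    proof -
      have "L2_inner T \<omega> (weak_d T (k - 1) \<tau>) = L2_inner T \<omega> (\<lambda>x. real k *\<^sub>R v)"
        by (rule L2_inner_cong[OF that that w\<tau>(2) square_integrable_forms(1) AE_I2]) (use w\<tau>(1) kk in simp_all)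
      then show ?thesis by (simp only: L2_inner_scaleR_right)
    qed
    have 3: "L2_inner T S \<tau> = L2_inner T S (\<lambda>x. u) + L2_inner T S (K v)"
      unfolding \<tau> by (intro L2_inner_add_right square_integrable_data square_integrable_forms)
    show ?thesis
      unfolding 1 2[OF square_integrable_forms(5)] 2[OF square_integrable_data(1)] 3 L2_inner_poly_form_const by simp
  qed
  have P: "?p \<in> PLambda T k" unfolding PLambda_eq[OF k(1)] using mem by blast
  have L0: "L2_inner T \<omega> (\<lambda>x. 0) = 0" "L2_inner T \<omega> (E 0) = 0" "L2_inner T \<omega> (K 0) = 0" for \<omega>
    by (simp_all add: L2_inner_def)
  have P1m: "P1_minus (k - 1) = {\<lambda>x. u + K v x |u v. u \<in> alt (k - 1) \<and> v \<in> alt k}"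
    using P1_minus_eq[of "k - 1" "centre T"] k by simp
  have "interpolates T k \<mu> ?p \<longleftrightarrow>
    (\<forall>u\<in>alt (k + 1). \<forall>v\<in>alt k. real (k + 1) * vol * (b \<bullet> u) + 2 * L2_inner T (E h) (E v) - codiff_factor CARD('n) (k + 1) * vol * (a \<bullet> v)
      = L2_inner T D (\<lambda>x. u) + L2_inner T D (E v) - codiff_factor CARD('n) (k + 1) * L2_inner T \<mu> (\<lambda>x. v)) \<and>
    (\<forall>u\<in>alt (k - 1). \<forall>v\<in>alt k. codiff_factor CARD('n) k * vol * (c \<bullet> u) - real k * vol * (a \<bullet> v)
      = L2_inner T S (\<lambda>x. u) + L2_inner T S (K v) - real k * L2_inner T \<mu> (\<lambda>x. v))"
    (is "_ \<longleftrightarrow> ?A \<and> ?B")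
  proof (intro iffI conjI ballI)
    fix u v :: "real ^ ('n set)" assume I: "interpolates T k \<mu> ?p" and uv: "u \<in> alt (k + 1)" "v \<in> alt k"
    then have "(\<lambda>x. u + E v x) \<in> P1_star_minus (k + 1)"
      unfolding P1_star_minus_eq[of k "centre T"] by blast
    with I eta[OF refl uv] show "real (k + 1) * vol * (b \<bullet> u) + 2 * L2_inner T (E h) (E v) - codiff_factor CARD('n) (k + 1) * vol * (a \<bullet> v)
      = L2_inner T D (\<lambda>x. u) + L2_inner T D (E v) - codiff_factor CARD('n) (k + 1) * L2_inner T \<mu> (\<lambda>x. v)"
      unfolding interpolates_def by metis
  next
    fix u v :: "real ^ ('n set)" assume I: "interpolates T k \<mu> ?p" and uv: "u \<in> alt (k - 1)" "v \<in> alt k"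
    then have "(\<lambda>x. u + K v x) \<in> P1_minus (k - 1)" unfolding P1m by blast
    with I tau[OF refl uv] show "codiff_factor CARD('n) k * vol * (c \<bullet> u) - real k * vol * (a \<bullet> v)
      = L2_inner T S (\<lambda>x. u) + L2_inner T S (K v) - real k * L2_inner T \<mu> (\<lambda>x. v)"
      unfolding interpolates_def by metis
  next
    assume AB: "?A \<and> ?B"
    show "interpolates T k \<mu> ?p"
      unfolding interpolates_def
    proof (intro conjI ballI P)
      fix \<eta> :: "'n form" assume "\<eta> \<in> P1_star_minus (k + 1)"
      then obtain u v where \<eta>: "\<eta> = (\<lambda>x. u + E v x)" and uv: "u \<in> alt (k + 1)" "v \<in> alt k"
        unfolding P1_star_minus_eq[of k "centre T"] by blast
      show "L2_inner T (weak_d T k ?p) \<eta> - L2_inner T ?p (codiff T (k + 1) \<eta>)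
        = L2_inner T D \<eta> - L2_inner T \<mu> (codiff T (k + 1) \<eta>)"
        using eta[OF \<eta> uv] AB uv by metis
    next
      fix \<tau> :: "'n form" assume "\<tau> \<in> P1_minus (k - 1)"
      then obtain u v where \<tau>: "\<tau> = (\<lambda>x. u + K v x)" and uv: "u \<in> alt (k - 1)" "v \<in> alt k"
        unfolding P1m by blast
      show "L2_inner T (codiff T k ?p) \<tau> - L2_inner T ?p (weak_d T (k - 1) \<tau>)
        = L2_inner T S \<tau> - L2_inner T \<mu> (weak_d T (k - 1) \<tau>)"
        using tau[OF \<tau> uv] AB uv by metis
    qed
  qed
  also have "\<dots> \<longleftrightarrow> solves a b c h"
  proof (intro iffI)
    assume AB: "?A \<and> ?B"
    have "codiff_factor CARD('n) k * vol * (c \<bullet> u) = L2_inner T S (\<lambda>x. u)" if "u \<in> alt (k - 1)" for u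
      using AB[THEN conjunct2, rule_format, OF that zero_alt] by (simp add: L0)
    moreover have "real k * vol * (a \<bullet> v) = real k * L2_inner T \<mu> (\<lambda>x. v) - L2_inner T S (K v)" if "v \<in> alt k" for v
      using AB[THEN conjunct2, rule_format, OF zero_alt that] by (simp add: L0)
    moreover have "real (k + 1) * vol * (b \<bullet> u) = L2_inner T D (\<lambda>x. u)" if "u \<in> alt (k + 1)" for u
      using AB[THEN conjunct1, rule_format, OF that zero_alt] by (simp add: L0)
    moreover have "2 * L2_inner T (E h) (E v)
       = L2_inner T D (E v) - codiff_factor CARD('n) (k + 1) * (L2_inner T \<mu> (\<lambda>x. v) - vol * (a \<bullet> v))" if "v \<in> alt k" for v
      using AB[THEN conjunct1, rule_format, OF zero_alt that] by (simp add: L0 algebra_simps)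
    ultimately show "solves a b c h" unfolding solves_def using mem by blast
  next
    assume s: "solves a b c h"
    show "?A \<and> ?B"
    proof (intro conjI ballI)
      fix u v :: "real ^ ('n set)" assume uv: "u \<in> alt (k + 1)" "v \<in> alt k"
      have "real (k + 1) * vol * (b \<bullet> u) = L2_inner T D (\<lambda>x. u)"
        "2 * L2_inner T (E h) (E v) = L2_inner T D (E v) - codiff_factor CARD('n) (k + 1) * (L2_inner T \<mu> (\<lambda>x. v) - vol * (a \<bullet> v))"
        using s uv unfolding solves_def by blast+
      then show "real (k + 1) * vol * (b \<bullet> u) + 2 * L2_inner T (E h) (E v) - codiff_factor CARD('n) (k + 1) * vol * (a \<bullet> v)
        = L2_inner T D (\<lambda>x. u) + L2_inner T D (E v) - codiff_factor CARD('n) (k + 1) * L2_inner T \<mu> (\<lambda>x. v)"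
        by (simp add: algebra_simps)
    next
      fix u v :: "real ^ ('n set)" assume uv: "u \<in> alt (k - 1)" "v \<in> alt k"
      have "codiff_factor CARD('n) k * vol * (c \<bullet> u) = L2_inner T S (\<lambda>x. u)"
        "real k * vol * (a \<bullet> v) = real k * L2_inner T \<mu> (\<lambda>x. v) - L2_inner T S (K v)"
        using s uv unfolding solves_def by blast+
      then show "codiff_factor CARD('n) k * vol * (c \<bullet> u) - real k * vol * (a \<bullet> v)
        = L2_inner T S (\<lambda>x. u) + L2_inner T S (K v) - real k * L2_inner T \<mu> (\<lambda>x. v)"
        by linarith
    qed
  qed
  finally show ?thesis .
qed

end

subsection \<open>Stability\<close>

context convex_body
begin

lemma E_definite:
  assumes v: "v \<in> alt j" "j < CARD('n)" "v \<noteq> 0"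
  shows "0 < L2_inner T (E v) (E v)"
proof -
  obtain z where "z \<in> interior T" using interior by blast
  then obtain r where r: "0 < r" "cball z r \<subseteq> T" unfolding mem_interior_cball by blast
  have "2 * r \<le> diam"
    using r diameter_subset[OF r(2)] compact by (simp add: compact_imp_bounded)
  \<comment> \<open>This choice turns the hypothesis on the diameter into an equality; for mere
    definiteness any ball inside \<open>T\<close> will do.\<close>
  let ?\<rho> = "diam / (2 * r)"
  have "0 < vol * diam\<^sup>2 * (norm v)\<^sup>2 / (8 * ?\<rho>) ^ (CARD('n) + 2)"
    using vol_pos v r \<open>2 * r \<le> diam\<close> by (intro divide_pos_pos mult_pos_pos zero_less_power) auto
  also have "\<dots> \<le> L2_inner T (E v) (E v)"
    by (rule L2_inner_E_ge[OF v(1,2) r(2,1)]) (use r \<open>2 * r \<le> diam\<close> in auto)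
  finally show ?thesis .
qed

lemma linear_L2_inner:
  assumes "square_integrable_on \<omega> T" "\<And>x. linear (\<lambda>v. F v x)" "\<And>v. continuous_on T (F v)"
  shows "linear (\<lambda>v. L2_inner T \<omega> (F v))"
proof (rule linearI)
  note sq = square_integrable_continuous[OF assms(3)]
  fix u v and c :: real
  have "F (u + v) = (\<lambda>x. F u x + F v x)" "F (c *\<^sub>R u) = (\<lambda>x. c *\<^sub>R F u x)"
    using linear_add[OF assms(2)] linear_cmul[OF assms(2)] by auto
  then show "L2_inner T \<omega> (F (u + v)) = L2_inner T \<omega> (F u) + L2_inner T \<omega> (F v)"
    "L2_inner T \<omega> (F (c *\<^sub>R u)) = c *\<^sub>R L2_inner T \<omega> (F u)"
    by (simp_all add: L2_inner_add_right[OF assms(1) sq sq] L2_inner_scaleR_right)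
qed

end

text \<open>The last step of every energy estimate: \<open>x\<close> is the scaled norm of an
  unknown, which may vanish.\<close>

lemma cancel_quadratic_bound:
  fixes q x y :: real
  assumes "q * (x * x) \<le> y * x" "0 \<le> x" "0 \<le> y" "0 \<le> q"
  shows "q * x \<le> y"
proof (cases "x = 0")
  case False
  then have "0 < x" using assms by simp
  have "(q * x) * x \<le> y * x" using assms(1) by (simp add: mult_ac)
  then show ?thesis using \<open>0 < x\<close> by (rule mult_right_le_imp_le)
qed (use assms in simp)

lemma abs_codiff_factor:
  assumes "j \<le> n" shows "\<bar>codiff_factor n j\<bar> = real n - real (j - 1)"
  using assms by (simp add: codiff_factor_def abs_mult)

context interpolation
begin

text \<open>The unknowns \<open>c\<close>, \<open>b\<close>, \<open>a\<close> are Riesz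
  representatives for the inner product of coefficients. Once \<open>a\<close> is fixed,
  \<open>h\<close> represents a functional with respect to the Gram form of \<open>E\<close>, which
  is definite in degree \<open>k\<close> because \<open>k\<close> is below the dimension.\<close>

lemma ex1_solution:
  "\<exists>a b c h. solves a b c h \<and> (\<forall>a' b' c' h'. solves a' b' c' h' \<longrightarrow> a' = a \<and> b' = b \<and> c' = c \<and> h' = h)"
proof -
  let ?cd = "codiff_factor CARD('n) k" and ?cd' = "codiff_factor CARD('n) (k + 1)"
  have cd: "?cd \<noteq> 0" using abs_codiff_factor[of k "CARD('n)"] k by auto
  have lin_const: "linear (\<lambda>v. L2_inner T \<omega> (\<lambda>x. v))" if "square_integrable_on \<omega> T" for \<omega>
    by (rule linear_L2_inner[OF that]) (auto intro: linear_ident)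
  have linK: "linear (\<lambda>v. L2_inner T \<omega> (K v))" if "square_integrable_on \<omega> T" for \<omega>
    by (rule linear_L2_inner[OF that linear_lin_contract continuous_on_lin_contract])
  have linE: "linear (\<lambda>v. L2_inner T \<omega> (E v))" if "square_integrable_on \<omega> T" for \<omega>
    by (rule linear_L2_inner[OF that linear_lin_wedge continuous_on_lin_wedge])
  have inner: "\<exists>!u. u \<in> alt j \<and> (\<forall>v\<in>alt j. u \<bullet> v = (f v :: real))" if "linear f"
    for f :: "real ^ ('n set) \<Rightarrow> real" and j
    by (rule definite_form_represents_alt[OF _ _ that])
       (auto simp: bilinear_def intro!: linearI inner_add_left inner_add_right)
  obtain c where c: "c \<in> alt (k - 1)" "\<forall>u\<in>alt (k - 1). c \<bullet> u = L2_inner T S (\<lambda>x. u) / (?cd * vol)"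
    and c_unique: "\<And>c'. c' \<in> alt (k - 1) \<Longrightarrow> \<forall>u\<in>alt (k - 1). c' \<bullet> u = L2_inner T S (\<lambda>x. u) / (?cd * vol) \<Longrightarrow> c' = c"
    using inner[of "\<lambda>u. L2_inner T S (\<lambda>x. u) / (?cd * vol)" "k - 1"] linear_compose_scale_right[OF lin_const[OF square_integrable_data(3)], of "1 / (?cd * vol)"]
    by (auto simp: ex1_iff_ex_Uniq Uniq_def)
  obtain b where b: "b \<in> alt (k + 1)" "\<forall>u\<in>alt (k + 1). b \<bullet> u = L2_inner T D (\<lambda>x. u) / (real (k + 1) * vol)"
    and b_unique: "\<And>b'. b' \<in> alt (k + 1) \<Longrightarrow> \<forall>u\<in>alt (k + 1). b' \<bullet> u = L2_inner T D (\<lambda>x. u) / (real (k + 1) * vol) \<Longrightarrow> b' = b"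
    using inner[of "\<lambda>u. L2_inner T D (\<lambda>x. u) / (real (k + 1) * vol)" "k + 1"] linear_compose_scale_right[OF lin_const[OF square_integrable_data(2)], of "1 / (real (k + 1) * vol)"]
    by (auto simp: ex1_iff_ex_Uniq Uniq_def)
  let ?fa = "\<lambda>v. (real k * L2_inner T \<mu> (\<lambda>x. v) - L2_inner T S (K v)) / (real k * vol)"
  have "linear (\<lambda>v. (1 / (real k * vol)) *\<^sub>R (real k *\<^sub>R L2_inner T \<mu> (\<lambda>x. v) - L2_inner T S (K v)))"
    by (intro linear_compose_scale_right linear_compose_sub lin_const linK square_integrable_data)
  then obtain a where a: "a \<in> alt k" "\<forall>v\<in>alt k. a \<bullet> v = ?fa v"
    and a_unique: "\<And>a'. a' \<in> alt k \<Longrightarrow> \<forall>v\<in>alt k. a' \<bullet> v = ?fa v \<Longrightarrow> a' = a"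
    using inner[of ?fa k] by (auto simp: ex1_iff_ex_Uniq Uniq_def)
  let ?fh = "\<lambda>v. L2_inner T D (E v) - ?cd' * (L2_inner T \<mu> (\<lambda>x. v) - vol * (a \<bullet> v))"
  have "linear (\<lambda>v. L2_inner T D (E v) - ?cd' *\<^sub>R (L2_inner T \<mu> (\<lambda>x. v) - vol *\<^sub>R (a \<bullet> v)))"
    by (intro linear_compose_scale_right linear_compose_sub lin_const linE square_integrable_data)
       (auto intro!: linearI simp: inner_add_right)
  moreover have "bilinear (\<lambda>u v. 2 * L2_inner T (E u) (E v))"
  proof -
    have lin: "linear (\<lambda>v. 2 * L2_inner T (E u) (E v))" for u
      using linear_compose_scale_right[OF linE[OF square_integrable_forms(3)], of 2] by simp
    have "(\<lambda>u. 2 * L2_inner T (E u) (E v)) = (\<lambda>u. 2 * L2_inner T (E v) (E u))" for v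
      by (rule ext, subst L2_inner_commute, rule refl)
    with lin show ?thesis unfolding bilinear_def by simp
  qed
  moreover have "0 < 2 * L2_inner T (E v) (E v)" if "v \<in> alt k" "v \<noteq> 0" for v
    using E_definite[OF that(1) k(2) that(2)] by simp
  ultimately have "\<exists>!h. h \<in> alt k \<and> (\<forall>v\<in>alt k. 2 * L2_inner T (E h) (E v) = ?fh v)"
    by (intro definite_form_represents_alt) simp_all
  then obtain h where h: "h \<in> alt k" "\<forall>v\<in>alt k. 2 * L2_inner T (E h) (E v) = ?fh v"
    and h_unique: "\<And>h'. h' \<in> alt k \<Longrightarrow> \<forall>v\<in>alt k. 2 * L2_inner T (E h') (E v) = ?fh v \<Longrightarrow> h' = h"
    by (auto simp: ex1_iff_ex_Uniq Uniq_def)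
  have div: "q * vol * x = y \<longleftrightarrow> x = y / (q * vol)" if "q \<noteq> 0" for q x y :: real
    using that vol_pos by (simp add: field_simps)
  have k0: "real k \<noteq> 0" "real (k + 1) \<noteq> 0" using k by auto
  have "solves a b c h"
    unfolding solves_def div[OF cd] div[OF k0(1)] div[OF k0(2)] using a b c h by blast
  moreover have "a' = a \<and> b' = b \<and> c' = c \<and> h' = h" if s: "solves a' b' c' h'" for a' b' c' h'
  proof -
    note s' = s[unfolded solves_def div[OF cd] div[OF k0(1)] div[OF k0(2)]]
    have "a' = a" using s' by (intro a_unique) auto
    moreover have "b' = b" using s' by (intro b_unique) auto
    moreover have "c' = c" using s' by (intro c_unique) auto
    \<comment> \<open>The right-hand side for \<open>h'\<close> contains \<open>a'\<close>, so
      \<open>a' = a\<close> has to be available first.\<close>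
    moreover have "h' = h" using s' \<open>a' = a\<close> by (intro h_unique) auto
    ultimately show ?thesis by blast
  qed
  ultimately show ?thesis by blast
qed

lemma interpolator_eq: "\<exists>a b c h. solves a b c h \<and> interpolator T k \<mu> = poly_form T a b c h"
proof -
  obtain a b c h where s: "solves a b c h"
    and unique: "\<And>a' b' c' h'. solves a' b' c' h' \<Longrightarrow> a' = a \<and> b' = b \<and> c' = c \<and> h' = h"
    using ex1_solution by blast
  have "interpolator T k \<mu> = poly_form T a b c h"
    unfolding interpolator_def
  proof (rule the_equality)
    show "interpolates T k \<mu> (poly_form T a b c h)"
      using s interpolates_poly_form_iff by (simp add: solves_def)
    fix p assume p: "interpolates T k \<mu> p"
    then obtain a' b' c' h' where "p = poly_form T a' b' c' h'"
      and "a' \<in> alt k" "b' \<in> alt (k + 1)" "c' \<in> alt (k - 1)" "h' \<in> alt k"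
      unfolding interpolates_def PLambda_eq[OF k(1)] by blast
    with p unique show "p = poly_form T a b c h" by (simp add: interpolates_poly_form_iff)
  qed
  with s show ?thesis by blast
qed

text \<open>The unknowns are scaled as forms: \<open>t * norm w\<close> is the L2 norm of the
  constant form \<open>w\<close>, and \<open>t * diam * norm h\<close> is the natural size of
  \<open>E h\<close>. In the bound for \<open>h\<close> the diameter from pairing with
  \<open>K\<close> and \<open>E\<close> is thereby absorbed on the left.\<close>

lemma solution_bounds:
  assumes s: "solves a b c h"
    and ball: "cball z r \<subseteq> T" "0 < r" "diam \<le> 2 * \<rho> * r" "0 < \<rho>"
  defines "t \<equiv> sqrt vol" and "n \<equiv> real CARD('n)"
  shows "(n - real (k - 1)) * (t * norm c) \<le> L2_norm T S"
    and "real (k + 1) * (t * norm b) \<le> L2_norm T D"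
    and "t * norm a \<le> L2_norm T \<mu> + n * diam * L2_norm T S"
    and "t * diam * norm h \<le> (8 * \<rho>) ^ (CARD('n) + 2) * (n * L2_norm T D + n\<^sup>2 * L2_norm T S)"
proof -
  have t: "0 \<le> t" "vol = t * t" using vol_pos by (simp_all add: t_def)
  have n: "real k \<le> n" "0 \<le> n" "1 \<le> real k" using k by (simp_all add: n_def)
  have const: "\<bar>L2_inner T \<omega> (\<lambda>x. w)\<bar> \<le> L2_norm T \<omega> * (t * norm w)" if "square_integrable_on \<omega> T" for \<omega> w
    unfolding t_def by (rule abs_L2_inner_le[OF that]) auto
  have Kb: "\<bar>L2_inner T S (K w)\<bar> \<le> n * diam * L2_norm T S * (t * norm w)" for w
    using abs_L2_inner_le[OF square_integrable_data(3) continuous_on_lin_contract, where G="n * diam * norm w"]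
      norm_K_le diam_nonneg by (simp add: t_def n_def mult_ac)
  have Eb: "\<bar>L2_inner T D (E w)\<bar> \<le> n * diam * L2_norm T D * (t * norm w)" for w
    using abs_L2_inner_le[OF square_integrable_data(2) continuous_on_lin_wedge, where G="n * diam * norm w"]
      norm_E_le diam_nonneg by (simp add: t_def n_def mult_ac)
  have self: "w \<bullet> w = norm w * norm w" for w :: "real ^ ('n set)"
    by (simp add: dot_square_norm power2_eq_square)
  note eqs = s[unfolded solves_def]
  show "(n - real (k - 1)) * (t * norm c) \<le> L2_norm T S"
  proof (rule cancel_quadratic_bound)
    have eq: "codiff_factor CARD('n) k * vol * (c \<bullet> c) = L2_inner T S (\<lambda>x. c)" using eqs by blast
    have "(n - real (k - 1)) * ((t * norm c) * (t * norm c)) = \<bar>codiff_factor CARD('n) k * vol * (c \<bullet> c)\<bar>"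
      using k by (simp add: abs_mult abs_codiff_factor n_def t(2) self mult_ac)
    also have "\<dots> \<le> L2_norm T S * (t * norm c)" unfolding eq by (rule const[OF square_integrable_data(3)])
    finally show "(n - real (k - 1)) * ((t * norm c) * (t * norm c)) \<le> L2_norm T S * (t * norm c)" .
  qed (use t n k in \<open>auto simp: n_def\<close>)
  show "real (k + 1) * (t * norm b) \<le> L2_norm T D"
  proof (rule cancel_quadratic_bound)
    have eq: "real (k + 1) * vol * (b \<bullet> b) = L2_inner T D (\<lambda>x. b)" using eqs by blast
    have "real (k + 1) * ((t * norm b) * (t * norm b)) = \<bar>real (k + 1) * vol * (b \<bullet> b)\<bar>"
      by (simp add: abs_mult t(2) self mult_ac)
    also have "\<dots> \<le> L2_norm T D * (t * norm b)" unfolding eq by (rule const[OF square_integrable_data(2)])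
    finally show "real (k + 1) * ((t * norm b) * (t * norm b)) \<le> L2_norm T D * (t * norm b)" .
  qed (use t in auto)
  have "real k * (t * norm a) \<le> real k * L2_norm T \<mu> + n * diam * L2_norm T S"
  proof (rule cancel_quadratic_bound)
    have "real k * ((t * norm a) * (t * norm a)) = real k * vol * (a \<bullet> a)"
      by (simp add: t(2) self mult_ac)
    also have "\<dots> = real k * L2_inner T \<mu> (\<lambda>x. a) - L2_inner T S (K a)" using eqs by blast
    also have "\<dots> \<le> real k * (L2_norm T \<mu> * (t * norm a)) + n * diam * L2_norm T S * (t * norm a)"
    proof -
      have "real k * L2_inner T \<mu> (\<lambda>x. a) \<le> real k * (L2_norm T \<mu> * (t * norm a))"
        using const[OF square_integrable_data(1), of a] by (intro mult_left_mono) auto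
      then show ?thesis using Kb[of a] by linarith
    qed
    finally show "real k * ((t * norm a) * (t * norm a))
        \<le> (real k * L2_norm T \<mu> + n * diam * L2_norm T S) * (t * norm a)"
      by (simp add: algebra_simps)
  qed (use t n diam_nonneg in auto)
  also have "\<dots> \<le> real k * (L2_norm T \<mu> + n * diam * L2_norm T S)"
  proof -
    have "1 * (n * diam * L2_norm T S) \<le> real k * (n * diam * L2_norm T S)"
      using n diam_nonneg by (intro mult_right_mono) auto
    then show ?thesis by (simp add: distrib_left)
  qed
  finally show "t * norm a \<le> L2_norm T \<mu> + n * diam * L2_norm T S"
    using n by simp
  let ?G = "(8 * \<rho>) ^ (CARD('n) + 2)" and ?y = "t * diam * norm h"
  have G: "0 < ?G" using ball by simp
  have "2 / ?G * ?y \<le> n * L2_norm T D + n\<^sup>2 * L2_norm T S"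
  proof (rule cancel_quadratic_bound)
    have h: "h \<in> alt k" using eqs by blast
    have "2 / ?G * (?y * ?y) = 2 * (vol * diam\<^sup>2 * (norm h)\<^sup>2 / ?G)"
      by (simp add: t(2) power2_eq_square mult_ac)
    also have "\<dots> \<le> 2 * L2_inner T (E h) (E h)"
      by (rule mult_left_mono[OF L2_inner_E_ge[OF h k(2) ball]]) simp
    also have "\<dots> = L2_inner T D (E h) - codiff_factor CARD('n) (k + 1) * (L2_inner T \<mu> (\<lambda>x. h) - vol * (a \<bullet> h))"
      using eqs by blast
    \<comment> \<open>The decisive substitution: the equation for \<open>a\<close>, tested with
      \<open>h\<close>, replaces two terms without a length factor by a pairing with
      \<open>K h\<close>, which carries \<open>diam\<close>.\<close>
    also have "L2_inner T \<mu> (\<lambda>x. h) - vol * (a \<bullet> h) = L2_inner T S (K h) / real k"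
    proof -
      have "real k * vol * (a \<bullet> h) = real k * L2_inner T \<mu> (\<lambda>x. h) - L2_inner T S (K h)" using eqs by blast
      then have "real k * (L2_inner T \<mu> (\<lambda>x. h) - vol * (a \<bullet> h)) = L2_inner T S (K h)"
        by (simp add: algebra_simps)
      then show ?thesis using n by (simp add: field_simps)
    qed
    also have "L2_inner T D (E h) - codiff_factor CARD('n) (k + 1) * (L2_inner T S (K h) / real k)
        \<le> \<bar>L2_inner T D (E h)\<bar> + \<bar>codiff_factor CARD('n) (k + 1)\<bar> * \<bar>L2_inner T S (K h) / real k\<bar>"
      unfolding abs_mult[symmetric] by linarith
    also have "\<dots> \<le> n * diam * L2_norm T D * (t * norm h) + n * (n * diam * L2_norm T S * (t * norm h))"
    proof (intro add_mono Eb mult_mono)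
      show "\<bar>codiff_factor CARD('n) (k + 1)\<bar> \<le> n"
        using k by (simp add: abs_codiff_factor n_def)
      have "\<bar>L2_inner T S (K h) / real k\<bar> \<le> \<bar>L2_inner T S (K h)\<bar> / 1"
        unfolding abs_divide using n by (intro divide_left_mono) auto
      then show "\<bar>L2_inner T S (K h) / real k\<bar> \<le> n * diam * L2_norm T S * (t * norm h)"
        using Kb[of h] by simp
    qed (use n in auto)
    finally show "2 / ?G * (?y * ?y) \<le> (n * L2_norm T D + n\<^sup>2 * L2_norm T S) * ?y"
      by (simp add: algebra_simps power2_eq_square)
  qed (use t n diam_nonneg G in auto)
  then have "2 * ?y \<le> ?G * (n * L2_norm T D + n\<^sup>2 * L2_norm T S)"
    using G by (simp add: field_simps)
  moreover have "0 \<le> ?y" using t diam_nonneg by simp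
  ultimately show "?y \<le> ?G * (n * L2_norm T D + n\<^sup>2 * L2_norm T S)" by linarith
qed

text \<open>In the constant, 3 collects one share from each norm on the left;
  \<open>3 * n * H\<close> stems from the bounds for \<open>a\<close>, \<open>K b\<close> and
  \<open>E c\<close>, \<open>n ^ 3 * H * G\<close> from the quadratic part, and
  \<open>2 * n ^ 3 * G\<close> from the term \<open>2 *\<^sub>R E h x\<close> of the
  derivative.\<close>

lemma interpolator_bound:
  assumes ball: "cball z r \<subseteq> T" "0 < r" "diam \<le> 2 * \<rho> * r" "0 < \<rho>" and H: "diam \<le> H"
  defines "n \<equiv> real CARD('n)" and "G \<equiv> (8 * \<rho>) ^ (CARD('n) + 2)"
  shows "L2_norm T (interpolator T k \<mu>) + L2_norm T (weak_d T k (interpolator T k \<mu>))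
      + L2_norm T (codiff T k (interpolator T k \<mu>))
    \<le> (3 + 3 * n * H + n ^ 3 * H * G + 2 * n ^ 3 * G) * (L2_norm T \<mu> + L2_norm T D + L2_norm T S)"
proof -
  obtain a b c h where s: "solves a b c h" and p: "interpolator T k \<mu> = poly_form T a b c h"
    using interpolator_eq by blast
  define t where "t = sqrt vol"
  define N where "N = L2_norm T \<mu> + L2_norm T D + L2_norm T S"
  have pos: "0 \<le> t" "0 \<le> n" "0 \<le> N" "0 \<le> G" "0 \<le> H" "1 \<le> n"
    using vol_pos ball H diam_nonneg k by (auto simp: t_def n_def N_def G_def)
  have le: "L2_norm T \<mu> + L2_norm T S \<le> N" "L2_norm T \<mu> \<le> N" "L2_norm T D \<le> N" "L2_norm T S \<le> N" "L2_norm T D + L2_norm T S \<le> N"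
    by (simp_all add: N_def)
  note bounds = solution_bounds[OF s ball, folded t_def n_def G_def]
  have c': "(n - real (k - 1)) * (t * norm c) \<le> N" using bounds(1) le by linarith
  have c: "t * norm c \<le> N"
  proof -
    have "1 * (t * norm c) \<le> (n - real (k - 1)) * (t * norm c)"
      using pos k by (intro mult_right_mono) (auto simp: n_def)
    with c' show ?thesis by linarith
  qed
  have b': "real (k + 1) * (t * norm b) \<le> N" using bounds(2) le by linarith
  have b: "t * norm b \<le> N"
  proof -
    have "1 * (t * norm b) \<le> real (k + 1) * (t * norm b)"
      using pos by (intro mult_right_mono) auto
    with b' show ?thesis by linarith
  qed
  have a: "t * norm a \<le> N + n * H * N"
  proof -
    have "n * diam * L2_norm T S \<le> n * H * N"
      using pos H le diam_nonneg by (intro mult_mono) auto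
    then show ?thesis using bounds(3) le by linarith
  qed
  have h: "t * diam * norm h \<le> G * (n\<^sup>2 * N)"
  proof -
    have "n * 1 \<le> n * n" using pos by (intro mult_left_mono) auto
    then have "n * L2_norm T D \<le> n\<^sup>2 * L2_norm T D"
      by (intro mult_right_mono) (auto simp: power2_eq_square)
    then have "n * L2_norm T D + n\<^sup>2 * L2_norm T S \<le> n\<^sup>2 * (L2_norm T D + L2_norm T S)"
      by (simp add: distrib_left)
    also have "\<dots> \<le> n\<^sup>2 * N" using le by (intro mult_left_mono) auto
    finally show ?thesis using bounds(4) pos by (meson mult_left_mono order_trans)
  qed
  have mem: "a \<in> alt k" "b \<in> alt (k + 1)" "c \<in> alt (k - 1)" "h \<in> alt k"
    using s by (auto simp: solves_def)
  have dxc: "dx_wedge i c \<in> alt k" for i using dx_wedge_alt[OF mem(3), of i] k by simp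
  have diamH: "diam * x \<le> H * x" if "0 \<le> x" for x using H that by (rule mult_right_mono)
  have 1: "L2_norm T (poly_form T a b c h) \<le> N + 3 * n * H * N + n ^ 3 * H * G * N"
  proof -
    have "L2_norm T (poly_form T a b c h)
      \<le> t * (norm a + n * diam * norm b + n * diam * norm c + n * diam\<^sup>2 * norm h)"
      unfolding t_def
    proof (rule L2_norm_le[OF continuous_on_poly_form])
      fix x assume x: "x \<in> T"
      have "norm (poly_form T a b c h x) \<le> norm a + norm (K b x) + norm (E c x) + norm (quad T h x)"
        unfolding poly_form_def by (intro norm_triangle_le add_mono order_refl)
      then show "norm (poly_form T a b c h x)
          \<le> norm a + n * diam * norm b + n * diam * norm c + n * diam\<^sup>2 * norm h"
        using norm_K_le[OF x, of b] norm_E_le[OF x, of c] norm_quad_le[OF x, of h] by (simp add: n_def)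
    qed (use pos diam_nonneg in auto)
    \<comment> \<open>Of the two factors \<open>diam\<close> of the quadratic part, one belongs to
      the bound for \<open>h\<close>; the other is estimated by \<open>H\<close>.\<close>
    also have "\<dots> = t * norm a + n * (diam * (t * norm b)) + n * (diam * (t * norm c))
        + n * (diam * (t * diam * norm h))"
      by (simp add: algebra_simps power2_eq_square)
    also have "\<dots> \<le> (N + n * H * N) + n * (H * N) + n * (H * N) + n * (H * (G * (n\<^sup>2 * N)))"
      by (intro add_mono mult_left_mono mult_mono a b c h pos H) (use pos diam_nonneg in auto)
    finally show ?thesis by (simp add: algebra_simps power2_eq_square power3_eq_cube)
  qed
  have 2: "L2_norm T (weak_d T k (poly_form T a b c h)) \<le> N + 2 * n ^ 3 * G * N"
  proof -
    have "L2_norm T (weak_d T k (poly_form T a b c h)) = L2_norm T (\<lambda>x. real (k + 1) *\<^sub>R b + 2 *\<^sub>R E h x)"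
      by (intro L2_norm_cong weak_d_poly_form[OF mem(2) dxc mem(4)] continuous_intros continuous_on_lin_wedge)
    also have "\<dots> \<le> t * (real (k + 1) * norm b + 2 * (n * diam * norm h))"
      unfolding t_def
    proof (rule L2_norm_le)
      fix x assume x: "x \<in> T"
      have "norm (real (k + 1) *\<^sub>R b + 2 *\<^sub>R E h x) \<le> norm (real (k + 1) *\<^sub>R b) + norm (2 *\<^sub>R E h x)"
        by (rule norm_triangle_ineq)
      then show "norm (real (k + 1) *\<^sub>R b + 2 *\<^sub>R E h x) \<le> real (k + 1) * norm b + 2 * (n * diam * norm h)"
        using norm_E_le[OF x, of h] by (simp add: n_def)
    qed (use pos diam_nonneg in \<open>auto intro!: continuous_intros continuous_on_lin_wedge\<close>)
    also have "\<dots> = real (k + 1) * (t * norm b) + 2 * n * (t * diam * norm h)"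
      by (simp add: algebra_simps)
    also have "\<dots> \<le> N + 2 * n * (G * (n\<^sup>2 * N))"
      by (intro add_mono mult_left_mono b' h) (use pos in auto)
    finally show ?thesis by (simp add: algebra_simps power2_eq_square power3_eq_cube)
  qed
  have 3: "L2_norm T (codiff T k (poly_form T a b c h)) \<le> N"
  proof -
    have "L2_norm T (codiff T k (poly_form T a b c h)) = L2_norm T (\<lambda>x. codiff_factor CARD('n) k *\<^sub>R c)"
      by (intro L2_norm_cong codiff_poly_form[OF mem(2,3,4) k(1)] continuous_intros)
    also have "\<dots> \<le> t * ((n - real (k - 1)) * norm c)"
      unfolding t_def by (rule L2_norm_le) (use k in \<open>auto simp: abs_codiff_factor n_def\<close>)
    also have "\<dots> \<le> N" using c' by (simp add: mult_ac)
    finally show ?thesis .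
  qed
  have "(3 + 3 * n * H + n ^ 3 * H * G + 2 * n ^ 3 * G) * N
      = (N + 3 * n * H * N + n ^ 3 * H * G * N) + (N + 2 * n ^ 3 * G * N) + N"
    by (simp add: algebra_simps)
  with 1 2 3 show ?thesis unfolding p N_def[symmetric] by linarith
qed

end

theorem lemma2p7:
  fixes k :: nat and \<rho> h :: real
  assumes "CARD('n::{finite,linorder}) \<ge> 2" and "1 \<le> k" and "k \<le> CARD('n) - 1"
  shows "\<exists>C>0. \<forall>T :: (real ^ 'n::{finite,linorder}) set.
           int CARD('n) simplex T \<and> shape_ratio T \<le> \<rho> \<and> diameter T \<le> h \<longrightarrow>
           (\<forall>\<mu> \<in> HLambda T k \<inter> HstarLambda T k.
              L2_norm T (interpolator T k \<mu>)
                + L2_norm T (weak_d T k (interpolator T k \<mu>))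
                + L2_norm T (codiff T k (interpolator T k \<mu>))
              \<le> C * (L2_norm T \<mu> + L2_norm T (weak_d T k \<mu>) + L2_norm T (codiff T k \<mu>)))"
proof (intro exI[of _ "3 + 3 * real CARD('n) * max h 0
      + real CARD('n) ^ 3 * max h 0 * (8 * max \<rho> 1) ^ (CARD('n) + 2)
      + 2 * real CARD('n) ^ 3 * (8 * max \<rho> 1) ^ (CARD('n) + 2)"] conjI allI impI ballI)
  \<comment> \<open>\<open>\<rho>\<close> and \<open>h\<close> are arbitrary reals. Passing to
    \<open>max \<rho> 1\<close> and \<open>max h 0\<close> only weakens the bounds on
    \<open>T\<close>, and makes the constant positive for every choice of them.\<close>
  have "0 \<le> 3 * real CARD('n) * max h 0" "0 \<le> real CARD('n) ^ 3 * max h 0 * (8 * max \<rho> 1) ^ (CARD('n) + 2)"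
    "0 \<le> 2 * real CARD('n) ^ 3 * (8 * max \<rho> 1) ^ (CARD('n) + 2)"
    by (intro mult_nonneg_nonneg zero_le_power; simp)+
  then show "0 < 3 + 3 * real CARD('n) * max h 0
      + real CARD('n) ^ 3 * max h 0 * (8 * max \<rho> 1) ^ (CARD('n) + 2)
      + 2 * real CARD('n) ^ 3 * (8 * max \<rho> 1) ^ (CARD('n) + 2)" by linarith
  fix T :: "(real ^ 'n::{finite,linorder}) set" and \<mu>
  assume T: "int CARD('n) simplex T \<and> shape_ratio T \<le> \<rho> \<and> diameter T \<le> h"
    and \<mu>: "\<mu> \<in> HLambda T k \<inter> HstarLambda T k"
  interpret interpolation T k \<mu>
    by unfold_locales
       (use T \<mu> assms compact_simplex convex_simplex simplex_interior_nonempty[OF T[THEN conjunct1]] in auto)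
  have "bounded T" "shape_ratio T \<le> max \<rho> 1" "0 < max \<rho> 1"
    using T compact compact_imp_bounded by auto
  then obtain z r where "0 < r" "cball z r \<subseteq> T" "diameter T \<le> 2 * max \<rho> 1 * r"
    by (rule inscribed_ball[OF _ interior])
  then show "L2_norm T (interpolator T k \<mu>)
                + L2_norm T (weak_d T k (interpolator T k \<mu>))
                + L2_norm T (codiff T k (interpolator T k \<mu>))
      \<le> (3 + 3 * real CARD('n) * max h 0
      + real CARD('n) ^ 3 * max h 0 * (8 * max \<rho> 1) ^ (CARD('n) + 2)
      + 2 * real CARD('n) ^ 3 * (8 * max \<rho> 1) ^ (CARD('n) + 2))
      * (L2_norm T \<mu> + L2_norm T (weak_d T k \<mu>) + L2_norm T (codiff T k \<mu>))"
    using T by (intro interpolator_bound) auto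
qed

end
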